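(* Let $M$ be a skew-symmetric invertible $4\times4$ complex matrix and let $\alpha_M={}^tZ\,M\,dZ$ be the corresponding holomorphic twist form, with associated $SU(3)$-structure $(\Omega_M,\omega_M)$ on $\mathbb{CP}^3$. Denote by $\lambda_M$ the smooth complex function and by $\eta_M$ the $(1,0)$-form given by $$d\alpha_M=\lambda_M\,\alpha_M\cdot\Omega_M+\alpha_M\wedge\eta_M .$$ Then the torsion classes of $(\Omega_M,\omega_M)$ are $$W_1=\tfrac43\overline{\lambda_M},$$ $$W_2\wedge\omega_M=\frac{W_1}{2}\Big(\omega_M+\frac{3i}{2\|\alpha_M\|^2}\alpha_M\wedge\overline{\alpha_M}\Big)\wedge\omega_M+\frac{i\overline{\lambda_M}}{\|\alpha_M\|^2}\alpha_M\wedge\overline{\alpha_M}\wedge\omega_0+\frac{1}{\lambda_M\|\alpha_M\|^2}\alpha_M\wedge\overline{\alpha_M}\wedge d\eta_M,$$ $$W_3=\mathrm{Re}(\eta_M)\wedge\Big(\omega_M+\frac{i}{\|\alpha_M\|^2}\alpha_M\wedge\overline{\alpha_M}\Big),\qquad W_4=-\mathrm{Re}(\eta_M),\qquad W_5=-2\,\mathrm{Re}(\eta_M).$$ Moreover, the structure is LT, i.e. $W_3=W_4=W_5=0$, if and only if there exists $\mu\in\mathbb R$ such that $M^*M=\mu I_4$, and in this case $$W_2=\frac{W_1}{2}\Big(\omega_M+\frac{3i}{2\|\alpha_M\|^2}\alpha_M\wedge\overline{\alpha_M}\Big).$$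
   Context: On $\mathbb C^4$: $\omega_0=\frac i2\sum_jdz_j\wedge d\overline{z_j}$, $\Omega_0=dz_1\wedge\cdots\wedge dz_4$, $\xi=\sum_jz_j\partial_{z_j}$, standard Hermitian metric; $M^*$ is the conjugate transpose and $\alpha_M=\sum_{i,j}z_im_{ij}dz_j$. Contraction: for a $(1,0)$-form $\alpha=\sum_ja_jdz_j$, $\overline\alpha\cdot$ is contraction by $\overline\alpha^\sharp=\sum_j\overline{a_j}\,\partial_{z_j}$, and $\alpha\cdot$ is contraction by its conjugate $\alpha^\sharp=\sum_ja_j\,\partial_{\overline z_j}$. $\|\alpha\|^2=\overline\alpha\cdot\alpha=\sum_j|a_j|^2$. The $SU(3)$-structure on $\mathbb{CP}^3$ is given by $$\Omega_M=\frac1{\|\alpha_M\|^2}\overline{\alpha_M}\wedge\hat\Omega_M,\quad \hat\Omega_M=\overline{\alpha_M}\cdot(\iota_\xi\Omega_0),\quad \omega_M=\omega_0-\frac{i}{\|\alpha_M\|^2}\alpha_M\wedge\overline{\alpha_M},$$ where these forms are restricted to the unit sphere $S^7\subset\mathbb C^4$ and descend to $\mathbb{CP}^3=S^7/S^1$; all identities are understood on $S^7$ (basic forms being identified with forms on $\mathbb{CP}^3$). One has $\alpha_M\cdot\Omega_M=\hat\Omega_M$. The form $\eta_M$ in the decomposition of $d\alpha_M$ is the one given by $\eta_M=\frac{\overline{\alpha_M}\cdot d\alpha_M}{\|\alpha_M\|^2}$. Torsion classes: for an $SU(3)$-structure $(\Omega,\omega)$ (that is, $\omega$ a nondegenerate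 real $2$-form, $\Omega$ a locally decomposable nowhere-vanishing complex $3$-form, $\Omega\wedge\omega=0$, $\Omega\wedge\overline\Omega=c_3\omega^3$ with $c_3=\frac{2^3}{3!}(-i)^9$), the torsion classes $W_1,\dots,W_5$ are defined by $$d\omega=\tfrac32\mathrm{Im}(\overline{W_1}\Omega)+W_4\wedge\omega+W_3,\qquad d\Omega=W_1\omega^2+W_2\wedge\omega+\overline{W_5}\wedge\Omega,$$ where, with respect to the almost complex structure for which $\Omega$ is of type $(3,0)$, $W_1$ is a smooth complex function, $W_2$ is a primitive $(1,1)$-form, $W_3$ is a real primitive $(1,2)+(2,1)$-form, $W_4$ is a real $(1,0)+(0,1)$-form and $W_5$ is a complex $(1,0)$-form. The formula for $W_5$ is understood through the term $\overline{W_5}\wedge\Omega$, i.e. modulo $(0,1)$-forms (whose conjugates wedge to zero with $\Omega$). *)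

theory Defs
  imports "HOL-Analysis.Analysis" "HOL-Library.Function_Algebras"
begin

section \<open>Complex-valued differential forms on \<open>C\<^sup>4\<close>\<close>

text \<open>
  A complex-valued exterior form on the real vector space underlying \<open>C\<^sup>4\<close> is a function on lists of
  vectors: its component of degree \<open>k\<close> is its restriction to lists of length \<open>k\<close>, so a homogeneous
  form of degree \<open>k\<close> vanishes on all lists of another length. A differential form assigns such an
  exterior form to every point. Sums, differences and zero are those of the function space.
\<close>

type_synonym form = "complex^4 \<Rightarrow> (complex^4) list \<Rightarrow> complex"

definition alt_form :: "nat \<Rightarrow> ((complex^4) list \<Rightarrow> complex) \<Rightarrow> bool" where
  "alt_form k \<beta> \<longleftrightarrow>
     (\<forall>vs. length vs \<noteq> k \<longrightarrow> \<beta> vs = 0) \<and>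
     (\<forall>us vs. linear (\<lambda>v. \<beta> (us @ v # vs))) \<and>
     (\<forall>vs. \<not> distinct vs \<longrightarrow> \<beta> vs = 0)"

primrec C_on :: "nat \<Rightarrow> (complex^4) set \<Rightarrow> (complex^4 \<Rightarrow> complex) \<Rightarrow> bool" where
  "C_on 0 S f \<longleftrightarrow> continuous_on S f"
| "C_on (Suc k) S f \<longleftrightarrow>
     (\<forall>x\<in>S. f differentiable (at x)) \<and> (\<forall>v. C_on k S (\<lambda>x. frechet_derivative f (at x) v))"

text \<open>Only used for open sets \<open>S\<close>; smoothness is with respect to the real structure.\<close>

definition smooth_on :: "(complex^4) set \<Rightarrow> (complex^4 \<Rightarrow> complex) \<Rightarrow> bool" where
  "smooth_on S f \<longleftrightarrow> (\<forall>k. C_on k S f)"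

definition smooth_form_on :: "(complex^4) set \<Rightarrow> nat \<Rightarrow> form \<Rightarrow> bool" where
  "smooth_form_on S k \<beta> \<longleftrightarrow>
     (\<forall>z\<in>S. alt_form k (\<beta> z)) \<and> (\<forall>vs. smooth_on S (\<lambda>z. \<beta> z vs))"

text \<open>
  The wedge product is given by the shuffle formula: \<open>I\<close> is the set of positions of the arguments
  handed to the first factor, and the exponent counts the inversions of the corresponding shuffle.
\<close>

definition wedge :: "form \<Rightarrow> form \<Rightarrow> form" (infixr "\<and>\<^sub>f" 70) where
  "(\<beta> \<and>\<^sub>f \<gamma>) z vs =
     (\<Sum>I\<in>Pow {..<length vs}.
        (-1) ^ card {(i, j). i \<in> I \<and> j < i \<and> j \<notin> I} * \<beta> z (nths vs I) * \<gamma> z (nths vs (- I)))"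

definition scale_form :: "(complex^4 \<Rightarrow> complex) \<Rightarrow> form \<Rightarrow> form" (infixr "*\<^sub>f" 75) where
  "(f *\<^sub>f \<beta>) z vs = f z * \<beta> z vs"

definition cnj_form :: "form \<Rightarrow> form" where
  "cnj_form \<beta> z vs = cnj (\<beta> z vs)"

definition Re_form :: "form \<Rightarrow> form" where
  "Re_form \<beta> z vs = complex_of_real (Re (\<beta> z vs))"

definition Im_form :: "form \<Rightarrow> form" where
  "Im_form \<beta> z vs = complex_of_real (Im (\<beta> z vs))"

text \<open>
  The exterior derivative in the flat coordinates of \<open>C\<^sup>4\<close>: the vectors in \<open>vs\<close> are extended as
  constant, hence commuting, vector fields.
\<close>

definition ext_d :: "form \<Rightarrow> form" where
  "ext_d \<beta> z vs =
     (\<Sum>i<length vs.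
        (-1) ^ i * frechet_derivative (\<lambda>w. \<beta> w (nths vs (- {i}))) (at z) (vs ! i))"

definition dz :: "4 \<Rightarrow> form" where
  "dz j z vs = (case vs of [v] \<Rightarrow> v $ j | _ \<Rightarrow> 0)"

text \<open>
  Contractions by \<open>\<partial>/\<partial>z\<^sub>j = (\<partial>/\<partial>x\<^sub>j - i \<partial>/\<partial>y\<^sub>j)/2\<close> and \<open>\<partial>/\<partial>(cnj z\<^sub>j) = (\<partial>/\<partial>x\<^sub>j + i \<partial>/\<partial>y\<^sub>j)/2\<close>,
  the forms being extended complex linearly to complex vectors.
\<close>

definition contr_dz :: "4 \<Rightarrow> form \<Rightarrow> form" where
  "contr_dz j \<beta> z vs = (\<beta> z (axis j 1 # vs) - \<i> * \<beta> z (axis j \<i> # vs)) / 2"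

definition contr_dzbar :: "4 \<Rightarrow> form \<Rightarrow> form" where
  "contr_dzbar j \<beta> z vs = (\<beta> z (axis j 1 # vs) + \<i> * \<beta> z (axis j \<i> # vs)) / 2"

text \<open>
  For a \<open>(1,0)\<close>-form \<open>\<alpha> = \<Sum>\<^sub>j a\<^sub>j dz\<^sub>j\<close> the coefficient \<open>a\<^sub>j\<close> is \<open>contr_dz j \<alpha> z []\<close>;
  \<open>bar_contract \<alpha>\<close> contracts by \<open>\<Sum>\<^sub>j cnj a\<^sub>j \<partial>/\<partial>z\<^sub>j\<close> and \<open>contract \<alpha>\<close> by its conjugate.
\<close>

definition bar_contract :: "form \<Rightarrow> form \<Rightarrow> form" where
  "bar_contract \<alpha> \<beta> z vs = (\<Sum>j\<in>UNIV. cnj (contr_dz j \<alpha> z []) * contr_dz j \<beta> z vs)"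

definition contract :: "form \<Rightarrow> form \<Rightarrow> form" where
  "contract \<alpha> \<beta> z vs = (\<Sum>j\<in>UNIV. contr_dz j \<alpha> z [] * contr_dzbar j \<beta> z vs)"

definition norm_sq :: "form \<Rightarrow> complex^4 \<Rightarrow> complex" where
  "norm_sq \<alpha> z = bar_contract \<alpha> \<alpha> z []"

definition contr_xi :: "form \<Rightarrow> form" where
  "contr_xi \<beta> z vs = (\<Sum>j\<in>UNIV. z $ j * contr_dz j \<beta> z vs)"

definition omega0 :: form where
  "omega0 z vs = \<i> / 2 * (\<Sum>j\<in>UNIV. (dz j \<and>\<^sub>f cnj_form (dz j)) z vs)"

definition Omega0 :: form where
  "Omega0 = dz 1 \<and>\<^sub>f dz 2 \<and>\<^sub>f dz 3 \<and>\<^sub>f dz 4"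


section \<open>Forms on \<open>S\<^sup>7\<close> and on \<open>CP\<^sup>3\<close>\<close>

text \<open>
  Forms on the unit sphere \<open>S\<^sup>7\<close> are represented by smooth forms on \<open>C\<^sup>4 - {0}\<close> (every smooth form on
  \<open>S\<^sup>7\<close> is the restriction of one), two of them being identified when they agree on vectors tangent
  to the sphere. Since pullback to the sphere commutes with \<open>d\<close>, the exterior derivative on \<open>S\<^sup>7\<close> is
  represented by \<^const>\<open>ext_d\<close>. The vectors tangent to \<open>S\<^sup>7\<close> at \<open>z\<close> are those orthogonal to \<open>z\<close> for the
  real inner product; the kernel of \<open>S\<^sup>7 \<rightarrow> CP\<^sup>3\<close> is spanned by \<open>iz\<close>, so that the tangent space
  of \<open>CP\<^sup>3\<close> is identified with the orthogonal complement of \<open>z\<close> and \<open>iz\<close>.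
\<close>

abbreviation S7 :: "(complex^4) set" where
  "S7 \<equiv> sphere 0 1"

definition tangent :: "complex^4 \<Rightarrow> (complex^4) set" where
  "tangent z = {v. z \<bullet> v = 0}"

definition horizontal :: "complex^4 \<Rightarrow> (complex^4) set" where
  "horizontal z = {v. z \<bullet> v = 0 \<and> (\<i> *s z) \<bullet> v = 0}"

definition eq_forms_on :: "(complex^4) set \<Rightarrow> form \<Rightarrow> form \<Rightarrow> bool" where
  "eq_forms_on U \<beta> \<gamma> \<longleftrightarrow> (\<forall>z\<in>S7 \<inter> U. \<forall>vs. set vs \<subseteq> tangent z \<longrightarrow> \<beta> z vs = \<gamma> z vs)"

abbreviation eq_forms :: "form \<Rightarrow> form \<Rightarrow> bool" (infix "=\<^sub>S" 50) where
  "\<beta> =\<^sub>S \<gamma> \<equiv> eq_forms_on UNIV \<beta> \<gamma>"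

definition basic :: "form \<Rightarrow> bool" where
  "basic \<beta> \<longleftrightarrow> (\<forall>z\<in>S7. \<forall>vs. set vs \<subseteq> tangent z \<longrightarrow>
     \<beta> z ((\<i> *s z) # vs) = 0 \<and>
     (\<forall>c. cmod c = 1 \<longrightarrow> \<beta> (c *s z) (map (\<lambda>v. c *s v) vs) = \<beta> z vs))"

definition CP3_form :: "nat \<Rightarrow> form \<Rightarrow> bool" where
  "CP3_form k \<beta> \<longleftrightarrow> smooth_form_on (- {0}) k \<beta> \<and> basic \<beta>"

definition CP3_function :: "(complex^4 \<Rightarrow> complex) \<Rightarrow> bool" where
  "CP3_function f \<longleftrightarrow> smooth_on (- {0}) f \<and> (\<forall>z\<in>S7. \<forall>c. cmod c = 1 \<longrightarrow> f (c *s z) = f z)"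

definition real_form :: "form \<Rightarrow> bool" where
  "real_form \<beta> \<longleftrightarrow> cnj_form \<beta> =\<^sub>S \<beta>"


section \<open>\<open>SU(3)\<close>-structures and their torsion classes\<close>

text \<open>
  The factors \<open>\<theta>\<^sub>i\<close> are only asked to be forms on an open subset of \<open>S\<^sup>7\<close>: if \<open>\<Omega>\<close> is basic and does not
  vanish, they are automatically horizontal, and pulling them back by a local section of
  \<open>S\<^sup>7 \<rightarrow> CP\<^sup>3\<close> gives a decomposition on an open subset of \<open>CP\<^sup>3\<close>.
\<close>

definition locally_decomposable :: "form \<Rightarrow> bool" where
  "locally_decomposable \<Omega> \<longleftrightarrow> (\<forall>z\<in>S7. \<exists>U \<theta>\<^sub>1 \<theta>\<^sub>2 \<theta>\<^sub>3. open U \<and> z \<in> U \<and>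
     smooth_form_on U 1 \<theta>\<^sub>1 \<and> smooth_form_on U 1 \<theta>\<^sub>2 \<and> smooth_form_on U 1 \<theta>\<^sub>3 \<and>
     eq_forms_on U \<Omega> (\<theta>\<^sub>1 \<and>\<^sub>f \<theta>\<^sub>2 \<and>\<^sub>f \<theta>\<^sub>3))"

definition nowhere_vanishing :: "form \<Rightarrow> bool" where
  "nowhere_vanishing \<Omega> \<longleftrightarrow> (\<forall>z\<in>S7. \<exists>vs. set vs \<subseteq> horizontal z \<and> \<Omega> z vs \<noteq> 0)"

definition nondegenerate :: "form \<Rightarrow> bool" where
  "nondegenerate \<omega> \<longleftrightarrow>
     (\<forall>z\<in>S7. \<forall>u\<in>horizontal z. (\<forall>v\<in>horizontal z. \<omega> z [u, v] = 0) \<longrightarrow> u = 0)"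

definition SU3_structure :: "form \<Rightarrow> form \<Rightarrow> bool" where
  "SU3_structure \<Omega> \<omega> \<longleftrightarrow>
     CP3_form 3 \<Omega> \<and> locally_decomposable \<Omega> \<and> nowhere_vanishing \<Omega> \<and>
     CP3_form 2 \<omega> \<and> real_form \<omega> \<and> nondegenerate \<omega> \<and>
     \<Omega> \<and>\<^sub>f \<omega> =\<^sub>S 0 \<and>
     \<Omega> \<and>\<^sub>f cnj_form \<Omega> =\<^sub>S (\<lambda>_. 2 ^ 3 / fact 3 * (- \<i>) ^ 9) *\<^sub>f (\<omega> \<and>\<^sub>f \<omega> \<and>\<^sub>f \<omega>)"

text \<open>
  A pair \<open>(x, y)\<close> stands for the complex tangent vector \<open>x + iy\<close>, and \<open>complexify \<beta>\<close> is the complex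
  multilinear extension of \<open>\<beta>\<close>. The almost complex structure for which \<open>\<Omega>\<close> is of type \<open>(3,0)\<close> is the one
  whose \<open>(0,1)\<close>-vectors are the complex tangent vectors of \<open>CP\<^sup>3\<close> annihilating \<open>\<Omega>\<close>.
\<close>

fun complexify :: "((complex^4) list \<Rightarrow> complex) \<Rightarrow> ((complex^4) \<times> (complex^4)) list \<Rightarrow> complex" where
  "complexify \<beta> [] = \<beta> []"
| "complexify \<beta> ((x, y) # ws) =
     complexify (\<lambda>vs. \<beta> (x # vs)) ws + \<i> * complexify (\<lambda>vs. \<beta> (y # vs)) ws"

definition T01 :: "form \<Rightarrow> complex^4 \<Rightarrow> ((complex^4) \<times> (complex^4)) set" where
  "T01 \<Omega> z = {(x, y). x \<in> horizontal z \<and> y \<in> horizontal z \<and>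
     (\<forall>vs. set vs \<subseteq> horizontal z \<longrightarrow> \<Omega> z (x # vs) + \<i> * \<Omega> z (y # vs) = 0)}"

definition T10 :: "form \<Rightarrow> complex^4 \<Rightarrow> ((complex^4) \<times> (complex^4)) set" where
  "T10 \<Omega> z = {(x, y). (x, - y) \<in> T01 \<Omega> z}"

text \<open>
  \<open>of_type \<Omega> P \<beta>\<close>: with respect to this almost complex structure, \<open>\<beta>\<close> is a sum of forms of the types
  \<open>(p,q)\<close> in \<open>P\<close>.
\<close>

definition of_type :: "form \<Rightarrow> (nat \<times> nat) set \<Rightarrow> form \<Rightarrow> bool" where
  "of_type \<Omega> P \<beta> \<longleftrightarrow>
     (\<forall>z\<in>S7. \<forall>us vs. set us \<subseteq> T10 \<Omega> z \<longrightarrow> set vs \<subseteq> T01 \<Omega> z \<longrightarrow>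
        (length us, length vs) \<notin> P \<longrightarrow> complexify (\<beta> z) (us @ vs) = 0)"

text \<open>
  In real dimension \<open>6\<close>, a form of degree \<open>k \<le> 3\<close> is primitive if its product with \<open>\<omega>\<^sup>4\<^sup>-\<^sup>k\<close> vanishes.
\<close>

definition primitive :: "form \<Rightarrow> nat \<Rightarrow> form \<Rightarrow> bool" where
  "primitive \<omega> k \<beta> \<longleftrightarrow> ((\<lambda>\<gamma>. \<omega> \<and>\<^sub>f \<gamma>) ^^ (4 - k)) \<beta> =\<^sub>S 0"

definition torsion_classes ::
  "form \<Rightarrow> form \<Rightarrow> (complex^4 \<Rightarrow> complex) \<Rightarrow> form \<Rightarrow> form \<Rightarrow> form \<Rightarrow> form \<Rightarrow> bool" where
  "torsion_classes \<Omega> \<omega> W\<^sub>1 W\<^sub>2 W\<^sub>3 W\<^sub>4 W\<^sub>5 \<longleftrightarrow>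
     SU3_structure \<Omega> \<omega> \<and>
     CP3_function W\<^sub>1 \<and>
     CP3_form 2 W\<^sub>2 \<and> of_type \<Omega> {(1, 1)} W\<^sub>2 \<and> primitive \<omega> 2 W\<^sub>2 \<and>
     CP3_form 3 W\<^sub>3 \<and> real_form W\<^sub>3 \<and> of_type \<Omega> {(1, 2), (2, 1)} W\<^sub>3 \<and> primitive \<omega> 3 W\<^sub>3 \<and>
     CP3_form 1 W\<^sub>4 \<and> real_form W\<^sub>4 \<and> of_type \<Omega> {(1, 0), (0, 1)} W\<^sub>4 \<and>
     CP3_form 1 W\<^sub>5 \<and> of_type \<Omega> {(1, 0)} W\<^sub>5 \<and>
     ext_d \<omega> =\<^sub>S
       (\<lambda>_. 3 / 2) *\<^sub>f Im_form ((\<lambda>z. cnj (W\<^sub>1 z)) *\<^sub>f \<Omega>) + W\<^sub>4 \<and>\<^sub>f \<omega> + W\<^sub>3 \<and>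
     ext_d \<Omega> =\<^sub>S
       W\<^sub>1 *\<^sub>f (\<omega> \<and>\<^sub>f \<omega>) + W\<^sub>2 \<and>\<^sub>f \<omega> + cnj_form W\<^sub>5 \<and>\<^sub>f \<Omega>"


section \<open>The structure associated with a skew-symmetric matrix\<close>

definition conj_transpose :: "complex^4^4 \<Rightarrow> complex^4^4" where
  "conj_transpose M = (\<chi> i j. cnj (M $ j $ i))"

definition alphaM :: "complex^4^4 \<Rightarrow> form" where
  "alphaM M z vs = (\<Sum>i\<in>UNIV. \<Sum>j\<in>UNIV. z $ i * M $ i $ j * dz j z vs)"

text \<open>The function \<open>\<parallel>\<alpha>\<^sub>M\<parallel>\<^sup>-\<^sup>2\<close>, which is real-valued.\<close>

definition inv_norm_sq :: "complex^4^4 \<Rightarrow> complex^4 \<Rightarrow> complex" where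
  "inv_norm_sq M z = 1 / norm_sq (alphaM M) z"

definition alpha_alphabar :: "complex^4^4 \<Rightarrow> form" where
  "alpha_alphabar M = alphaM M \<and>\<^sub>f cnj_form (alphaM M)"

definition hatOmegaM :: "complex^4^4 \<Rightarrow> form" where
  "hatOmegaM M = bar_contract (alphaM M) (contr_xi Omega0)"

definition OmegaM :: "complex^4^4 \<Rightarrow> form" where
  "OmegaM M = inv_norm_sq M *\<^sub>f (cnj_form (alphaM M) \<and>\<^sub>f hatOmegaM M)"

definition omegaM :: "complex^4^4 \<Rightarrow> form" where
  "omegaM M = omega0 - (\<lambda>z. \<i> * inv_norm_sq M z) *\<^sub>f alpha_alphabar M"

definition etaM :: "complex^4^4 \<Rightarrow> form" where
  "etaM M = inv_norm_sq M *\<^sub>f bar_contract (alphaM M) (ext_d (alphaM M))"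

text \<open>
  \<open>lam\<close> represents \<open>\<lambda>\<^sub>M\<close>; the equation determines it on \<open>S\<^sup>7\<close>.
\<close>

definition is_lambdaM :: "complex^4^4 \<Rightarrow> (complex^4 \<Rightarrow> complex) \<Rightarrow> bool" where
  "is_lambdaM M lam \<longleftrightarrow> smooth_on (- {0}) lam \<and>
     ext_d (alphaM M) =\<^sub>S lam *\<^sub>f contract (alphaM M) (OmegaM M) + alphaM M \<and>\<^sub>f etaM M"

end

theory Submission
  imports Defs
begin

text \<open>
  Write \<open>m(u,v) = \<Sum>u\<^sub>iM\<^sub>i\<^sub>jv\<^sub>j\<close>. Then \<open>\<alpha>\<close> at \<open>z\<close> is \<open>m(z,\<cdot>)\<close>, and \<open>d\<alpha> = 2m\<close>. Let \<open>b\<close> be the vector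
  dual to \<open>\<alpha>\<close> for the Hermitian metric, \<open>N = \<parallel>\<alpha>\<parallel>\<^sup>2 = m(z,b)\<close>, and \<open>Pf\<close> the Pfaffian of \<open>M\<close>.

  The identity \<open>m \<and> m = 2 Pf \<Omega>\<^sub>0\<close>, contracted with \<open>z\<close> and \<open>b\<close>, reads
  \<open>2 Pf \<Omega>hat = N (d\<alpha> - \<alpha> \<and> \<eta>)\<close> (lemma \<open>hatOmega_eq\<close>). It holds at all nonzero \<open>z\<close> and on all vectors,
  not only on the sphere. Hence \<open>\<lambda> = 2 Pf / N\<close>, which has no zeros, and
  \<open>\<Omega> = conj \<alpha> \<and> (d\<alpha> - \<alpha> \<and> \<eta>) / (2 Pf)\<close>, where \<open>d\<alpha>\<close> has constant coefficients. Moreover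
  \<open>\<eta> = -2 \<partial> log N\<close>, so \<open>dN = - N Re \<eta>\<close> (lemma \<open>invn_deriv\<close>). With the Leibniz rule this determines
  \<open>d\<omega>\<close> and \<open>d\<Omega>\<close> (lemmas \<open>ext_d_omegaM\<close>, \<open>ext_d_OmegaM\<close>); only \<open>\<alpha> \<and> conj \<alpha> \<and> d\<eta>\<close> is left to be computed.

  At a point \<open>z\<close> of the sphere there is a unitary basis \<open>z, f\<^sub>1, f\<^sub>2, f\<^sub>3\<close> of determinant 1 with \<open>f\<^sub>1 = b / |b|\<close>.
  Let \<open>\<theta>\<^sub>0, \<dots>, \<theta>\<^sub>3\<close> be the dual basis. On tangent vectors \<open>conj \<theta>\<^sub>0 = - \<theta>\<^sub>0\<close>, so that
  \<open>\<Omega> = \<phi>\<^sub>1 \<and> \<phi>\<^sub>2 \<and> \<phi>\<^sub>3\<close> and \<open>\<omega> = (i/2) \<Sum> \<phi>\<^sub>k \<and> conj \<phi>\<^sub>k\<close> for \<open>\<phi>\<^sub>1 = conj \<theta>\<^sub>1\<close>, \<open>\<phi>\<^sub>2 = \<theta>\<^sub>2\<close>, \<open>\<phi>\<^sub>3 = \<theta>\<^sub>3\<close>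
  (lemmas \<open>R_Omega\<close>, \<open>R_omega\<close>). All algebraic conditions on an \<open>SU(3)\<close>-structure and on its torsion
  classes thereby become identities in the exterior algebra on six generators. In the same frame
  \<open>\<alpha> \<and> conj \<alpha> \<and> d\<eta> = - i |\<lambda>|\<^sup>2 \<alpha> \<and> conj \<alpha> \<and> \<omega>\<^sub>0\<close> (lemma \<open>R_alpha_deta_omega0\<close>). Therefore the last two terms of
  the formula for \<open>W\<^sub>2 \<and> \<omega>\<close> cancel, and \<open>W\<^sub>2 = (W\<^sub>1/2) (\<omega> + (3i/2N) \<alpha> \<and> conj \<alpha>)\<close> for every \<open>M\<close>.

  The torsion classes are unique because the two defining equations can be evaluated on the complex
  basis dual to \<open>\<phi>\<^sub>k, conj \<phi>\<^sub>k\<close>, where types and primitivity isolate one class after the other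
  (lemma \<open>torsion_unique_at\<close>). Finally \<open>W\<^sub>4 = - Re \<eta> = d log N\<close> vanishes on the sphere iff \<open>N(z) = z\<^sup>* (M\<^sup>*M) z\<close> is
  constant there, that is, iff every vector is an eigenvector of the Hermitian matrix \<open>M\<^sup>*M\<close>
  (lemma \<open>scalar_if_rho_vanishes\<close>).

  The algebra rests on one observation: the shuffle formula for the exterior product satisfies a
  recursion on the list of arguments, by which it is associative, distributive and compatible with
  restriction, complexification and pullback on all functions of lists. Only the
  anticommutation of one-forms is needed besides, and long products never have to be expanded into
  shuffles.
\<close>

section \<open>The exterior product as a signed shuffle product\<close>

text \<open>
  The degree involution \<open>parity\<close> and the contraction \<open>interior\<close> are what the recursion for the product
  is built from. They act on functions of lists with arbitrary entries, so that the same algebra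
  serves real and complex tangent vectors.
\<close>

definition parity :: "('a list \<Rightarrow> complex) \<Rightarrow> 'a list \<Rightarrow> complex" where
  "parity \<beta> vs = (- 1) ^ length vs * \<beta> vs"

definition interior :: "'a \<Rightarrow> ('a list \<Rightarrow> complex) \<Rightarrow> 'a list \<Rightarrow> complex" where
  "interior v \<beta> vs = \<beta> (v # vs)"

definition scl :: "complex \<Rightarrow> ('a list \<Rightarrow> complex) \<Rightarrow> 'a list \<Rightarrow> complex" where
  "scl c \<beta> vs = c * \<beta> vs"

text \<open>
  The contraction with a vector is a graded derivation of the exterior product. Read as a recursion,
  this rule defines the product; \<open>wedge_emul\<close> below identifies it with the shuffle formula.
\<close>

primrec shuffle :: "'a list \<Rightarrow> ('a list \<Rightarrow> complex) \<Rightarrow> ('a list \<Rightarrow> complex) \<Rightarrow> complex" where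
  "shuffle [] \<beta> \<gamma> = \<beta> [] * \<gamma> []"
| "shuffle (v # vs) \<beta> \<gamma> = shuffle vs (interior v \<beta>) \<gamma> + shuffle vs (parity \<beta>) (interior v \<gamma>)"

definition emul :: "('a list \<Rightarrow> complex) \<Rightarrow> ('a list \<Rightarrow> complex) \<Rightarrow> 'a list \<Rightarrow> complex"
    (infixr "\<odot>" 70) where
  "(\<beta> \<odot> \<gamma>) vs = shuffle vs \<beta> \<gamma>"

lemma emul_Nil: "(\<beta> \<odot> \<gamma>) [] = \<beta> [] * \<gamma> []"
  by (simp add: emul_def)

lemma emul_Cons: "(\<beta> \<odot> \<gamma>) (v # vs) = (interior v \<beta> \<odot> \<gamma>) vs + (parity \<beta> \<odot> interior v \<gamma>) vs"
  by (simp add: emul_def)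

lemma interior_simps:
  "interior v (\<beta> + \<gamma>) = interior v \<beta> + interior v \<gamma>"
  "interior v (\<beta> - \<gamma>) = interior v \<beta> - interior v \<gamma>"
  "interior v (- \<beta>) = - interior v \<beta>"
  "interior v 0 = 0"
  "interior v (scl c \<beta>) = scl c (interior v \<beta>)"
  "interior v (parity \<beta>) = - parity (interior v \<beta>)"
  "interior v (\<beta> \<odot> \<gamma>) = interior v \<beta> \<odot> \<gamma> + parity \<beta> \<odot> interior v \<gamma>"
  by (auto simp: interior_def scl_def parity_def fun_eq_iff emul_Cons)

lemma parity_simps:
  "parity (\<beta> + \<gamma>) = parity \<beta> + parity \<gamma>"
  "parity (\<beta> - \<gamma>) = parity \<beta> - parity \<gamma>"
  "parity (- \<beta>) = - parity \<beta>"
  "parity 0 = 0"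
  "parity (scl c \<beta>) = scl c (parity \<beta>)"
  "parity (parity \<beta>) = \<beta>"
  by (auto simp: scl_def parity_def fun_eq_iff algebra_simps)

lemma emul_scl_left: "scl c \<beta> \<odot> \<gamma> = scl c (\<beta> \<odot> \<gamma>)"
proof
  fix vs show "(scl c \<beta> \<odot> \<gamma>) vs = scl c (\<beta> \<odot> \<gamma>) vs"
    by (induction vs arbitrary: \<beta> \<gamma>)
       (auto simp: emul_Nil emul_Cons interior_simps parity_simps scl_def algebra_simps)
qed

lemma emul_scl_right: "\<beta> \<odot> scl c \<gamma> = scl c (\<beta> \<odot> \<gamma>)"
proof
  fix vs show "(\<beta> \<odot> scl c \<gamma>) vs = scl c (\<beta> \<odot> \<gamma>) vs"
    by (induction vs arbitrary: \<beta> \<gamma>)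
       (auto simp: emul_Nil emul_Cons interior_simps parity_simps scl_def algebra_simps)
qed

lemma emul_add_left: "(\<beta> + \<beta>') \<odot> \<gamma> = \<beta> \<odot> \<gamma> + \<beta>' \<odot> \<gamma>"
proof
  fix vs show "((\<beta> + \<beta>') \<odot> \<gamma>) vs = (\<beta> \<odot> \<gamma> + \<beta>' \<odot> \<gamma>) vs"
    by (induction vs arbitrary: \<beta> \<beta>' \<gamma>)
       (auto simp: emul_Nil emul_Cons interior_simps parity_simps algebra_simps)
qed

lemma emul_add_right: "\<beta> \<odot> (\<gamma> + \<gamma>') = \<beta> \<odot> \<gamma> + \<beta> \<odot> \<gamma>'"
proof
  fix vs show "(\<beta> \<odot> (\<gamma> + \<gamma>')) vs = (\<beta> \<odot> \<gamma> + \<beta> \<odot> \<gamma>') vs"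
    by (induction vs arbitrary: \<beta> \<gamma> \<gamma>')
       (auto simp: emul_Nil emul_Cons interior_simps parity_simps algebra_simps)
qed

lemma scl_minus_one: "scl (- 1) \<beta> = - \<beta>"
  by (auto simp: scl_def fun_eq_iff)

lemma scl_scl: "scl a (scl b \<beta>) = scl (a * b) \<beta>"
  by (simp add: scl_def fun_eq_iff)

lemma scl_add: "scl a (\<beta> + \<gamma>) = scl a \<beta> + scl a \<gamma>" "scl a (\<beta> - \<gamma>) = scl a \<beta> - scl a \<gamma>"
  "scl a (- \<beta>) = - scl a \<beta>" "scl 0 \<beta> = 0" "scl 1 \<beta> = \<beta>" "scl a 0 = 0"
  by (simp_all add: scl_def fun_eq_iff algebra_simps)

lemma emul_minus_left: "(- \<beta>) \<odot> \<gamma> = - (\<beta> \<odot> \<gamma>)"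
  using emul_scl_left[of "- 1" \<beta> \<gamma>] by (simp add: scl_minus_one)

lemma emul_minus_right: "\<beta> \<odot> (- \<gamma>) = - (\<beta> \<odot> \<gamma>)"
  using emul_scl_right[of \<beta> "- 1" \<gamma>] by (simp add: scl_minus_one)

lemma emul_diff_left: "(\<beta> - \<beta>') \<odot> \<gamma> = \<beta> \<odot> \<gamma> - \<beta>' \<odot> \<gamma>"
  using emul_add_left[of \<beta> "- \<beta>'" \<gamma>] by (simp add: emul_minus_left)

lemma emul_diff_right: "\<beta> \<odot> (\<gamma> - \<gamma>') = \<beta> \<odot> \<gamma> - \<beta> \<odot> \<gamma>'"
  using emul_add_right[of \<beta> \<gamma> "- \<gamma>'"] by (simp add: emul_minus_right)

lemma emul_zero_left: "0 \<odot> \<gamma> = 0"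
  using emul_diff_left[of 0 0 \<gamma>] by simp

lemma emul_zero_right: "\<beta> \<odot> 0 = 0"
  using emul_diff_right[of \<beta> 0 0] by simp

lemmas emul_linear = emul_add_left emul_add_right emul_diff_left emul_diff_right
  emul_minus_left emul_minus_right emul_zero_left emul_zero_right emul_scl_left emul_scl_right

lemma parity_emul: "parity (\<beta> \<odot> \<gamma>) = parity \<beta> \<odot> parity \<gamma>"
proof
  fix vs show "parity (\<beta> \<odot> \<gamma>) vs = (parity \<beta> \<odot> parity \<gamma>) vs"
  proof (induction vs arbitrary: \<beta> \<gamma>)
    case (Cons v vs)
    have "parity (\<beta> \<odot> \<gamma>) (v # vs) = - (parity (interior v \<beta> \<odot> \<gamma>) vs + parity (parity \<beta> \<odot> interior v \<gamma>) vs)"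
      by (simp add: parity_def emul_Cons algebra_simps)
    then show ?case
      by (simp add: Cons.IH emul_Cons interior_simps emul_linear parity_simps)
  qed (auto simp: parity_def emul_Nil)
qed

text \<open>
  The signed deshuffling of lists is coassociative, so that this holds for all functions of lists.
  By the derivation rule, both sides satisfy the same recursion.
\<close>

lemma emul_assoc: "(\<beta> \<odot> \<gamma>) \<odot> \<delta> = \<beta> \<odot> (\<gamma> \<odot> \<delta>)"
proof
  fix vs show "((\<beta> \<odot> \<gamma>) \<odot> \<delta>) vs = (\<beta> \<odot> (\<gamma> \<odot> \<delta>)) vs"
    by (induction vs arbitrary: \<beta> \<gamma> \<delta>)
       (auto simp: emul_Nil emul_Cons interior_simps parity_emul emul_linear)
qed

lemma emul_comp_map: "(\<beta> \<odot> \<gamma>) (map f vs) = ((\<lambda>vs. \<beta> (map f vs)) \<odot> (\<lambda>vs. \<gamma> (map f vs))) vs"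
proof (induction vs arbitrary: \<beta> \<gamma>)
  case (Cons v vs)
  have *: "(\<lambda>vs. interior (f v) \<beta> (map f vs)) = interior v (\<lambda>vs. \<beta> (map f vs))"
    "(\<lambda>vs. parity \<beta> (map f vs)) = parity (\<lambda>vs. \<beta> (map f vs))" for \<beta>
    by (auto simp: interior_def parity_def)
  show ?case by (simp add: emul_Cons Cons.IH *)
qed (simp add: emul_Nil)

definition restr :: "'a set \<Rightarrow> ('a list \<Rightarrow> complex) \<Rightarrow> 'a list \<Rightarrow> complex" where
  "restr T \<beta> vs = (if set vs \<subseteq> T then \<beta> vs else 0)"

lemma restr_linear:
  "restr T (\<beta> + \<gamma>) = restr T \<beta> + restr T \<gamma>"
  "restr T (\<beta> - \<gamma>) = restr T \<beta> - restr T \<gamma>"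
  "restr T (- \<beta>) = - restr T \<beta>"
  "restr T (scl c \<beta>) = scl c (restr T \<beta>)"
  "restr T 0 = 0"
  by (auto simp: restr_def scl_def fun_eq_iff)

lemma restr_emul: "restr T (\<beta> \<odot> \<gamma>) = restr T \<beta> \<odot> restr T \<gamma>"
proof
  fix vs show "restr T (\<beta> \<odot> \<gamma>) vs = (restr T \<beta> \<odot> restr T \<gamma>) vs"
  proof (induction vs arbitrary: \<beta> \<gamma>)
    case Nil
    then show ?case by (simp add: restr_def emul_Nil)
  next
    case (Cons v vs)
    have i: "interior v (restr T \<beta>) = (if v \<in> T then restr T (interior v \<beta>) else 0)" for \<beta> :: "'a list \<Rightarrow> complex"
      by (auto simp: interior_def restr_def fun_eq_iff)
    have f: "parity (restr T \<beta>) = restr T (parity \<beta>)" for \<beta> :: "'a list \<Rightarrow> complex"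
      by (auto simp: parity_def restr_def fun_eq_iff)
    have "restr T (\<beta> \<odot> \<gamma>) (v # vs) =
      (if v \<in> T then restr T (interior v \<beta> \<odot> \<gamma>) vs + restr T (parity \<beta> \<odot> interior v \<gamma>) vs else 0)"
      by (auto simp: restr_def emul_Cons)
    then show ?case by (simp add: emul_Cons i f Cons.IH emul_linear)
  qed
qed

lemma complexify_add: "complexify (\<lambda>vs. \<beta> vs + \<gamma> vs) ws = complexify \<beta> ws + complexify \<gamma> ws"
  by (induction ws arbitrary: \<beta> \<gamma>) (auto simp: algebra_simps)

lemma complexify_scale: "complexify (\<lambda>vs. c * \<beta> vs) ws = c * complexify \<beta> ws"
  by (induction ws arbitrary: \<beta>) (auto simp: algebra_simps)

lemma complexify_parity: "complexify (parity \<beta>) = parity (complexify \<beta>)"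
  unfolding parity_def
proof
  fix ws show "complexify (\<lambda>vs. (- 1) ^ length vs * \<beta> vs) ws = (- 1) ^ length ws * complexify \<beta> ws"
  proof (induction ws arbitrary: \<beta>)
    case (Cons w ws)
    obtain x y where w: "w = (x, y)" by force
    show ?case using Cons[of "\<lambda>vs. \<beta> (x # vs)"] Cons[of "\<lambda>vs. \<beta> (y # vs)"]
      complexify_scale[of "-1" "\<lambda>vs. (- 1) ^ length vs * \<beta> (_ # vs)" ws]
      by (simp add: w algebra_simps)
  qed auto
qed

lemma complexify_emul: "complexify (\<beta> \<odot> \<gamma>) = complexify \<beta> \<odot> complexify \<gamma>"
proof
  fix ws show "complexify (\<beta> \<odot> \<gamma>) ws = (complexify \<beta> \<odot> complexify \<gamma>) ws"
  proof (induction ws arbitrary: \<beta> \<gamma>)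
    case Nil
    then show ?case by (simp add: emul_Nil)
  next
    case (Cons w ws)
    obtain x y where w: "w = (x, y)" by force
    have i: "interior w (complexify \<beta>) = complexify (interior x \<beta>) + scl \<i> (complexify (interior y \<beta>))" for \<beta>
      by (auto simp: w interior_def[abs_def] scl_def fun_eq_iff)
    show ?case
      by (simp add: w emul_Cons complexify_add Cons.IH[symmetric])
         (simp add: Cons.IH complexify_parity i[unfolded w] emul_linear scl_def algebra_simps)
  qed
qed

lemma sum_Pow_Suc:
  "(\<Sum>I\<in>Pow {..<Suc n}. f I) = (\<Sum>I\<in>Pow {..<n}. f (insert 0 (Suc ` I)) + f (Suc ` I))"
proof -
  have e: "{..<Suc n} = insert 0 (Suc ` {..<n})" by (auto simp: lessThan_Suc_eq_insert_0)
  have "(\<Sum>I\<in>Pow {..<Suc n}. f I)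
     = (\<Sum>I\<in>Pow (Suc ` {..<n}). f I) + (\<Sum>I\<in>insert 0 ` Pow (Suc ` {..<n}). f I)"
    unfolding e Pow_insert by (rule sum.union_disjoint) auto
  also have "(\<Sum>I\<in>insert 0 ` Pow (Suc ` {..<n}). f I) = (\<Sum>I\<in>Pow (Suc ` {..<n}). f (insert 0 I))"
    by (subst sum.reindex) (auto simp: inj_on_def)
  also have "Pow (Suc ` {..<n}) = (`) Suc ` Pow {..<n}"
    by (auto simp: image_Pow_surj)
  finally show ?thesis
    by (subst (asm) (1 2) sum.reindex) (auto simp: inj_on_def sum.distrib inj_image_eq_iff add.commute)
qed

text \<open>
  A set of positions either contains the first position, and then the shifted rest has as many
  inversions, or it does not, and then every element of it produces one more inversion. These are
  the two terms of the recursion, the second with the sign \<open>parity\<close>.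
\<close>

lemma shuffle_eq:
  "shuffle vs \<beta> \<gamma> = (\<Sum>I\<in>Pow {..<length vs}.
        (-1) ^ card {(i, j). i \<in> I \<and> j < i \<and> j \<notin> I} * \<beta> (nths vs I) * \<gamma> (nths vs (- I)))"
proof (induction vs arbitrary: \<beta> \<gamma>)
  case (Cons v vs)
  have nS: "nths (v # vs) (Suc ` I) = nths vs I" "nths (v # vs) (- Suc ` I) = v # nths vs (- I)"
    "nths (v # vs) (insert 0 (Suc ` I)) = v # nths vs I"
    "nths (v # vs) (- insert 0 (Suc ` I)) = nths vs (- I)" for I
    by (auto simp: nths_Cons inj_image_mem_iff Compl_eq)
  have c1: "card {(i, j). i \<in> insert 0 (Suc ` I) \<and> j < i \<and> j \<notin> insert 0 (Suc ` I)}
     = card {(i, j). i \<in> I \<and> j < i \<and> j \<notin> I}" for I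
  proof -
    have "{(i, j). i \<in> insert 0 (Suc ` I) \<and> j < i \<and> j \<notin> insert 0 (Suc ` I)}
      = map_prod Suc Suc ` {(i, j). i \<in> I \<and> j < i \<and> j \<notin> I}"
      by (auto simp: image_iff gr0_conv_Suc Bex_def less_Suc_eq_0_disj)
    then show ?thesis by (simp add: card_image inj_on_def)
  qed
  have c2: "card {(i, j). i \<in> Suc ` I \<and> j < i \<and> j \<notin> Suc ` I}
     = card {(i, j). i \<in> I \<and> j < i \<and> j \<notin> I} + card I" if "I \<in> Pow {..<length vs}" for I
  proof -
    have fI: "finite I" using that finite_subset by auto
    have "{(i, j). i \<in> Suc ` I \<and> j < i \<and> j \<notin> Suc ` I}
      = map_prod Suc Suc ` {(i, j). i \<in> I \<and> j < i \<and> j \<notin> I} \<union> (\<lambda>i. (Suc i, 0)) ` I"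
      by (auto simp: image_iff gr0_conv_Suc Bex_def) (metis not0_implies_Suc Suc_less_eq)+
    moreover have "finite {(i, j). i \<in> I \<and> j < i \<and> j \<notin> I}"
      by (rule finite_subset[of _ "I \<times> {..<length vs}"]) (use that fI in auto)
    moreover have "map_prod Suc Suc ` A \<inter> (\<lambda>i. (Suc i, 0)) ` I = {}" for A
      by auto
    ultimately show ?thesis using fI
      by (simp add: card_Un_disjoint card_image inj_on_def)
  qed
  have ln: "length (nths vs I) = card I" if "I \<in> Pow {..<length vs}" for I
  proof -
    have "{i. i < length vs \<and> i \<in> I} = I" using that by auto
    then show ?thesis by (simp add: length_nths)
  qed
  show ?case
    unfolding length_Cons sum_Pow_Suc sum.distrib shuffle.simps Cons.IH
    by (intro arg_cong2[where f="(+)"] sum.cong refl)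
       (simp_all only: c1 c2 nS, simp_all add: ln interior_def parity_def power_add)
qed simp

lemma wedge_emul: "(\<beta> \<and>\<^sub>f \<gamma>) z = \<beta> z \<odot> \<gamma> z"
  by (rule ext) (simp add: wedge_def emul_def shuffle_eq)

section \<open>Forms of degree zero and one\<close>

definition const_form :: "complex \<Rightarrow> 'a list \<Rightarrow> complex" where
  "const_form c vs = (if vs = [] then c else 0)"

definition cov :: "('a \<Rightarrow> complex) \<Rightarrow> 'a list \<Rightarrow> complex" where
  "cov p vs = (case vs of [v] \<Rightarrow> p v | _ \<Rightarrow> 0)"

lemma cov_values: "cov p [v] = p v" "cov p [] = 0" "cov p (u # v # vs) = 0"
  by (auto simp: cov_def)

lemma interior_const_form: "interior v (const_form c) = 0"
  by (auto simp: interior_def const_form_def fun_eq_iff)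

lemma interior_cov: "interior v (cov p) = const_form (p v)"
  by (auto simp: interior_def const_form_def cov_def fun_eq_iff split: list.splits)

lemma parity_const_form: "parity (const_form c) = const_form c"
  by (auto simp: parity_def const_form_def fun_eq_iff)

lemma parity_cov: "parity (cov p) = - cov p"
  by (auto simp: parity_def cov_def fun_eq_iff split: list.splits)

lemma const_form_emul: "const_form c \<odot> \<gamma> = scl c \<gamma>"
proof
  fix vs show "(const_form c \<odot> \<gamma>) vs = scl c \<gamma> vs"
  proof (induction vs arbitrary: \<gamma>)
    case (Cons v vs)
    then show ?case by (simp add: emul_Cons interior_const_form parity_const_form emul_linear) (simp add: scl_def interior_def)
  qed (simp add: emul_Nil const_form_def scl_def)
qed

lemma emul_const_form: "\<gamma> \<odot> const_form c = scl c \<gamma>"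
proof
  fix vs show "(\<gamma> \<odot> const_form c) vs = scl c \<gamma> vs"
  proof (induction vs arbitrary: \<gamma>)
    case (Cons v vs)
    then show ?case by (simp add: emul_Cons interior_const_form emul_linear) (simp add: scl_def interior_def)
  qed (simp add: emul_Nil const_form_def scl_def)
qed

lemma interior_value: "\<beta> (v # vs) = interior v \<beta> vs"
  by (simp add: interior_def)

lemma list_form_eqI: "\<beta> [] = \<gamma> [] \<Longrightarrow> (\<And>v. interior v \<beta> = interior v \<gamma>) \<Longrightarrow> \<beta> = \<gamma>"
  by (rule ext, case_tac x) (auto simp: interior_value)

text \<open>
  Both sides vanish on the empty list and have the same contractions.
\<close>

lemma cov_anticommute: "cov p \<odot> cov q = - (cov q \<odot> cov p)"
  by (rule list_form_eqI)
    (auto simp: emul_Nil cov_values interior_simps interior_cov parity_cov const_form_emul emul_const_form emul_linear,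
     auto simp: scl_def fun_eq_iff)

lemma cov_square: "cov p \<odot> cov p = 0"
proof -
  have "(cov p \<odot> cov p) vs = - (cov p \<odot> cov p) vs" for vs
    using fun_cong[OF cov_anticommute[of p p]] by simp
  then show ?thesis by (auto simp: fun_eq_iff)
qed

lemma cov_anticommute_left: "cov p \<odot> (cov q \<odot> \<beta>) = - (cov q \<odot> (cov p \<odot> \<beta>))"
  by (metis cov_anticommute emul_assoc emul_minus_left)

lemma cov_square_left: "cov p \<odot> (cov p \<odot> \<beta>) = 0"
  by (metis cov_square emul_assoc emul_zero_left)

lemma cov_emul_value: "(cov p \<odot> \<beta>) (v # vs) = p v * \<beta> vs - (cov p \<odot> interior v \<beta>) vs"
  by (simp add: emul_Cons interior_cov const_form_emul parity_cov emul_linear) (simp add: scl_def)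

lemma cov_emul_cov: "(cov p \<odot> cov q) [u, v] = p u * q v - q u * p v"
  by (simp add: cov_emul_value interior_cov emul_const_form cov_values scl_def)

lemma cov_linear:
  "cov (\<lambda>v. p v + q v) = cov p + cov q" "cov (\<lambda>v. p v - q v) = cov p - cov q"
  "cov (\<lambda>v. c * p v) = scl c (cov p)" "cov (\<lambda>v. - p v) = - cov p"
  by (auto simp: cov_def scl_def fun_eq_iff split: list.splits)

section \<open>Homogeneous, multilinear and alternating forms\<close>

definition homog :: "nat \<Rightarrow> ('a list \<Rightarrow> complex) \<Rightarrow> bool" where
  "homog k \<beta> \<longleftrightarrow> (\<forall>vs. length vs \<noteq> k \<longrightarrow> \<beta> vs = 0)"

lemma homog_interior: "homog (Suc k) \<beta> \<Longrightarrow> homog k (interior v \<beta>)"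
  by (auto simp: homog_def interior_def)

lemma homog_0: "homog 0 \<beta> \<Longrightarrow> \<beta> = const_form (\<beta> [])"
  by (rule ext) (simp add: homog_def const_form_def)

lemma homog_parity: "homog k \<beta> \<Longrightarrow> parity \<beta> = scl ((- 1) ^ k) \<beta>"
  by (auto simp: homog_def parity_def scl_def fun_eq_iff)

lemma homog_linear:
  "homog k \<beta> \<Longrightarrow> homog k \<gamma> \<Longrightarrow> homog k (\<beta> + \<gamma>)"
  "homog k \<beta> \<Longrightarrow> homog k \<gamma> \<Longrightarrow> homog k (\<beta> - \<gamma>)"
  "homog k \<beta> \<Longrightarrow> homog k (- \<beta>)"
  "homog k \<beta> \<Longrightarrow> homog k (scl c \<beta>)"
  "homog k 0"
  by (auto simp: homog_def scl_def)

lemma homog_cov: "homog 1 (cov p)"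
  by (auto simp: homog_def cov_def split: list.splits)

lemma homog_emul: "homog k \<beta> \<Longrightarrow> homog l \<gamma> \<Longrightarrow> homog (k + l) (\<beta> \<odot> \<gamma>)"
proof -
  have "homog k \<beta> \<Longrightarrow> homog l \<gamma> \<Longrightarrow> length vs \<noteq> k + l \<Longrightarrow> (\<beta> \<odot> \<gamma>) vs = 0" for vs
  proof (induction vs arbitrary: k l \<beta> \<gamma>)
    case Nil
    then show ?case by (auto simp: emul_Nil homog_def)
  next
    case (Cons v vs)
    have "(interior v \<beta> \<odot> \<gamma>) vs = 0"
    proof (cases k)
      case 0
      then have "interior v \<beta> = 0" using Cons.prems(1) homog_0 by (metis interior_const_form)
      then show ?thesis by (simp add: emul_linear)
    next
      case (Suc k')
      then show ?thesis using Cons.IH[OF homog_interior[of k' \<beta> v] Cons.prems(2)] Cons.prems by auto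
    qed
    moreover have "(parity \<beta> \<odot> interior v \<gamma>) vs = 0"
    proof (cases l)
      case 0
      then have "interior v \<gamma> = 0" using Cons.prems(2) homog_0 by (metis interior_const_form)
      then show ?thesis by (simp add: emul_linear)
    next
      case (Suc l')
      have "homog k (parity \<beta>)" using Cons.prems(1) homog_parity homog_linear(4) by metis
      then show ?thesis using Cons.IH[OF _ homog_interior[of l' \<gamma> v]] Cons.prems Suc by auto
    qed
    ultimately show ?case by (simp add: emul_Cons)
  qed
  then show "homog k \<beta> \<Longrightarrow> homog l \<gamma> \<Longrightarrow> homog (k + l) (\<beta> \<odot> \<gamma>)"
    by (auto simp: homog_def)
qed

definition multilin :: "('a::real_vector list \<Rightarrow> complex) \<Rightarrow> bool" where
  "multilin \<beta> \<longleftrightarrow> (\<forall>us vs. linear (\<lambda>v. \<beta> (us @ v # vs)))"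

definition alternating :: "('a list \<Rightarrow> complex) \<Rightarrow> bool" where
  "alternating \<beta> \<longleftrightarrow> (\<forall>us v vs. \<beta> (us @ v # v # vs) = 0)"

lemma multilin_interior: "multilin \<beta> \<Longrightarrow> multilin (interior v \<beta>)"
  unfolding multilin_def interior_def by (intro allI, drule spec[of _ "v # _"], drule spec, simp)

lemma linear_const_mult: "linear f \<Longrightarrow> linear (\<lambda>v. (c::complex) * f v)"
  using linear_compose[of f "\<lambda>x. c * x"] by (simp add: o_def linear_times)

lemma multilin_parity: "multilin \<beta> \<Longrightarrow> multilin (parity \<beta>)"
  unfolding multilin_def parity_def by (auto intro!: linear_const_mult simp del: power_Suc)

lemma multilin_linear:
  "multilin \<beta> \<Longrightarrow> multilin \<gamma> \<Longrightarrow> multilin (\<beta> + \<gamma>)"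
  "multilin \<beta> \<Longrightarrow> multilin \<gamma> \<Longrightarrow> multilin (\<beta> - \<gamma>)"
  "multilin \<beta> \<Longrightarrow> multilin (- \<beta>)"
  "multilin \<beta> \<Longrightarrow> multilin (scl c \<beta>)"
  unfolding multilin_def plus_fun_apply minus_apply uminus_apply scl_def
  by (simp_all add: linear_compose_add linear_compose_sub linear_compose_neg linear_const_mult)

lemma multilin_interior_add: "multilin \<beta> \<Longrightarrow> interior (u + v) \<beta> = interior u \<beta> + interior v \<beta>"
  unfolding multilin_def interior_def using linear_add[of "\<lambda>v. \<beta> ([] @ v # _)"] by (fastforce simp: fun_eq_iff)

lemma multilin_interior_scale: "multilin \<beta> \<Longrightarrow> interior (r *\<^sub>R v) \<beta> = scl (of_real r) (interior v \<beta>)"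
  unfolding multilin_def interior_def using linear_scale[of "\<lambda>v. \<beta> ([] @ v # _)"]
  by (fastforce simp: fun_eq_iff scl_def scaleR_conv_of_real)

lemma multilin_emul: "multilin \<beta> \<Longrightarrow> multilin \<gamma> \<Longrightarrow> multilin (\<beta> \<odot> \<gamma>)"
proof -
  have "multilin \<beta> \<Longrightarrow> multilin \<gamma> \<Longrightarrow> linear (\<lambda>v. (\<beta> \<odot> \<gamma>) (us @ v # vs))" for us vs
  proof (induction us arbitrary: \<beta> \<gamma>)
    case Nil
    then show ?case
      by (auto simp: linear_iff emul_Cons multilin_interior_add multilin_interior_scale emul_linear)
         (auto simp: scl_def scaleR_conv_of_real algebra_simps)
  next
    case (Cons u us)
    then show ?case
      by (simp add: emul_Cons linear_compose_add multilin_interior multilin_parity)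
  qed
  then show "multilin \<beta> \<Longrightarrow> multilin \<gamma> \<Longrightarrow> multilin (\<beta> \<odot> \<gamma>)"
    by (auto simp: multilin_def)
qed

lemma alternating_interior: "alternating \<beta> \<Longrightarrow> alternating (interior v \<beta>)"
  unfolding alternating_def interior_def by (metis append_Cons)

lemma alternating_parity: "alternating \<beta> \<Longrightarrow> alternating (parity \<beta>)"
  by (auto simp: alternating_def parity_def)

lemma alternating_linear:
  "alternating \<beta> \<Longrightarrow> alternating \<gamma> \<Longrightarrow> alternating (\<beta> + \<gamma>)"
  "alternating \<beta> \<Longrightarrow> alternating \<gamma> \<Longrightarrow> alternating (\<beta> - \<gamma>)"
  "alternating \<beta> \<Longrightarrow> alternating (- \<beta>)"
  "alternating \<beta> \<Longrightarrow> alternating (scl c \<beta>)"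
  by (auto simp: alternating_def scl_def)

lemma alternating_interior_twice: "alternating \<beta> \<Longrightarrow> interior v (interior v \<beta>) = 0"
  by (rule ext, unfold alternating_def, drule spec[of _ "[]"]) (simp add: interior_def)

text \<open>
  For an alternating form it is enough to test two equal neighbouring arguments. Contracting twice
  with \<open>v\<close> leaves the two mixed terms of the derivation rule, and these cancel because \<open>parity\<close>
  anticommutes with contraction.
\<close>

lemma alternating_emul: "alternating \<beta> \<Longrightarrow> alternating \<gamma> \<Longrightarrow> alternating (\<beta> \<odot> \<gamma>)"
proof -
  have "alternating \<beta> \<Longrightarrow> alternating \<gamma> \<Longrightarrow> (\<beta> \<odot> \<gamma>) (us @ v # v # vs) = 0" for us v vs
  proof (induction us arbitrary: \<beta> \<gamma>)
    case Nil
    then show ?case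
      by (simp add: emul_Cons, simp add: interior_simps, simp add: parity_simps emul_linear,
        simp add: alternating_interior_twice emul_linear)
  next
    case (Cons u us)
    then show ?case by (simp add: emul_Cons alternating_interior alternating_parity)
  qed
  then show "alternating \<beta> \<Longrightarrow> alternating \<gamma> \<Longrightarrow> alternating (\<beta> \<odot> \<gamma>)"
    by (auto simp: alternating_def)
qed

lemma alternating_swap:
  assumes "multilin \<beta>" "alternating \<beta>"
  shows "\<beta> (us @ u # v # vs) = - \<beta> (us @ v # u # vs)"
proof -
  have l1: "linear (\<lambda>x. \<beta> (us @ x # y # vs))" for y
    using assms(1) by (auto simp: multilin_def)
  have l2: "linear (\<lambda>x. \<beta> (us @ y # x # vs))" for y
    using assms(1)[unfolded multilin_def, rule_format, of "us @ [y]" vs] by auto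
  have z: "\<beta> (us @ x # x # vs) = 0" for x using assms(2) by (auto simp: alternating_def)
  have "\<beta> (us @ (u + v) # (u + v) # vs) = \<beta> (us @ u # u # vs) + \<beta> (us @ v # u # vs)
    + (\<beta> (us @ u # v # vs) + \<beta> (us @ v # v # vs))"
    using linear_add[OF l1] linear_add[OF l2] by simp
  then show ?thesis by (simp add: z add_eq_0_iff)
qed

lemma alternating_repeat:
  assumes "multilin \<beta>" "alternating \<beta>"
  shows "\<beta> (us @ v # ws @ v # vs) = 0"
proof (induction ws arbitrary: us)
  case Nil
  then show ?case using assms(2) by (auto simp: alternating_def)
next
  case (Cons w ws)
  show ?case using Cons[of "us @ [w]"] alternating_swap[OF assms, of us v w "ws @ v # vs"] by simp
qed

text \<open>
  Splitting the notion into three conditions makes each of them stable under the product by an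
  induction of its own. Equal arguments can be brought together by transpositions.
\<close>

lemma alt_form_iff: "alt_form k \<beta> \<longleftrightarrow> homog k \<beta> \<and> multilin \<beta> \<and> alternating \<beta>"
proof
  assume "alt_form k \<beta>"
  then show "homog k \<beta> \<and> multilin \<beta> \<and> alternating \<beta>"
    by (auto simp: alt_form_def homog_def multilin_def alternating_def)
next
  assume a: "homog k \<beta> \<and> multilin \<beta> \<and> alternating \<beta>"
  have "\<beta> vs = 0" if "\<not> distinct vs" for vs
    using not_distinct_decomp[OF that] alternating_repeat a by force
  then show "alt_form k \<beta>" using a
    by (auto simp: alt_form_def homog_def multilin_def)
qed

lemma alt_form_emul: "alt_form k \<beta> \<Longrightarrow> alt_form l \<gamma> \<Longrightarrow> alt_form (k + l) (\<beta> \<odot> \<gamma>)"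
  by (simp add: alt_form_iff homog_emul multilin_emul alternating_emul)

lemma alt_form_linear:
  "alt_form k \<beta> \<Longrightarrow> alt_form k \<gamma> \<Longrightarrow> alt_form k (\<beta> + \<gamma>)"
  "alt_form k \<beta> \<Longrightarrow> alt_form k \<gamma> \<Longrightarrow> alt_form k (\<beta> - \<gamma>)"
  "alt_form k \<beta> \<Longrightarrow> alt_form k (- \<beta>)"
  "alt_form k \<beta> \<Longrightarrow> alt_form k (scl c \<beta>)"
  by (simp_all add: alt_form_iff homog_linear multilin_linear alternating_linear)

lemma alt_form_compose_linear:
  "alt_form k \<beta> \<Longrightarrow> linear h \<Longrightarrow> alt_form k (\<lambda>vs. h (\<beta> vs))"
  unfolding alt_form_def using linear_compose[of "\<lambda>v. \<beta> (_ @ v # _)" h]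
  by (simp add: linear_0 o_def)

lemma alt_form_cov: "linear p \<Longrightarrow> alt_form 1 (cov p)"
proof -
  assume l: "linear p"
  have "linear (\<lambda>v. cov p (us @ v # vs))" for us vs
  proof (cases "us = [] \<and> vs = []")
    case True
    then show ?thesis using l by (simp add: cov_values)
  next
    case False
    then have "length (us @ v # vs) \<noteq> 1" for v by auto
    then have "(\<lambda>v. cov p (us @ v # vs)) = (\<lambda>v. 0)"
      using homog_cov[of p] unfolding homog_def by (intro ext) blast
    then show ?thesis by (simp add: linear_zero)
  qed
  moreover have "cov p (us @ v # v # vs) = 0" for us v vs
    using homog_cov[of p] by (auto simp: homog_def)
  ultimately show ?thesis using homog_cov by (auto simp: alt_form_iff multilin_def alternating_def)
qed

section \<open>Smooth functions\<close>

lemma frechet_derivative_cong_open: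
  assumes "open S" "x \<in> S" "\<And>x. x \<in> S \<Longrightarrow> f x = g x"
  shows "f differentiable (at x) \<longleftrightarrow> g differentiable (at x)"
    and "f differentiable (at x) \<Longrightarrow> frechet_derivative f (at x) = frechet_derivative g (at x)"
proof -
  have *: "(f has_derivative D) (at x) \<longleftrightarrow> (g has_derivative D) (at x)" for D
    using has_derivative_transform_within_open[OF _ assms(1,2)] assms(3) by metis
  then show "f differentiable (at x) \<longleftrightarrow> g differentiable (at x)"
    by (simp add: differentiable_def)
  show "frechet_derivative f (at x) = frechet_derivative g (at x)"
    by (simp add: frechet_derivative_def *)
qed

lemma C_on_cong:
  assumes "open S" "\<And>x. x \<in> S \<Longrightarrow> f x = g x"
  shows "C_on k S f \<longleftrightarrow> C_on k S g"
  using assms(2)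
proof (induction k arbitrary: f g)
  case 0
  then show ?case by (simp cong: continuous_on_cong)
next
  case (Suc k)
  have d: "\<And>x. x \<in> S \<Longrightarrow> f differentiable (at x) \<longleftrightarrow> g differentiable (at x)"
    using frechet_derivative_cong_open(1)[OF assms(1) _ Suc.prems] by simp
  show ?case
  proof (cases "\<forall>x\<in>S. f differentiable (at x)")
    case True
    have "C_on k S (\<lambda>x. frechet_derivative f (at x) v) \<longleftrightarrow> C_on k S (\<lambda>x. frechet_derivative g (at x) v)" for v
      by (rule Suc.IH) (use frechet_derivative_cong_open(2)[OF assms(1) _ Suc.prems] True in auto)
    then show ?thesis using d by simp
  next
    case False
    then show ?thesis using d by auto
  qed
qed

lemma C_on_Suc_imp: "C_on (Suc k) S f \<Longrightarrow> C_on k S f"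
proof (induction k arbitrary: f)
  case 0
  then show ?case by (auto intro!: differentiable_imp_continuous_on simp: differentiable_on_def differentiable_at_withinI)
next
  case (Suc k)
  have "\<forall>x\<in>S. f differentiable (at x)" "\<And>v. C_on (Suc k) S (\<lambda>x. frechet_derivative f (at x) v)"
    using Suc.prems unfolding C_on.simps(2)[of "Suc k"] by auto
  then show ?case using Suc.IH by simp
qed

text \<open>
  The iterated derivatives are taken with \<open>frechet_derivative\<close>, which is only known where the function
  is differentiable. Hence a derivative known on the open set has to be transported along equality
  on that set.
\<close>

lemma C_on_Suc_I:
  assumes "open S" "\<And>x. x \<in> S \<Longrightarrow> (f has_derivative D x) (at x)" "\<And>v. C_on k S (\<lambda>x. D x v)"
  shows "C_on (Suc k) S f"
  unfolding C_on.simps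
proof (intro conjI allI ballI)
  fix x assume "x \<in> S"
  then show "f differentiable (at x)" using assms(2) by (auto simp: differentiable_def)
next
  fix v
  have "frechet_derivative f (at x) v = D x v" if "x \<in> S" for x
    using frechet_derivative_at[OF assms(2)[OF that]] by simp
  then have "C_on k S (\<lambda>x. frechet_derivative f (at x) v) \<longleftrightarrow> C_on k S (\<lambda>x. D x v)"
    by (rule C_on_cong[OF assms(1)])
  then show "C_on k S (\<lambda>x. frechet_derivative f (at x) v)"
    using assms(3) by simp
qed

lemma C_on_Suc_D:
  assumes "C_on (Suc k) S f" "x \<in> S"
  shows "(f has_derivative frechet_derivative f (at x)) (at x)"
  using assms by (auto simp: frechet_derivative_works)

lemma C_on_const: "open S \<Longrightarrow> C_on k S (\<lambda>x. c)"
proof (induction k arbitrary: c)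
  case (Suc k)
  then show ?case by (intro C_on_Suc_I[where D = "\<lambda>_ _. 0"]) auto
qed auto

lemma C_on_bounded_linear:
  assumes "open S" "bounded_linear h" shows "C_on k S f \<Longrightarrow> C_on k S (\<lambda>x. h (f x))"
proof (induction k arbitrary: f)
  case 0
  then show ?case using bounded_linear.continuous_on[OF assms(2)] by simp
next
  case (Suc k)
  show ?case
    by (rule C_on_Suc_I[OF assms(1) bounded_linear.has_derivative[OF assms(2) C_on_Suc_D[OF Suc.prems]]])
       (use Suc in auto)
qed

lemma C_on_add: "open S \<Longrightarrow> C_on k S f \<Longrightarrow> C_on k S g \<Longrightarrow> C_on k S (\<lambda>x. f x + g x)"
proof (induction k arbitrary: f g)
  case 0
  then show ?case by (auto intro: continuous_intros)
next
  case (Suc k)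
  show ?case
    by (rule C_on_Suc_I[OF Suc.prems(1) has_derivative_add[OF C_on_Suc_D[OF Suc.prems(2)] C_on_Suc_D[OF Suc.prems(3)]]])
       (use Suc in auto)
qed

lemma C_on_mult: "open S \<Longrightarrow> C_on k S f \<Longrightarrow> C_on k S g \<Longrightarrow> C_on k S (\<lambda>x. f x * g x)"
proof (induction k arbitrary: f g)
  case 0
  then show ?case by (auto intro: continuous_intros)
next
  case (Suc k)
  show ?case
    by (rule C_on_Suc_I[OF Suc.prems(1) has_derivative_mult[OF C_on_Suc_D[OF Suc.prems(2)] C_on_Suc_D[OF Suc.prems(3)]]])
       (use Suc.prems C_on_Suc_imp[of k S] in \<open>auto intro!: C_on_add Suc.IH\<close>)
qed

lemma C_on_inverse:
  "open S \<Longrightarrow> C_on k S f \<Longrightarrow> (\<And>x. x \<in> S \<Longrightarrow> f x \<noteq> 0) \<Longrightarrow> C_on k S (\<lambda>x. inverse (f x))"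
proof (induction k arbitrary: f)
  case 0
  then show ?case by (auto intro: continuous_intros)
next
  case (Suc k)
  show ?case
  proof (rule C_on_Suc_I[OF Suc.prems(1) Deriv.has_derivative_inverse[OF Suc.prems(3) C_on_Suc_D[OF Suc.prems(2)]]])
    fix v
    have f: "C_on k S f" using Suc.prems(2) C_on_Suc_imp by auto
    have "C_on k S (\<lambda>x. (- 1) * (inverse (f x) * frechet_derivative f (at x) v * inverse (f x)))"
      by (intro C_on_mult C_on_const Suc.IH f Suc.prems) (use Suc.prems(2) in auto)
    then show "C_on k S (\<lambda>x. - (inverse (f x) * frechet_derivative f (at x) v * inverse (f x)))"
      by simp
  qed auto
qed

lemma C_on_linear: "open S \<Longrightarrow> bounded_linear f \<Longrightarrow> C_on k S f"
proof (induction k)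
  case 0
  then show ?case by (simp add: linear_continuous_on)
next
  case (Suc k)
  show ?case
    by (rule C_on_Suc_I[OF Suc.prems(1) bounded_linear_imp_has_derivative[OF Suc.prems(2)]])
       (use Suc C_on_const in auto)
qed

lemma smooth_on_const: "open S \<Longrightarrow> smooth_on S (\<lambda>x. c)"
  and smooth_on_compose_linear: "open S \<Longrightarrow> bounded_linear h \<Longrightarrow> smooth_on S f \<Longrightarrow> smooth_on S (\<lambda>x. h (f x))"
  and smooth_on_add: "open S \<Longrightarrow> smooth_on S f \<Longrightarrow> smooth_on S g \<Longrightarrow> smooth_on S (\<lambda>x. f x + g x)"
  and smooth_on_mult: "open S \<Longrightarrow> smooth_on S f \<Longrightarrow> smooth_on S g \<Longrightarrow> smooth_on S (\<lambda>x. f x * g x)"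
  and smooth_on_inverse: "open S \<Longrightarrow> smooth_on S f \<Longrightarrow> (\<And>x. x \<in> S \<Longrightarrow> f x \<noteq> 0) \<Longrightarrow> smooth_on S (\<lambda>x. inverse (f x))"
  and smooth_on_linear: "open S \<Longrightarrow> bounded_linear f \<Longrightarrow> smooth_on S f"
  by (auto simp: smooth_on_def C_on_const C_on_bounded_linear C_on_add C_on_mult C_on_inverse C_on_linear)

lemma smooth_on_cong: "open S \<Longrightarrow> (\<And>x. x \<in> S \<Longrightarrow> f x = g x) \<Longrightarrow> smooth_on S f \<longleftrightarrow> smooth_on S g"
  unfolding smooth_on_def using C_on_cong[of S f g] by simp

lemma smooth_on_subset: "smooth_on S f \<Longrightarrow> T \<subseteq> S \<Longrightarrow> smooth_on T f"
proof -
  have "C_on k S f \<Longrightarrow> T \<subseteq> S \<Longrightarrow> C_on k T f" for k f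
    by (induction k arbitrary: f) (auto intro: continuous_on_subset)
  then show "smooth_on S f \<Longrightarrow> T \<subseteq> S \<Longrightarrow> smooth_on T f" by (auto simp: smooth_on_def)
qed

lemma smooth_on_sum: "open S \<Longrightarrow> (\<And>i. i \<in> I \<Longrightarrow> smooth_on S (f i)) \<Longrightarrow> smooth_on S (\<lambda>x. \<Sum>i\<in>I. f i x)"
  by (induction I rule: infinite_finite_induct) (auto intro: smooth_on_add smooth_on_const)

section \<open>The exterior derivative\<close>

definition dir_deriv :: "('v::real_normed_vector \<Rightarrow> 'a list \<Rightarrow> complex) \<Rightarrow> 'v \<Rightarrow> 'v \<Rightarrow> 'a list \<Rightarrow> complex" where
  "dir_deriv \<beta> z v vs = frechet_derivative (\<lambda>w. \<beta> w vs) (at z) v"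

text \<open>
  Cartan's formula for a constant vector field. As a recursion on the arguments it reduces all
  rules for \<open>ext_d\<close> to rules for directional derivatives.
\<close>

lemma interior_ext_d: "interior v (ext_d \<beta> z) = dir_deriv \<beta> z v - ext_d (\<lambda>w. interior v (\<beta> w)) z"
proof
  fix vs
  have n0: "nths (v # vs) (- {0}) = vs"
  proof -
    have "{j. Suc j \<in> - {0}} = UNIV" by auto
    then show ?thesis by (simp add: nths_Cons nths_all)
  qed
  have nS: "nths (v # vs) (- {Suc i}) = v # nths vs (- {i})" for i
  proof -
    have "{j. Suc j \<in> - {Suc i}} = - {i}" by auto
    then show ?thesis by (simp add: nths_Cons)
  qed
  show "interior v (ext_d \<beta> z) vs = (dir_deriv \<beta> z v - ext_d (\<lambda>w. interior v (\<beta> w)) z) vs"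
    unfolding interior_def ext_d_def length_Cons
    by (subst sum.lessThan_Suc_shift) (simp add: n0 nS dir_deriv_def sum_negf)
qed

lemma ext_d_Nil: "ext_d \<beta> z [] = 0"
  by (simp add: ext_d_def)

definition diffble :: "('v::real_normed_vector \<Rightarrow> 'a list \<Rightarrow> complex) \<Rightarrow> 'v \<Rightarrow> bool" where
  "diffble \<beta> z \<longleftrightarrow> (\<forall>vs. (\<lambda>w. \<beta> w vs) differentiable (at z))"

lemma diffbleD: "diffble \<beta> z \<Longrightarrow> ((\<lambda>w. \<beta> w vs) has_derivative (\<lambda>v. dir_deriv \<beta> z v vs)) (at z)"
  unfolding diffble_def dir_deriv_def by (metis frechet_derivative_works)

lemma diffble_dir_derivI:
  assumes "\<And>vs. ((\<lambda>w. \<beta> w vs) has_derivative (\<lambda>v. D v vs)) (at z)"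
  shows "diffble \<beta> z" "dir_deriv \<beta> z = D"
  using assms frechet_derivative_at[OF assms]
  by (auto simp: diffble_def dir_deriv_def fun_eq_iff differentiable_def)

lemma diffble_interior: "diffble \<beta> z \<Longrightarrow> diffble (\<lambda>w. interior u (\<beta> w)) z"
  and dir_deriv_interior: "dir_deriv (\<lambda>w. interior u (\<beta> w)) z v = interior u (dir_deriv \<beta> z v)"
  by (auto simp: diffble_def interior_def dir_deriv_def fun_eq_iff)

lemma has_derivative_emul:
  assumes "diffble \<beta> z" "diffble \<gamma> z"
  shows "((\<lambda>w. (\<beta> w \<odot> \<gamma> w) vs) has_derivative
    (\<lambda>v. (dir_deriv \<beta> z v \<odot> \<gamma> z + \<beta> z \<odot> dir_deriv \<gamma> z v) vs)) (at z)"
  using assms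
proof (induction vs arbitrary: \<beta> \<gamma>)
  case Nil
  show ?case
    by (simp add: emul_Nil) (rule has_derivative_eq_rhs[OF has_derivative_mult[OF diffbleD diffbleD]], use Nil in auto)
next
  case (Cons u vs)
  have f: "((\<lambda>w. parity (\<beta> w) xs) has_derivative (\<lambda>v. parity (dir_deriv \<beta> z v) xs)) (at z)" for xs
    unfolding parity_def by (intro has_derivative_mult_right diffbleD Cons.prems)
  note f' = diffble_dir_derivI[of "\<lambda>w. parity (\<beta> w)" "\<lambda>v. parity (dir_deriv \<beta> z v)", OF f]
  show ?case unfolding emul_Cons
    by (rule has_derivative_eq_rhs[OF has_derivative_add[OF
          Cons.IH[OF diffble_interior[OF Cons.prems(1)] Cons.prems(2)]
          Cons.IH[OF f'(1) diffble_interior[OF Cons.prems(2)]]]])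
      (auto simp: fun_eq_iff emul_Cons dir_deriv_interior f'(2))
qed

lemma diffble_emul: "diffble \<beta> z \<Longrightarrow> diffble \<gamma> z \<Longrightarrow> diffble (\<lambda>w. \<beta> w \<odot> \<gamma> w) z"
  and dir_deriv_emul: "diffble \<beta> z \<Longrightarrow> diffble \<gamma> z \<Longrightarrow>
    dir_deriv (\<lambda>w. \<beta> w \<odot> \<gamma> w) z v = dir_deriv \<beta> z v \<odot> \<gamma> z + \<beta> z \<odot> dir_deriv \<gamma> z v"
  using diffble_dir_derivI[where \<beta> = "\<lambda>w. \<beta> w \<odot> \<gamma> w", OF has_derivative_emul[of \<beta> z \<gamma>]] by auto

lemma dir_deriv_linear:
  "diffble \<beta> z \<Longrightarrow> diffble \<gamma> z \<Longrightarrow> dir_deriv (\<lambda>w. \<beta> w + \<gamma> w) z v = dir_deriv \<beta> z v + dir_deriv \<gamma> z v"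
  "diffble \<beta> z \<Longrightarrow> dir_deriv (\<lambda>w. scl c (\<beta> w)) z v = scl c (dir_deriv \<beta> z v)"
  "diffble \<beta> z \<Longrightarrow> dir_deriv (\<lambda>w. parity (\<beta> w)) z v = parity (dir_deriv \<beta> z v)"
proof -
  assume b: "diffble \<beta> z"
  show "diffble \<gamma> z \<Longrightarrow> dir_deriv (\<lambda>w. \<beta> w + \<gamma> w) z v = dir_deriv \<beta> z v + dir_deriv \<gamma> z v"
    by (rule fun_cong[OF diffble_dir_derivI(2)]) (simp, rule has_derivative_add[OF diffbleD[OF b] diffbleD])
  show "dir_deriv (\<lambda>w. scl c (\<beta> w)) z v = scl c (dir_deriv \<beta> z v)"
    by (rule fun_cong[OF diffble_dir_derivI(2)]) (auto simp: scl_def intro!: has_derivative_mult_right diffbleD[OF b])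
  show "dir_deriv (\<lambda>w. parity (\<beta> w)) z v = parity (dir_deriv \<beta> z v)"
    by (rule fun_cong[OF diffble_dir_derivI(2)]) (auto simp: parity_def intro!: has_derivative_mult_right diffbleD[OF b])
qed

lemma diffble_linear:
  "diffble \<beta> z \<Longrightarrow> diffble \<gamma> z \<Longrightarrow> diffble (\<lambda>w. \<beta> w + \<gamma> w) z"
  "diffble \<beta> z \<Longrightarrow> diffble (\<lambda>w. scl c (\<beta> w)) z"
  "diffble \<beta> z \<Longrightarrow> diffble (\<lambda>w. parity (\<beta> w)) z"
  by (auto simp: diffble_def scl_def parity_def intro!: derivative_intros)

lemma ext_d_add: "diffble \<beta> z \<Longrightarrow> diffble \<gamma> z \<Longrightarrow> ext_d (\<lambda>w. \<beta> w + \<gamma> w) z = ext_d \<beta> z + ext_d \<gamma> z"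
proof
  fix vs show "diffble \<beta> z \<Longrightarrow> diffble \<gamma> z \<Longrightarrow> ext_d (\<lambda>w. \<beta> w + \<gamma> w) z vs = (ext_d \<beta> z + ext_d \<gamma> z) vs"
    by (induction vs arbitrary: \<beta> \<gamma>) (simp_all add: ext_d_Nil interior_value interior_ext_d interior_simps dir_deriv_linear diffble_interior)
qed

lemma ext_d_scl: "diffble \<beta> z \<Longrightarrow> ext_d (\<lambda>w. scl c (\<beta> w)) z = scl c (ext_d \<beta> z)"
proof
  fix vs show "diffble \<beta> z \<Longrightarrow> ext_d (\<lambda>w. scl c (\<beta> w)) z vs = scl c (ext_d \<beta> z) vs"
    by (induction vs arbitrary: \<beta>)
      (simp_all add: ext_d_Nil interior_value interior_ext_d interior_simps dir_deriv_linear diffble_interior,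
       simp_all add: scl_def ext_d_Nil algebra_simps)
qed

lemma ext_d_minus: "diffble \<beta> z \<Longrightarrow> ext_d (\<lambda>w. - \<beta> w) z = - ext_d \<beta> z"
  using ext_d_scl[of \<beta> z "- 1"] by (simp add: scl_minus_one)

lemma diffble_diff: "diffble \<beta> z \<Longrightarrow> diffble \<gamma> z \<Longrightarrow> diffble (\<lambda>w. \<beta> w - \<gamma> w) z"
  and diffble_minus: "diffble \<beta> z \<Longrightarrow> diffble (\<lambda>w. - \<beta> w) z"
  by (auto simp: diffble_def intro!: derivative_intros)

lemma ext_d_diff: "diffble \<beta> z \<Longrightarrow> diffble \<gamma> z \<Longrightarrow> ext_d (\<lambda>w. \<beta> w - \<gamma> w) z = ext_d \<beta> z - ext_d \<gamma> z"
  using ext_d_add[of \<beta> z "\<lambda>w. - \<gamma> w"] by (simp add: diffble_minus ext_d_minus)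

lemma ext_d_parity: "diffble \<beta> z \<Longrightarrow> ext_d (\<lambda>w. parity (\<beta> w)) z = - parity (ext_d \<beta> z)"
proof
  fix vs show "diffble \<beta> z \<Longrightarrow> ext_d (\<lambda>w. parity (\<beta> w)) z vs = (- parity (ext_d \<beta> z)) vs"
  proof (induction vs arbitrary: \<beta>)
    case (Cons v vs)
    then show ?case
      by (simp add: interior_value interior_ext_d interior_simps parity_simps dir_deriv_linear ext_d_minus diffble_interior diffble_linear)
  qed (simp add: ext_d_Nil parity_def)
qed

text \<open>
  Contract both sides with \<open>v\<close> and use Cartan's formula together with the product rule for the
  directional derivative; the induction hypothesis applies to \<open>interior v \<beta>\<close> and \<open>interior v \<gamma>\<close>.
\<close>

lemma ext_d_emul:
  assumes "diffble \<beta> z" "diffble \<gamma> z"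
  shows "ext_d (\<lambda>w. \<beta> w \<odot> \<gamma> w) z = ext_d \<beta> z \<odot> \<gamma> z + parity (\<beta> z) \<odot> ext_d \<gamma> z"
proof
  fix vs show "ext_d (\<lambda>w. \<beta> w \<odot> \<gamma> w) z vs = (ext_d \<beta> z \<odot> \<gamma> z + parity (\<beta> z) \<odot> ext_d \<gamma> z) vs"
    using assms
  proof (induction vs arbitrary: \<beta> \<gamma>)
    case Nil
    then show ?case by (simp add: ext_d_Nil emul_Nil)
  next
    case (Cons v vs)
    note d = Cons.prems
    have "ext_d (\<lambda>w. interior v (\<beta> w \<odot> \<gamma> w)) z =
      ext_d (\<lambda>w. interior v (\<beta> w) \<odot> \<gamma> w) z + ext_d (\<lambda>w. parity (\<beta> w) \<odot> interior v (\<gamma> w)) z"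
      by (simp only: interior_simps) (rule ext_d_add; intro diffble_emul diffble_interior diffble_linear d)
    then show ?case
      by (simp add: interior_value interior_ext_d dir_deriv_emul d Cons.IH diffble_interior diffble_linear)
         (simp add: interior_simps interior_ext_d emul_linear parity_simps ext_d_parity d)
  qed
qed

lemma ext_d_cong_open:
  assumes "open S" "z \<in> S" "\<And>w. w \<in> S \<Longrightarrow> \<beta> w = \<gamma> w"
  shows "ext_d \<beta> z = ext_d \<gamma> z"
proof -
  have "((\<lambda>w. \<beta> w xs) has_derivative D) (at z) \<longleftrightarrow> ((\<lambda>w. \<gamma> w xs) has_derivative D) (at z)" for D xs
    using has_derivative_transform_within_open[OF _ assms(1,2)] assms(3) by metis
  then show ?thesis unfolding ext_d_def frechet_derivative_def by simp
qed

lemma ext_d_1: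
  "ext_d (\<lambda>w. cov (p w)) z [u, v] =
    frechet_derivative (\<lambda>w. p w v) (at z) u - frechet_derivative (\<lambda>w. p w u) (at z) v"
  by (simp add: ext_d_def numeral_2_eq_2 nths_Cons cov_values)

section \<open>Smooth forms\<close>

lemma smooth_form_onI:
  assumes "\<And>z. z \<in> S \<Longrightarrow> alt_form k (\<beta> z)" "\<And>vs. smooth_on S (\<lambda>z. \<beta> z vs)"
  shows "smooth_form_on S k \<beta>"
  using assms by (auto simp: smooth_form_on_def)

lemma smooth_on_emul:
  assumes "open S" "\<And>vs. smooth_on S (\<lambda>z. \<beta> z vs)" "\<And>vs. smooth_on S (\<lambda>z. \<gamma> z vs)"
  shows "smooth_on S (\<lambda>z. (\<beta> z \<odot> \<gamma> z) vs)"
  using assms(2,3)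
proof (induction vs arbitrary: \<beta> \<gamma>)
  case Nil
  then show ?case by (auto simp: emul_Nil intro: smooth_on_mult assms(1))
next
  case (Cons v vs)
  show ?case unfolding emul_Cons
    by (intro smooth_on_add Cons.IH assms(1), simp_all only: interior_def parity_def)
       (intro Cons.prems smooth_on_mult smooth_on_const assms(1))+
qed

lemma smooth_form_on_wedge:
  assumes "open S" "smooth_form_on S k \<beta>" "smooth_form_on S l \<gamma>"
  shows "smooth_form_on S (k + l) (\<beta> \<and>\<^sub>f \<gamma>)"
  using assms by (auto simp: smooth_form_on_def wedge_emul alt_form_emul smooth_on_emul)

lemma scale_form_scl: "(f *\<^sub>f \<beta>) z = scl (f z) (\<beta> z)"
  by (auto simp: scale_form_def scl_def)

lemma smooth_form_on_scale:
  assumes "open S" "smooth_on S f" "smooth_form_on S k \<beta>"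
  shows "smooth_form_on S k (f *\<^sub>f \<beta>)"
  using assms by (auto simp: smooth_form_on_def scale_form_scl alt_form_linear) (simp add: scl_def smooth_on_mult)

lemma smooth_form_on_add:
  assumes "open S" "smooth_form_on S k \<beta>" "smooth_form_on S k \<gamma>"
  shows "smooth_form_on S k (\<beta> + \<gamma>)"
  using assms by (auto simp: smooth_form_on_def alt_form_linear smooth_on_add)

lemma smooth_form_on_linear:
  assumes "open S" "bounded_linear h" "smooth_form_on S k \<beta>"
  shows "smooth_form_on S k (\<lambda>z vs. h (\<beta> z vs))"
  using assms by (auto simp: smooth_form_on_def alt_form_compose_linear bounded_linear.linear intro!: smooth_on_compose_linear[of S h])

section \<open>The Pfaffian and the determinant\<close>

text \<open>
  The determinant of the matrix with rows \<open>a, b, c, d\<close>, as a value of \<open>\<Omega>\<^sub>0\<close>.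
\<close>

definition det4 :: "complex^4 \<Rightarrow> complex^4 \<Rightarrow> complex^4 \<Rightarrow> complex^4 \<Rightarrow> complex" where
  "det4 a b c d = (cov (\<lambda>v. v $ 1) \<odot> cov (\<lambda>v. v $ 2) \<odot> cov (\<lambda>v. v $ 3) \<odot> cov (\<lambda>v. v $ 4)) [a, b, c, d]"

lemma cov_emul_values:
  "(cov p \<odot> \<beta>) [] = 0"
  "(cov p \<odot> \<beta>) [a] = p a * \<beta> []"
  "(cov p \<odot> \<beta>) [a, b] = p a * \<beta> [b] - p b * \<beta> [a]"
  "(cov p \<odot> \<beta>) [a, b, c] = p a * \<beta> [b, c] - p b * \<beta> [a, c] + p c * \<beta> [a, b]"
  "(cov p \<odot> \<beta>) [a, b, c, d] = p a * \<beta> [b, c, d] - p b * \<beta> [a, c, d] + p c * \<beta> [a, b, d] - p d * \<beta> [a, b, c]"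
proof -
  show 0: "(cov p \<odot> \<beta>) [] = 0" for \<beta> by (simp add: emul_Nil cov_values)
  show 1: "(cov p \<odot> \<beta>) [a] = p a * \<beta> []" for a \<beta>
    by (subst cov_emul_value) (simp add: 0)
  show 2: "(cov p \<odot> \<beta>) [a, b] = p a * \<beta> [b] - p b * \<beta> [a]" for a b \<beta>
    by (subst cov_emul_value) (simp add: 1 interior_def)
  show 3: "(cov p \<odot> \<beta>) [a, b, c] = p a * \<beta> [b, c] - p b * \<beta> [a, c] + p c * \<beta> [a, b]" for a b c \<beta>
    by (subst cov_emul_value) (simp add: 2 interior_def)
  show "(cov p \<odot> \<beta>) [a, b, c, d] = p a * \<beta> [b, c, d] - p b * \<beta> [a, c, d] + p c * \<beta> [a, b, d] - p d * \<beta> [a, b, c]"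
    by (subst cov_emul_value) (simp add: 3 interior_def)
qed

lemma det4_det: "det4 a b c d = det (vector [a, b, c, d] :: complex^4^4)"
proof -
  have f123: "finite {2::4, 3, 4}" "1 \<notin> {2::4, 3, 4}" "finite {3::4, 4}" "2 \<notin> {3::4, 4}" "finite {4::4}" "3 \<notin> {4::4}" by auto
  have v: "vector [a, b, c, d] $ 1 = a" "vector [a, b, c, d] $ (2::4) = b" "vector [a, b, c, d] $ (3::4) = c"
      "vector [a, b, c, d] $ (4::4) = d" for a b c d :: "complex^4"
    by (simp_all add: vector_def)
  show ?thesis
    unfolding det_def UNIV_4
    unfolding sum_over_permutations_insert[OF f123(1,2)] sum_over_permutations_insert[OF f123(3,4)] sum_over_permutations_insert[OF f123(5,6)]
    unfolding permutes_sing
    by (simp add: sign_swap_id permutation_swap_id permutation_compose sign_compose sign_id det4_def cov_emul_values cov_values v algebra_simps)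
qed

text \<open>
  The bilinear form of \<open>M\<close>: the twist form at \<open>z\<close> is \<open>mform M z\<close>, and its derivative is \<open>2 mform M\<close>.
\<close>

definition mform :: "complex^4^4 \<Rightarrow> complex^4 \<Rightarrow> complex^4 \<Rightarrow> complex" where
  "mform M u v = (\<Sum>i\<in>UNIV. \<Sum>j\<in>UNIV. u $ i * M $ i $ j * v $ j)"

definition pfaffian :: "complex^4^4 \<Rightarrow> complex" where
  "pfaffian M = M $ 1 $ 2 * M $ 3 $ 4 - M $ 1 $ 3 * M $ 2 $ 4 + M $ 1 $ 4 * M $ 2 $ 3"

text \<open>
  The vector \<open>b\<close> with components \<open>cnj a\<^sub>j\<close>, where \<open>\<alpha> = \<Sum>a\<^sub>jdz\<^sub>j\<close>; contraction with \<open>b\<close> is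
  \<open>bar_contract\<close>.
\<close>

definition sharp :: "complex^4^4 \<Rightarrow> complex^4 \<Rightarrow> complex^4" where
  "sharp M z = (\<chi> j. cnj (\<Sum>i\<in>UNIV. z $ i * M $ i $ j))"

lemma skew_entries:
  assumes "transpose M = - M"
  shows "M $ 1 $ 1 = 0" "M $ 2 $ 2 = 0" "M $ 3 $ 3 = 0" "M $ 4 $ 4 = (0::complex)"
    "M $ 2 $ 1 = - M $ 1 $ 2" "M $ 3 $ 1 = - M $ 1 $ 3" "M $ 4 $ 1 = - M $ 1 $ 4"
    "M $ 3 $ 2 = - M $ 2 $ 3" "M $ 4 $ 2 = - M $ 2 $ 4" "M $ 4 $ 3 = - M $ 3 $ 4"
proof -
  have e: "M $ j $ i = - M $ i $ j" for i j
    using arg_cong[OF assms, of "\<lambda>A. A $ i $ j"] by (simp add: transpose_def)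
  have "M $ i $ i = 0" for i using e[of i i] by (simp add: equation_minus_iff)
  then show "M $ 1 $ 1 = 0" "M $ 2 $ 2 = 0" "M $ 3 $ 3 = 0" "M $ 4 $ 4 = (0::complex)" by auto
  show "M $ 2 $ 1 = - M $ 1 $ 2" "M $ 3 $ 1 = - M $ 1 $ 3" "M $ 4 $ 1 = - M $ 1 $ 4"
    "M $ 3 $ 2 = - M $ 2 $ 3" "M $ 4 $ 2 = - M $ 2 $ 4" "M $ 4 $ 3 = - M $ 3 $ 4" by (rule e)+
qed

lemma mform_skew: "transpose M = - M \<Longrightarrow> mform M u v = - mform M v u"
  by (simp add: mform_def sum_4 skew_entries algebra_simps)

text \<open>
  This is \<open>m \<and> m = 2 Pf \<Omega>\<^sub>0\<close> evaluated on four vectors and divided by 2.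
\<close>

lemma pfaffian_det4:
  assumes "transpose M = - M"
  shows "pfaffian M * det4 z b u v =
    mform M z b * mform M u v - mform M z u * mform M b v + mform M z v * mform M b u"
proof -
  define p :: "4 \<Rightarrow> 4 \<Rightarrow> complex^4 \<Rightarrow> complex^4 \<Rightarrow> complex" where "p i j u v = u $ i * v $ j - u $ j * v $ i" for i j u v
  \<comment> \<open>\<open>Q i j k l\<close> is the coefficient of \<open>M\<^sub>i\<^sub>jM\<^sub>k\<^sub>l\<close> on the right. Symmetrised, it is the Pluecker relation and
    vanishes unless the four indices are distinct. Treating the coefficients as
    atoms keeps the polynomial identities small.\<close>
  define Q where "Q i j k l = p i j z b * p k l u v - p i j z u * p k l b v + p i j z v * p k l b u" for i j k l
  define D where "D = det4 z b u v"
  have m: "mform M u v = M $ 1 $ 2 * p 1 2 u v + M $ 1 $ 3 * p 1 3 u v + M $ 1 $ 4 * p 1 4 u v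
    + M $ 2 $ 3 * p 2 3 u v + M $ 2 $ 4 * p 2 4 u v + M $ 3 $ 4 * p 3 4 u v" for u v
    by (simp add: mform_def sum_4 skew_entries[OF assms] p_def algebra_simps)
  have S: "Q 1 2 1 2 = 0"
    "Q 1 2 1 3 + Q 1 3 1 2 = 0"
    "Q 1 2 1 4 + Q 1 4 1 2 = 0"
    "Q 1 2 2 3 + Q 2 3 1 2 = 0"
    "Q 1 2 2 4 + Q 2 4 1 2 = 0"
    "Q 1 2 3 4 + Q 3 4 1 2 = D"
    "Q 1 3 1 3 = 0"
    "Q 1 3 1 4 + Q 1 4 1 3 = 0"
    "Q 1 3 2 3 + Q 2 3 1 3 = 0"
    "Q 1 3 2 4 + Q 2 4 1 3 = - D"
    "Q 1 3 3 4 + Q 3 4 1 3 = 0"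
    "Q 1 4 1 4 = 0"
    "Q 1 4 2 3 + Q 2 3 1 4 = D"
    "Q 1 4 2 4 + Q 2 4 1 4 = 0"
    "Q 1 4 3 4 + Q 3 4 1 4 = 0"
    "Q 2 3 2 3 = 0"
    "Q 2 3 2 4 + Q 2 4 2 3 = 0"
    "Q 2 3 3 4 + Q 3 4 2 3 = 0"
    "Q 2 4 2 4 = 0"
    "Q 2 4 3 4 + Q 3 4 2 4 = 0"
    "Q 3 4 3 4 = 0"
    unfolding Q_def p_def D_def det4_def cov_emul_values cov_values
    by (simp_all add: algebra_simps)
  have "mform M z b * mform M u v - mform M z u * mform M b v + mform M z v * mform M b u =
    M $ 1 $ 2 * M $ 1 $ 2 * (Q 1 2 1 2)
    + M $ 1 $ 2 * M $ 1 $ 3 * (Q 1 2 1 3 + Q 1 3 1 2)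
    + M $ 1 $ 2 * M $ 1 $ 4 * (Q 1 2 1 4 + Q 1 4 1 2)
    + M $ 1 $ 2 * M $ 2 $ 3 * (Q 1 2 2 3 + Q 2 3 1 2)
    + M $ 1 $ 2 * M $ 2 $ 4 * (Q 1 2 2 4 + Q 2 4 1 2)
    + M $ 1 $ 2 * M $ 3 $ 4 * (Q 1 2 3 4 + Q 3 4 1 2)
    + M $ 1 $ 3 * M $ 1 $ 3 * (Q 1 3 1 3)
    + M $ 1 $ 3 * M $ 1 $ 4 * (Q 1 3 1 4 + Q 1 4 1 3)
    + M $ 1 $ 3 * M $ 2 $ 3 * (Q 1 3 2 3 + Q 2 3 1 3)
    + M $ 1 $ 3 * M $ 2 $ 4 * (Q 1 3 2 4 + Q 2 4 1 3)
    + M $ 1 $ 3 * M $ 3 $ 4 * (Q 1 3 3 4 + Q 3 4 1 3)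
    + M $ 1 $ 4 * M $ 1 $ 4 * (Q 1 4 1 4)
    + M $ 1 $ 4 * M $ 2 $ 3 * (Q 1 4 2 3 + Q 2 3 1 4)
    + M $ 1 $ 4 * M $ 2 $ 4 * (Q 1 4 2 4 + Q 2 4 1 4)
    + M $ 1 $ 4 * M $ 3 $ 4 * (Q 1 4 3 4 + Q 3 4 1 4)
    + M $ 2 $ 3 * M $ 2 $ 3 * (Q 2 3 2 3)
    + M $ 2 $ 3 * M $ 2 $ 4 * (Q 2 3 2 4 + Q 2 4 2 3)
    + M $ 2 $ 3 * M $ 3 $ 4 * (Q 2 3 3 4 + Q 3 4 2 3)
    + M $ 2 $ 4 * M $ 2 $ 4 * (Q 2 4 2 4)
    + M $ 2 $ 4 * M $ 3 $ 4 * (Q 2 4 3 4 + Q 3 4 2 4)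
    + M $ 3 $ 4 * M $ 3 $ 4 * (Q 3 4 3 4)"
    unfolding m Q_def by (simp only: ring_distribs ac_simps diff_conv_add_uminus mult_minus_left mult_minus_right minus_add_distrib minus_minus)
  also have "\<dots> = pfaffian M * D"
    unfolding S pfaffian_def by (simp add: algebra_simps)
  finally show ?thesis by (simp add: D_def)
qed

text \<open>
  Invertibility of \<open>M\<close> enters the whole proof as \<open>Pf \<noteq> 0\<close>.
\<close>

lemma det_skew_pfaffian:
  assumes "transpose M = - M"
  shows "det M = (pfaffian M)\<^sup>2"
proof -
  have "det M = det4 (M $ 1) (M $ 2) (M $ 3) (M $ 4)"
    unfolding det4_det by (rule arg_cong[where f = det]) (simp add: vec_eq_iff forall_4 vector_def)
  then show ?thesis
    by (simp add: det4_def cov_emul_values cov_values skew_entries[OF assms] pfaffian_def power2_eq_square algebra_simps)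
qed

lemma pfaffian_nonzero: "transpose M = - M \<Longrightarrow> invertible M \<Longrightarrow> pfaffian M \<noteq> 0"
  using det_skew_pfaffian[of M] by (auto simp: invertible_det_nz)

section \<open>Complex conjugation and forms of low degree\<close>

definition conj_ext :: "('a list \<Rightarrow> complex) \<Rightarrow> 'a list \<Rightarrow> complex" where
  "conj_ext \<beta> vs = cnj (\<beta> vs)"

lemma conj_ext_linear:
  "conj_ext (\<beta> + \<gamma>) = conj_ext \<beta> + conj_ext \<gamma>"
  "conj_ext (\<beta> - \<gamma>) = conj_ext \<beta> - conj_ext \<gamma>"
  "conj_ext (- \<beta>) = - conj_ext \<beta>"
  "conj_ext (scl c \<beta>) = scl (cnj c) (conj_ext \<beta>)"
  "conj_ext (conj_ext \<beta>) = \<beta>"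
  "conj_ext (parity \<beta>) = parity (conj_ext \<beta>)"
  "conj_ext (interior v \<beta>) = interior v (conj_ext \<beta>)"
  "conj_ext 0 = 0"
  by (auto simp: conj_ext_def scl_def fun_eq_iff parity_def interior_def)

lemma conj_ext_emul: "conj_ext (\<beta> \<odot> \<gamma>) = conj_ext \<beta> \<odot> conj_ext \<gamma>"
proof
  fix vs show "conj_ext (\<beta> \<odot> \<gamma>) vs = (conj_ext \<beta> \<odot> conj_ext \<gamma>) vs"
    unfolding conj_ext_def[of "_ \<odot> _"]
    by (induction vs arbitrary: \<beta> \<gamma>)
      (simp_all add: emul_Nil emul_Cons conj_ext_linear(6,7)[symmetric], simp_all add: conj_ext_def)
qed

lemma conj_ext_cov: "conj_ext (cov p) = cov (\<lambda>v. cnj (p v))"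
  by (auto simp: conj_ext_def cov_def fun_eq_iff split: list.splits)

lemma cnj_form_conj_ext: "cnj_form \<beta> z = conj_ext (\<beta> z)"
  by (auto simp: cnj_form_def conj_ext_def)

text \<open>
  A one-form commutes with every form up to the degree sign of that form.
\<close>

lemma cov_emul_commute: "cov p \<odot> \<beta> = parity \<beta> \<odot> cov p"
proof
  fix vs show "(cov p \<odot> \<beta>) vs = (parity \<beta> \<odot> cov p) vs"
  proof (induction vs arbitrary: \<beta>)
    case (Cons v vs)
    then show ?case
      by (simp add: emul_Cons interior_simps parity_simps interior_cov parity_cov const_form_emul emul_const_form emul_linear)
  qed (simp add: emul_Nil cov_values)
qed

lemma cov_commute_even: "homog 2 \<beta> \<Longrightarrow> \<beta> \<odot> cov p = cov p \<odot> \<beta>"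
  by (subst cov_emul_commute) (simp add: homog_parity scl_def[abs_def])

lemma homog2_eqI:
  assumes "homog 2 \<beta>" "homog 2 \<gamma>" "\<And>u v. \<beta> [u, v] = \<gamma> [u, v]"
  shows "\<beta> = \<gamma>"
proof
  fix vs
  show "\<beta> vs = \<gamma> vs"
  proof (cases "length vs = 2")
    case True
    then obtain u v where "vs = [u, v]" by (auto simp: numeral_2_eq_2 length_Suc_conv)
    then show ?thesis using assms(3) by simp
  next
    case False
    then show ?thesis using assms(1,2) by (simp add: homog_def)
  qed
qed

lemma homog_cov_cov: "homog 2 (cov p \<odot> cov q)"
  using homog_emul[OF homog_cov homog_cov, of p q] by (simp add: numeral_2_eq_2)

lemma homog_ext_d:
  assumes "\<And>w. homog k (\<beta> w)"
  shows "homog (Suc k) (ext_d \<beta> z)"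
  unfolding homog_def
proof (intro allI impI)
  fix vs :: "(complex^4) list" assume l: "length vs \<noteq> Suc k"
  have "frechet_derivative (\<lambda>w. \<beta> w (nths vs (- {i}))) (at z) (vs ! i) = 0" if "i < length vs" for i
  proof -
    have "{j. j < length vs \<and> j \<in> - {i}} = {..<length vs} - {i}" by auto
    then have "length (nths vs (- {i})) = length vs - 1" using that by (simp add: length_nths)
    then have "(\<lambda>w. \<beta> w (nths vs (- {i}))) = (\<lambda>w. 0)"
      using assms l that by (intro ext) (auto simp: homog_def)
    then show ?thesis by simp
  qed
  then show "ext_d \<beta> z vs = 0" by (simp add: ext_d_def)
qed

lemma homog1_eqI:
  assumes "homog (Suc 0) \<beta>" "\<And>v. \<beta> [v] = p v"
  shows "\<beta> = cov p"
proof
  fix vs show "\<beta> vs = cov p vs"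
  proof (cases "length vs = 1")
    case True
    then show ?thesis using assms(2) by (auto simp: cov_values length_Suc_conv)
  next
    case False
    then show ?thesis using assms(1) homog_cov[of p] by (simp add: homog_def)
  qed
qed

lemma ext_d_const_form: "(f has_derivative D) (at z) \<Longrightarrow> ext_d (\<lambda>w. const_form (f w)) z = cov D"
proof (rule homog1_eqI)
  show "homog (Suc 0) (ext_d (\<lambda>w. const_form (f w)) z)"
    by (rule homog_ext_d) (simp add: homog_def const_form_def)
  assume "(f has_derivative D) (at z)"
  then show "ext_d (\<lambda>w. const_form (f w)) z [v] = D v" for v
    using frechet_derivative_at[of f D z] by (simp add: ext_d_def nths_Cons const_form_def)
qed

lemma ext_d_const: "(\<And>w. \<beta> w = \<gamma>) \<Longrightarrow> ext_d \<beta> z = 0"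
  by (rule ext) (simp add: ext_d_def)

lemma ext_d_conj:
  assumes "diffble \<beta> z" shows "ext_d (\<lambda>w. conj_ext (\<beta> w)) z = conj_ext (ext_d \<beta> z)"
proof
  fix vs
  have "frechet_derivative (\<lambda>w. cnj (\<beta> w xs)) (at z) v = cnj (frechet_derivative (\<lambda>w. \<beta> w xs) (at z) v)" for xs v
    using frechet_derivative_at[OF bounded_linear.has_derivative[OF bounded_linear_cnj diffbleD[OF assms, of xs]]]
    by (simp add: fun_eq_iff dir_deriv_def)
  then show "ext_d (\<lambda>w. conj_ext (\<beta> w)) z vs = conj_ext (ext_d \<beta> z) vs"
    by (simp add: ext_d_def conj_ext_def)
qed

lemma diffble_const_form: "f differentiable (at z) \<Longrightarrow> diffble (\<lambda>w. const_form (f w)) z"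
  unfolding diffble_def const_form_def by (intro allI, case_tac "vs = []") simp_all

lemma diffble_cov: "(\<And>v. (\<lambda>w. p w v) differentiable (at z)) \<Longrightarrow> diffble (\<lambda>w. cov (p w)) z"
proof -
  assume d: "\<And>v. (\<lambda>w. p w v) differentiable (at z)"
  have "(\<lambda>w. cov (p w) vs) differentiable (at z)" for vs
  proof (cases "\<exists>v. vs = [v]")
    case True
    then show ?thesis using d by (auto simp: cov_values)
  next
    case False
    then have "length vs \<noteq> 1" by (auto simp: length_Suc_conv)
    then have "(\<lambda>w. cov (p w) vs) = (\<lambda>w. 0)" using homog_cov by (auto simp: homog_def)
    then show ?thesis by simp
  qed
  then show "diffble (\<lambda>w. cov (p w)) z" by (simp add: diffble_def)
qed

lemma diffble_const: "diffble (\<lambda>w. \<beta>) z"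
  by (auto simp: diffble_def)

lemma diffble_conj: "diffble \<beta> z \<Longrightarrow> diffble (\<lambda>w. conj_ext (\<beta> w)) z"
  unfolding diffble_def conj_ext_def differentiable_def
  using bounded_linear.has_derivative[OF bounded_linear_cnj] by blast

section \<open>The twist form\<close>

lemma scaleR_complex: "r *\<^sub>R x = of_real r * (x::complex)"
  by (simp add: scaleR_conv_of_real)

lemma mform_linear:
  "mform M (u + u') v = mform M u v + mform M u' v"
  "mform M u (v + v') = mform M u v + mform M u v'"
  "mform M (c *s u) v = c * mform M u v"
  "mform M u (c *s v) = c * mform M u v"
  "mform M (r *\<^sub>R u) v = of_real r * mform M u v"
  "mform M u (r *\<^sub>R v) = of_real r * mform M u v"
  by (simp_all add: mform_def sum_4 algebra_simps scaleR_complex)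

lemma linear_mform: "linear (mform M u)" "linear (\<lambda>u. mform M u v)"
  by (auto intro!: linearI simp: mform_linear scaleR_complex)

lemma mform_expand: "mform M u v = (\<Sum>j\<in>UNIV. u $ j * mform M (axis j 1) v)"
    "mform M u v = (\<Sum>j\<in>UNIV. v $ j * mform M u (axis j 1))"
  by (simp_all add: mform_def sum_4 axis_def algebra_simps)

lemma mform_axis: "mform M (axis j c) v = c * mform M (axis j 1) v" "mform M u (axis j c) = c * mform M u (axis j 1)"
proof -
  have "axis j c = c *s (axis j 1 :: complex^4)" by (simp add: vec_eq_iff axis_def)
  then show "mform M (axis j c) v = c * mform M (axis j 1) v" "mform M u (axis j c) = c * mform M u (axis j 1)"
    by (simp_all add: mform_linear)
qed

lemma sharp_nth: "sharp M z $ j = cnj (mform M z (axis j 1))"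
  by (simp add: sharp_def mform_def sum_4 axis_def) (use exhaust_4[of j] in auto)

lemma mform_sharp: "mform M u (sharp M z) = (\<Sum>j\<in>UNIV. mform M u (axis j 1) * cnj (mform M z (axis j 1)))"
  by (subst mform_expand(2)) (simp add: sharp_nth mult.commute)

lemma cnj_mform_sharp: "cnj (mform M u (sharp M z)) = mform M z (sharp M u)"
  by (simp add: mform_sharp mult.commute)

lemma linear_sharp: "linear (sharp M)"
  by (rule linearI) (simp_all add: vec_eq_iff sharp_nth mform_linear scaleR_complex)

lemma sharp_smult: "sharp M (c *s z) = cnj c *s sharp M z"
  by (simp add: vec_eq_iff sharp_nth mform_linear)

lemma dz_cov: "dz j z = cov (\<lambda>v. v $ j)"
  by (auto simp: dz_def cov_def fun_eq_iff split: list.splits)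

lemma alphaM_cov: "alphaM M z = cov (mform M z)"
  by (rule ext) (auto simp: alphaM_def dz_cov cov_def mform_def split: list.splits)

lemma contr_dz_alphaM: "contr_dz j (alphaM M) z [] = mform M z (axis j 1)"
  by (simp add: contr_dz_def alphaM_cov cov_values mform_axis(2)[of M z j \<i>])

lemma norm_sq_alphaM: "norm_sq (alphaM M) z = mform M z (sharp M z)"
  by (simp add: norm_sq_def bar_contract_def contr_dz_alphaM mform_sharp mult.commute)

lemma norm_sq_alphaM_real: "norm_sq (alphaM M) z = of_real ((norm (sharp M z))\<^sup>2)"
  by (simp add: norm_sq_alphaM mform_sharp norm_vec_def L2_set_def sharp_nth sum_nonneg complex_norm_square[symmetric])

lemma differentiable_linear: "linear f \<Longrightarrow> f differentiable (at (z::complex^4))"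
  by (simp add: linear_imp_differentiable)

lemma diffble_alphaM: "diffble (alphaM M) z"
  unfolding alphaM_cov by (rule diffble_cov) (rule differentiable_linear[OF linear_mform(2)])

lemma homog_ext_d_alphaM: "homog 2 (ext_d (alphaM M) z)"
  unfolding numeral_2_eq_2 by (rule homog_ext_d) (simp add: alphaM_cov homog_cov[simplified])

lemma frechet_linear: "linear f \<Longrightarrow> frechet_derivative f (at (z::complex^4)) = f"
  using frechet_derivative_at[OF linear_imp_has_derivative] by metis

lemma ext_d_alphaM:
  assumes "transpose M = - M"
  shows "ext_d (alphaM M) z [u, v] = 2 * mform M u v"
proof -
  have "ext_d (alphaM M) z [u, v] = ext_d (\<lambda>w. cov (mform M w)) z [u, v]"
    by (simp add: alphaM_cov[abs_def])
  also have "\<dots> = mform M u v - mform M v u"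
    by (subst ext_d_1) (simp add: frechet_linear[OF linear_mform(2)])
  finally show ?thesis using mform_skew[OF assms, of v u] by simp
qed

lemma ext_d_alphaM_const:
  assumes "transpose M = - M" shows "ext_d (alphaM M) z = ext_d (alphaM M) 0"
  by (rule homog2_eqI) (simp_all add: homog_ext_d_alphaM ext_d_alphaM assms)

lemma det4_swap: "det4 a b c d = - det4 b a c d"
  by (simp add: det4_def cov_emul_values cov_values algebra_simps)

lemma det4_axis: "det4 (axis j x) b c d = x * det4 (axis j 1) b c d"
  using exhaust_4[of j] by (auto simp: det4_def cov_emul_values cov_values axis_def algebra_simps)

lemma det4_expand: "det4 a b c d = (\<Sum>j\<in>UNIV. a $ j * det4 (axis j 1) b c d)"
  by (simp add: sum_4 det4_def cov_emul_values cov_values axis_def algebra_simps)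

lemma Omega0_cov: "Omega0 z = cov (\<lambda>v. v $ 1) \<odot> cov (\<lambda>v. v $ 2) \<odot> cov (\<lambda>v. v $ 3) \<odot> cov (\<lambda>v. v $ 4)"
  by (simp add: Omega0_def wedge_emul dz_cov)

lemma Omega0_det4: "Omega0 z [a, b, c, d] = det4 a b c d"
  by (simp add: Omega0_cov det4_def)

lemma homog_Omega0: "homog 4 (Omega0 z)"
proof -
  have "homog (1 + (1 + (1 + 1))) (Omega0 z)"
    unfolding Omega0_cov by (intro homog_emul homog_cov)
  then show ?thesis by (simp add: eval_nat_numeral)
qed

lemma contr_xi_Omega0: "contr_xi Omega0 z [b, c, d] = det4 z b c d"
  by (subst det4_expand[of z]) (simp add: contr_xi_def contr_dz_def Omega0_det4 det4_axis[of _ \<i>])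

text \<open>
  \<open>\<Omega>\<^sub>0\<close> is complex multilinear, so contracting its complex linear extension with a \<open>(1,0)\<close>-vector amounts
  to inserting the corresponding real vector as an argument.
\<close>

lemma hatOmegaM_value: "hatOmegaM M z [u, v] = det4 z (sharp M z) u v"
proof -
  have "hatOmegaM M z [u, v] = (\<Sum>j\<in>UNIV. sharp M z $ j * ((det4 z (axis j 1) u v - \<i> * det4 z (axis j \<i>) u v) / 2))"
    by (simp add: hatOmegaM_def bar_contract_def contr_dz_alphaM sharp_nth contr_dz_def[of _ "contr_xi Omega0"] contr_xi_Omega0)
  also have "\<dots> = - (\<Sum>j\<in>UNIV. sharp M z $ j * det4 (axis j 1) z u v)"
    by (simp add: det4_swap[of z] det4_axis[of _ \<i>] sum_negf)
  finally show ?thesis by (simp add: det4_expand[symmetric] det4_swap[of "sharp M z"])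
qed

lemma homog_hatOmegaM: "homog 2 (hatOmegaM M z)"
  unfolding homog_def hatOmegaM_def bar_contract_def contr_dz_def contr_xi_def
  using homog_Omega0[of z] by (auto simp: homog_def)

definition eta_fun :: "complex^4^4 \<Rightarrow> complex^4 \<Rightarrow> complex^4 \<Rightarrow> complex" where
  "eta_fun M z v = 2 * mform M (sharp M z) v * inv_norm_sq M z"

lemma etaM_cov:
  assumes "transpose M = - M" shows "etaM M z = cov (eta_fun M z)"
proof (rule homog1_eqI)
  show "homog (Suc 0) (etaM M z)"
    using homog_ext_d_alphaM[of M z]
    by (auto simp: homog_def etaM_def scale_form_def bar_contract_def contr_dz_def)
  fix v
  have i: "(2 * x - \<i> * (2 * (\<i> * x))) / 2 = 2 * x" for x
    using i_squared by (simp add: algebra_simps)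
  have "etaM M z [v] = inv_norm_sq M z * (\<Sum>j\<in>UNIV. sharp M z $ j * (2 * mform M (axis j 1) v))"
    by (simp add: etaM_def scale_form_def bar_contract_def contr_dz_alphaM sharp_nth
      contr_dz_def[of _ "ext_d (alphaM M)"] ext_d_alphaM assms mform_axis(1)[of M _ \<i>] i)
  then show "etaM M z [v] = eta_fun M z v"
    by (subst (asm) mult.left_commute) (simp add: eta_fun_def mform_expand(1)[of M "sharp M z"] sum_distrib_left[symmetric] ac_simps)
qed

section \<open>Invertible skew-symmetric matrices\<close>

text \<open>
  In the names below, \<open>b z\<close> is the vector dual to the twist form at \<open>z\<close>, and \<open>invn\<close> is \<open>1/N\<close>.
\<close>

locale invertible_skew =
  fixes M :: "complex^4^4"
  assumes skew: "transpose M = - M" and inv: "invertible M"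
begin

abbreviation "m \<equiv> mform M"
abbreviation "nsq z \<equiv> norm_sq (alphaM M) z"
abbreviation "\<alpha> \<equiv> alphaM M"
abbreviation "\<eta> \<equiv> etaM M"
abbreviation "b \<equiv> sharp M"
abbreviation "Pf \<equiv> pfaffian M"
abbreviation "invn \<equiv> inv_norm_sq M"

definition lambda :: "complex^4 \<Rightarrow> complex" where
  "lambda z = 2 * Pf * invn z"

lemma m_skew: "m u v = - m v u" using mform_skew[OF skew] .
lemma m_self: "m u u = 0" using m_skew[of u u] by simp
lemma Pf_nonzero: "Pf \<noteq> 0" using pfaffian_nonzero[OF skew inv] .

lemma sharp_nonzero: assumes "z \<noteq> 0" shows "b z \<noteq> 0"
proof
  assume "b z = 0"
  then have "m z (axis j 1) = 0" for j by (simp add: vec_eq_iff sharp_nth)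
  then have "m (axis j 1) z = 0" for j by (simp add: m_skew[of "axis j 1"])
  moreover have "m (axis j 1) z = (\<Sum>k\<in>UNIV. M $ j $ k * z $ k)" for j
    using exhaust_4[of j] by (auto simp: mform_def axis_def sum_4)
  ultimately have "M *v z = 0" by (simp add: vec_eq_iff matrix_vector_mult_def)
  moreover obtain A where "A ** M = mat 1" using inv by (auto simp: invertible_def)
  moreover have "mat 1 *v z = z" by (rule matrix_vector_mul_lid)
  ultimately have "z = A *v 0" by (simp add: matrix_vector_mul_assoc[symmetric] flip: \<open>A ** M = mat 1\<close>)
  then show False using assms by simp
qed

lemma nsq_nonzero: "z \<noteq> 0 \<Longrightarrow> nsq z \<noteq> 0"
  using sharp_nonzero by (simp add: norm_sq_alphaM_real)

lemma invn_eq: "invn z = 1 / nsq z" by (simp add: inv_norm_sq_def)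
lemma cnj_nsq: "cnj (nsq z) = nsq z" by (simp add: norm_sq_alphaM_real)
lemma cnj_invn: "cnj (invn z) = invn z" by (simp add: invn_eq cnj_nsq)
lemma invn_nsq: "z \<noteq> 0 \<Longrightarrow> invn z * nsq z = 1" by (simp add: invn_eq nsq_nonzero)
lemma lambda_nonzero: "z \<noteq> 0 \<Longrightarrow> lambda z \<noteq> 0"
  using Pf_nonzero nsq_nonzero by (simp add: lambda_def invn_eq)

text \<open>
  The Pfaffian identity for the vectors \<open>z\<close> and \<open>b\<close>, in which \<open>m(z,b) = N\<close> and \<open>2m(b,\<cdot>) = N\<eta>\<close>.
\<close>

lemma hatOmega_eq:
  assumes "z \<noteq> 0"
  shows "scl (lambda z) (hatOmegaM M z) = ext_d \<alpha> z - \<alpha> z \<odot> \<eta> z"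
proof (rule homog2_eqI)
  show "homog 2 (scl (lambda z) (hatOmegaM M z))" by (intro homog_linear homog_hatOmegaM)
  show "homog 2 (ext_d \<alpha> z - \<alpha> z \<odot> \<eta> z)"
    by (intro homog_linear homog_ext_d_alphaM) (simp add: alphaM_cov etaM_cov[OF skew] homog_cov_cov)
  fix u v
  have "lambda z * det4 z (b z) u v = 2 * invn z * (nsq z * m u v - m z u * m (b z) v + m z v * m (b z) u)"
    using pfaffian_det4[OF skew, of z "b z" u v] by (simp add: lambda_def norm_sq_alphaM)
  also have "\<dots> = 2 * m u v - m z u * eta_fun M z v + m z v * eta_fun M z u"
    using invn_nsq[OF assms] by (simp add: eta_fun_def algebra_simps)
  finally show "scl (lambda z) (hatOmegaM M z) [u, v] = (ext_d \<alpha> z - \<alpha> z \<odot> \<eta> z) [u, v]"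
    by (simp add: scl_def hatOmegaM_value ext_d_alphaM[OF skew] alphaM_cov etaM_cov[OF skew] cov_emul_cov
      ext_d_alphaM[OF skew, unfolded alphaM_cov[abs_def]])
qed

lemma nsq_deriv:
  "(nsq has_derivative (\<lambda>v. 2 * of_real (Re (m v (b z))))) (at z)"
proof -
  have l: "((\<lambda>w. m w (axis j 1)) has_derivative (\<lambda>v. m v (axis j 1))) (at z)" for j
    by (rule linear_imp_has_derivative[OF linear_mform(2)])
  have c: "((\<lambda>w. cnj (m w (axis j 1))) has_derivative (\<lambda>v. cnj (m v (axis j 1)))) (at z)" for j
    by (rule bounded_linear.has_derivative[OF bounded_linear_cnj l])
  have "((\<lambda>w. \<Sum>j\<in>UNIV. m w (axis j 1) * cnj (m w (axis j 1))) has_derivative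
      (\<lambda>v. \<Sum>j\<in>UNIV. m z (axis j 1) * cnj (m v (axis j 1)) + m v (axis j 1) * cnj (m z (axis j 1)))) (at z)"
    by (intro has_derivative_sum has_derivative_mult l c)
  then show ?thesis
    by (simp add: norm_sq_alphaM[abs_def] mform_sharp[symmetric] sum.distrib, subst (asm) cnj_mform_sharp[symmetric])
      (simp add: complex_add_cnj add.commute)
qed

text \<open>
  The real part of \<open>\<eta>\<close>. By \<open>invn_deriv\<close> it is the logarithmic derivative of \<open>1/N\<close>.
\<close>

definition rho :: "complex^4 \<Rightarrow> complex^4 \<Rightarrow> complex" where
  "rho z v = of_real (Re (eta_fun M z v))"

lemma rho_eq: "rho z v = (eta_fun M z v + cnj (eta_fun M z v)) / 2"
  unfolding rho_def by (simp add: complex_add_cnj)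

lemma rho_nsq: "rho z v = - 2 * invn z * of_real (Re (m v (b z)))"
proof -
  have "eta_fun M z v = of_real (- 2 * Re (invn z)) * m v (b z)"
    by (simp add: eta_fun_def m_skew[of "b z"] invn_eq norm_sq_alphaM_real del: of_real_power)
  then have "rho z v = - 2 * of_real (Re (invn z)) * of_real (Re (m v (b z)))"
    by (simp only: rho_def Re_complex_of_real times_complex.simps Im_complex_of_real) simp
  moreover have "of_real (Re (invn z)) = invn z"
    by (simp add: invn_eq norm_sq_alphaM_real del: of_real_power)
  ultimately show ?thesis by simp
qed

lemma invn_deriv:
  assumes "z \<noteq> 0" shows "(invn has_derivative (\<lambda>v. invn z * rho z v)) (at z)"
proof -
  have "((\<lambda>w. inverse (nsq w)) has_derivative
      (\<lambda>v. - (inverse (nsq z) * (2 * of_real (Re (m v (b z)))) * inverse (nsq z)))) (at z)"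
    by (rule Deriv.has_derivative_inverse[OF nsq_nonzero[OF assms] nsq_deriv])
  then show ?thesis
    by (simp add: invn_eq[abs_def] rho_nsq inverse_eq_divide algebra_simps)
qed

text \<open>
  The point \<open>w\<close> occurs in \<open>\<eta>\<close> through the real-linear function \<open>b\<close> and through \<open>1/N\<close>.
\<close>

lemma eta_deriv:
  assumes "z \<noteq> 0"
  shows "((\<lambda>w. eta_fun M w v) has_derivative (\<lambda>u. 2 * m (b u) v * invn z + rho z u * eta_fun M z v)) (at z)"
proof -
  have "linear (\<lambda>u. m (b u) v)"
    using linear_compose[OF linear_sharp linear_mform(2)] by (simp add: o_def)
  then have "((\<lambda>w. 2 * m (b w) v * invn w) has_derivative
      (\<lambda>u. 2 * m (b z) v * (invn z * rho z u) + 2 * m (b u) v * invn z)) (at z)"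
    by (intro has_derivative_mult has_derivative_mult_right linear_imp_has_derivative invn_deriv[OF assms])
  then show ?thesis by (simp add: eta_fun_def algebra_simps)
qed

lemma diffble_invn: "z \<noteq> 0 \<Longrightarrow> diffble (\<lambda>w. const_form (invn w)) z"
  using invn_deriv by (intro diffble_const_form) (auto simp: differentiable_def)

lemma diffble_eta: "z \<noteq> 0 \<Longrightarrow> diffble \<eta> z"
  unfolding etaM_cov[OF skew, abs_def] using eta_deriv by (intro diffble_cov) (auto simp: differentiable_def)

lemma ext_d_invn: "z \<noteq> 0 \<Longrightarrow> ext_d (\<lambda>w. const_form (invn w)) z = scl (invn z) (cov (rho z))"
  unfolding cov_linear(3)[of "invn z" "rho z", symmetric] by (rule ext_d_const_form, rule invn_deriv)

end

section \<open>The derivatives of the two structure forms\<close>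

lemma cnj_form_dz: "cnj_form (dz j) z = cov (\<lambda>v. cnj (v $ j))"
  by (simp add: cnj_form_conj_ext dz_cov conj_ext_cov)

lemma omega0_cov: "omega0 z = scl (\<i> / 2) (\<Sum>j\<in>UNIV. cov (\<lambda>v. v $ j) \<odot> cov (\<lambda>v. cnj (v $ j)))"
  by (rule ext) (simp add: omega0_def wedge_emul cnj_form_dz dz_cov scl_def sum_4)

lemma ext_d_omega0: "ext_d omega0 z = 0"
  by (rule ext_d_const) (rule omega0_cov)

context invertible_skew begin

abbreviation "e z \<equiv> cov (eta_fun M z)"
abbreviation "ec z \<equiv> cov (\<lambda>v. cnj (eta_fun M z v))"
abbreviation "a z \<equiv> cov (m z)"
abbreviation "ac z \<equiv> cov (\<lambda>v. cnj (m z v))"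

lemma cov_rho: "cov (rho z) = scl (1 / 2) (e z + ec z)"
  by (rule ext) (simp add: cov_def scl_def rho_eq split: list.split)

lemma alpha_alphabar_eq: "alpha_alphabar M z = a z \<odot> ac z"
  by (simp add: alpha_alphabar_def wedge_emul cnj_form_conj_ext alphaM_cov conj_ext_cov)

lemma OmegaM_eq: "OmegaM M z = scl (invn z) (ac z \<odot> hatOmegaM M z)"
  by (simp add: OmegaM_def scale_form_scl wedge_emul cnj_form_conj_ext alphaM_cov conj_ext_cov)

lemma omegaM_eq: "omegaM M z = omega0 z - scl (\<i> * invn z) (a z \<odot> ac z)"
  by (simp add: omegaM_def scale_form_scl alpha_alphabar_eq)

lemma dalpha_eq: "z \<noteq> 0 \<Longrightarrow> ext_d \<alpha> z = scl (lambda z) (hatOmegaM M z) + a z \<odot> e z"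
  by (simp add: hatOmega_eq alphaM_cov etaM_cov[OF skew])

lemma alpha_abs: "(\<lambda>w. a w) = \<alpha>" "(\<lambda>w. ac w) = (\<lambda>w. conj_ext (\<alpha> w))"
  by (auto simp: alphaM_cov conj_ext_cov)

lemma diffble_a: "diffble (\<lambda>w. a w) z" "diffble (\<lambda>w. ac w) z"
  unfolding alpha_abs by (auto intro: diffble_conj diffble_alphaM)

lemma ext_d_a: "z \<noteq> 0 \<Longrightarrow> ext_d (\<lambda>w. a w) z = scl (lambda z) (hatOmegaM M z) + a z \<odot> e z"
  "z \<noteq> 0 \<Longrightarrow> ext_d (\<lambda>w. ac w) z = scl (cnj (lambda z)) (conj_ext (hatOmegaM M z)) + ac z \<odot> ec z"
  unfolding alpha_abs
  by (simp_all add: ext_d_conj diffble_alphaM dalpha_eq conj_ext_linear conj_ext_emul conj_ext_cov)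

text \<open>
  Leibniz' rule applied to \<open>\<omega>\<^sub>0 - (i/N) \<alpha> \<and> conj \<alpha>\<close>, where \<open>d\<alpha> = \<lambda> \<Omega>hat + \<alpha> \<and> \<eta>\<close> and \<open>d(1/N) = (1/N) Re \<eta>\<close>. The
  terms with \<open>\<Omega>hat\<close> reassemble to \<open>\<Omega>\<close> and its conjugate.
\<close>

lemma ext_d_omegaM:
  assumes z: "z \<noteq> 0"
  shows "ext_d (omegaM M) z =
    scl (- \<i>) (scl (lambda z) (OmegaM M z) - scl (cnj (lambda z)) (conj_ext (OmegaM M z)))
    + scl (\<i> * invn z) (cov (rho z) \<odot> a z \<odot> ac z)"
proof -
  have w: "omegaM M = (\<lambda>w. omega0 w + scl (- \<i>) (const_form (invn w) \<odot> (a w \<odot> ac w)))"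
    by (rule ext) (simp add: omegaM_eq const_form_emul scl_scl scl_def fun_eq_iff)
  have d: "diffble omega0 z"
    using diffble_const[of "omega0 0" z] omega0_cov by (metis (no_types, lifting) ext)
  note D = diffble_emul[OF diffble_a(1) diffble_a(2), of z]
  note U = diffble_invn[OF z]
  have "ext_d (omegaM M) z = scl (- \<i>) (ext_d (\<lambda>w. const_form (invn w) \<odot> (a w \<odot> ac w)) z)"
    unfolding w
    by (simp add: ext_d_add d diffble_linear diffble_emul U diffble_a ext_d_scl ext_d_omega0)
  also have "ext_d (\<lambda>w. const_form (invn w) \<odot> (a w \<odot> ac w)) z =
     scl (invn z) (cov (rho z)) \<odot> a z \<odot> ac z
     + scl (invn z) ((scl (lambda z) (hatOmegaM M z) + a z \<odot> e z) \<odot> ac z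
         - a z \<odot> (scl (cnj (lambda z)) (conj_ext (hatOmegaM M z)) + ac z \<odot> ec z))"
    by (subst ext_d_emul) (simp_all add: ext_d_emul U diffble_a D ext_d_invn z ext_d_a parity_const_form const_form_emul parity_cov emul_minus_left)
  finally show ?thesis
    unfolding OmegaM_eq cov_rho
    by (simp add: emul_linear emul_assoc cov_anticommute[of "m z" "eta_fun M z"]
      cov_anticommute_left[of "m z" "eta_fun M z"] cov_anticommute_left[of "m z" "\<lambda>v. cnj (eta_fun M z v)"]
      cov_anticommute[of "\<lambda>v. cnj (m z v)" "\<lambda>v. cnj (eta_fun M z v)"]
      cov_commute_even[OF homog_hatOmegaM] conj_ext_linear conj_ext_emul conj_ext_cov cnj_invn)
      (simp add: fun_eq_iff scl_def algebra_simps)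
qed

text \<open>
  In this form the scalar factor is constant, and of the three factors only \<open>\<eta>\<close> has a nontrivial
  derivative beyond \<open>d\<alpha>\<close>.
\<close>

lemma OmegaM_eq_pfaffian:
  "OmegaM M z = scl (1 / (2 * Pf)) (ac z \<odot> ext_d \<alpha> 0 - ac z \<odot> a z \<odot> e z)" if z: "z \<noteq> 0"
proof -
  have "hatOmegaM M z = scl (1 / lambda z) (ext_d \<alpha> 0 - a z \<odot> e z)"
    using hatOmega_eq[OF z, symmetric] lambda_nonzero[OF z] ext_d_alphaM_const[OF skew, of z]
    by (simp add: alphaM_cov etaM_cov[OF skew] scl_scl scl_add)
  moreover have "invn z * (1 / lambda z) = 1 / (2 * Pf)"
    using lambda_nonzero[OF z] by (simp add: lambda_def)
  ultimately show ?thesis unfolding OmegaM_eq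
    by (simp add: emul_linear scl_scl)
qed

lemma ext_d_OmegaM:
  assumes z: "z \<noteq> 0"
  shows "ext_d (OmegaM M) z =
    scl (cnj (lambda z) * invn z) (conj_ext (hatOmegaM M z) \<odot> hatOmegaM M z)
    - scl 2 (cov (rho z) \<odot> OmegaM M z)
    + scl (invn z / lambda z) (a z \<odot> ac z \<odot> ext_d \<eta> z)"
proof -
  let ?d = "ext_d \<alpha> 0"
  let ?F = "\<lambda>w. scl (1 / (2 * Pf)) (ac w \<odot> ?d - ac w \<odot> a w \<odot> e w)"
  have de: "diffble (\<lambda>w. e w) z" "ext_d (\<lambda>w. e w) z = ext_d \<eta> z"
    using diffble_eta[OF z] by (simp_all add: etaM_cov[OF skew, abs_def])
  have "ext_d (OmegaM M) z = ext_d ?F z"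
  proof (rule ext_d_cong_open)
    show "open (- {0 :: complex^4})" "z \<in> - {0}" using z by auto
    fix w :: "complex^4" assume "w \<in> - {0}"
    then have "w \<noteq> 0" by simp
    from OmegaM_eq_pfaffian[OF this] show "OmegaM M w = ?F w" .
  qed
  also have "\<dots> = scl (1 / (2 * Pf)) (ext_d (\<lambda>w. ac w) z \<odot> ?d
      - (ext_d (\<lambda>w. ac w) z \<odot> a z \<odot> e z - ac z \<odot> (ext_d (\<lambda>w. a w) z \<odot> e z - a z \<odot> ext_d \<eta> z)))"
    by (simp add: ext_d_scl ext_d_diff diffble_linear diffble_diff diffble_emul diffble_a diffble_const de ext_d_emul
      ext_d_const[of "\<lambda>w. ?d" ?d] parity_cov emul_linear)
      (simp add: fun_eq_iff scl_def algebra_simps)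
  also have "?d = scl (lambda z) (hatOmegaM M z) + a z \<odot> e z"
    using dalpha_eq[OF z] ext_d_alphaM_const[OF skew, of z] by simp
  also have "scl (1 / (2 * Pf)) (ext_d (\<lambda>w. ac w) z \<odot> (scl (lambda z) (hatOmegaM M z) + a z \<odot> e z)
      - (ext_d (\<lambda>w. ac w) z \<odot> a z \<odot> e z - ac z \<odot> (ext_d (\<lambda>w. a w) z \<odot> e z - a z \<odot> ext_d \<eta> z)))
    = scl (1 / (2 * Pf)) (scl (cnj (lambda z) * lambda z) (conj_ext (hatOmegaM M z) \<odot> hatOmegaM M z)
      - scl (lambda z) ((e z + ec z) \<odot> ac z \<odot> hatOmegaM M z) + a z \<odot> ac z \<odot> ext_d \<eta> z)"
    by (simp add: ext_d_a z emul_linear emul_assoc cov_anticommute_left[of "\<lambda>v. cnj (m z v)" "\<lambda>v. cnj (eta_fun M z v)"]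
      cov_commute_even[OF homog_hatOmegaM] cov_square
      cov_anticommute_left[of "\<lambda>v. cnj (m z v)" "eta_fun M z"]
      cov_anticommute_left[of "\<lambda>v. cnj (m z v)" "m z"])
      (simp add: fun_eq_iff scl_def algebra_simps)
  finally show ?thesis
    using lambda_nonzero[OF z] Pf_nonzero nsq_nonzero[OF z]
    unfolding OmegaM_eq cov_rho
    by (simp add: emul_linear) (simp add: fun_eq_iff scl_def lambda_def invn_eq field_simps)
qed

end

section \<open>Unitary bases\<close>

lemmas ring_normal = ring_distribs ac_simps mult_minus_left mult_minus_right diff_conv_add_uminus
  minus_add_distrib minus_minus

definition herm :: "complex^4 \<Rightarrow> complex^4 \<Rightarrow> complex" where
  "herm u v = (\<Sum>j\<in>UNIV. cnj (u $ j) * v $ j)"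

lemma herm_linear:
  "herm u (v + w) = herm u v + herm u w" "herm u (c *s v) = c * herm u v" "herm (c *s u) v = cnj c * herm u v"
  "herm u (r *\<^sub>R v) = of_real r * herm u v"  "herm (r *\<^sub>R u) v = of_real r * herm u v"
  "herm (u + w) v = herm u v + herm w v"
  by (simp_all add: herm_def sum_4 algebra_simps scaleR_complex)

lemma cnj_herm: "cnj (herm u v) = herm v u"
  by (simp add: herm_def mult.commute)

lemma inner_herm: "u \<bullet> v = Re (herm u v)"
  by (simp add: inner_vec_def herm_def inner_complex_def)

lemma herm_self: "herm u u = of_real ((norm u)\<^sup>2)"
proof -
  have "Im (herm u u) = 0" using cnj_herm[of u u] by (metis complex_cnj_cancel_iff complex_is_Real_iff Reals_cnj_iff)
  then show ?thesis by (simp add: complex_eq_iff inner_herm[symmetric] power2_norm_eq_inner)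
qed

text \<open>
  Complex orthogonality to \<open>u\<close> is real orthogonality to \<open>u\<close> and \<open>iu\<close>. Three vectors give at most six
  real conditions, in a space of real dimension eight.
\<close>

lemma orthogonal_unit_exists:
  assumes "finite S" "card S \<le> 3"
  obtains v :: "complex^4" where "norm v = 1" "\<And>u. u \<in> S \<Longrightarrow> herm u v = 0"
proof -
  let ?S = "S \<union> (*s) \<i> ` S"
  have "dim ?S \<le> card ?S" using assms(1) by (intro dim_le_card) (auto simp: span_superset)
  also have "\<dots> \<le> card S + card ((*s) \<i> ` S)" by (rule card_Un_le)
  also have "\<dots> \<le> 3 + 3" using assms card_image_le[OF assms(1), of "(*s) \<i>"] by linarith
  finally have "dim ?S < DIM(complex^4)" by simp
  then obtain x where x: "x \<noteq> 0" "\<And>y. y \<in> span ?S \<Longrightarrow> orthogonal x y"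
    using orthogonal_to_subspace_exists by blast
  have h: "herm u x = 0" if "u \<in> S" for u
  proof -
    have "u \<bullet> x = 0" "(\<i> *s u) \<bullet> x = 0"
      using x(2)[of u] x(2)[of "\<i> *s u"] that by (auto simp: orthogonal_def inner_commute span_base)
    then show ?thesis by (simp add: inner_herm herm_linear complex_eq_iff)
  qed
  show ?thesis
    by (rule that[of "(1 / norm x) *\<^sub>R x"]) (use x(1) h in \<open>auto simp: herm_linear\<close>)
qed

text \<open>
  The matrix with the rows \<open>f\<^sub>k\<close> is unitary, so its adjoint is a two-sided inverse.
\<close>

lemma orthonormal_expansion:
  assumes o: "herm f0 f0 = 1" "herm f1 f1 = 1" "herm f2 f2 = 1" "herm f3 f3 = 1"
    "herm f0 f1 = 0" "herm f0 f2 = 0" "herm f0 f3 = 0" "herm f1 f2 = 0" "herm f1 f3 = 0" "herm f2 f3 = 0"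
  shows "v = herm f0 v *s f0 + herm f1 v *s f1 + herm f2 v *s f2 + herm f3 v *s f3"
    and "cmod (det4 f0 f1 f2 f3) = 1"
proof -
  have o': "herm f1 f0 = 0" "herm f2 f0 = 0" "herm f3 f0 = 0" "herm f2 f1 = 0" "herm f3 f1 = 0" "herm f3 f2 = 0"
    using o(5-10) cnj_herm complex_cnj_zero by metis+
  define A :: "complex^4^4" where "A = vector [f0, f1, f2, f3]"
  define B :: "complex^4^4" where "B = conj_transpose A"
  have A: "A $ 1 = f0" "A $ 2 = f1" "A $ 3 = f2" "A $ 4 = f3" by (simp_all add: A_def vector_def)
  have "(A ** B) $ k $ l = herm (A $ l) (A $ k)" for k l
    by (simp add: matrix_matrix_mult_def B_def conj_transpose_def herm_def mult.commute)
  then have AB: "A ** B = mat 1"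
    by (simp add: vec_eq_iff forall_4 mat_def A o o')
  then have BA: "B ** A = mat 1" by (simp add: matrix_left_right_inverse)
  have "(\<Sum>k\<in>UNIV. cnj (A $ k $ i) * A $ k $ j) = (if i = j then 1 else 0)" for i j
    using arg_cong[OF BA, of "\<lambda>C. C $ i $ j"]
    by (simp add: matrix_matrix_mult_def B_def conj_transpose_def mat_def)
  then have r: "cnj (f0 $ i) * f0 $ j + cnj (f1 $ i) * f1 $ j + cnj (f2 $ i) * f2 $ j + cnj (f3 $ i) * f3 $ j
     = (if i = j then 1 else 0)" for i j
    by (simp add: sum_4 A)
  have "(herm f0 v *s f0 + herm f1 v *s f1 + herm f2 v *s f2 + herm f3 v *s f3) $ j =
    (\<Sum>i\<in>UNIV. v $ i * (cnj (f0 $ i) * f0 $ j + cnj (f1 $ i) * f1 $ j + cnj (f2 $ i) * f2 $ j + cnj (f3 $ i) * f3 $ j))" for j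
    by (simp add: herm_def sum_4 algebra_simps)
  also have "\<dots> j = v $ j" for j by (simp add: r if_distrib cong: if_cong)
  finally show "v = herm f0 v *s f0 + herm f1 v *s f1 + herm f2 v *s f2 + herm f3 v *s f3"
    by (simp add: vec_eq_iff)
  have "det B = det (vector [\<chi> j. cnj (f0 $ j), \<chi> j. cnj (f1 $ j), \<chi> j. cnj (f2 $ j), \<chi> j. cnj (f3 $ j)] :: complex^4^4)"
    by (subst det_transpose[symmetric], rule arg_cong[where f = det])
      (simp add: vec_eq_iff forall_4 transpose_def B_def conj_transpose_def A vector_def)
  also have "\<dots> = cnj (det4 f0 f1 f2 f3)"
    unfolding det4_det[symmetric] by (simp add: det4_def cov_emul_values cov_values)
  finally have "det4 f0 f1 f2 f3 * cnj (det4 f0 f1 f2 f3) = 1"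
    using det_mul[of A B] AB by (simp add: A_def[symmetric] det4_det)
  then have "of_real ((cmod (det4 f0 f1 f2 f3))\<^sup>2) = (1::complex)"
    by (simp only: complex_norm_square)
  then have "(cmod (det4 f0 f1 f2 f3))\<^sup>2 = 1" by (simp only: of_real_eq_1_iff)
  then show "cmod (det4 f0 f1 f2 f3) = 1"
    by (metis norm_ge_zero one_power2 power2_eq_imp_eq zero_le_one)
qed

lemma det4_linear:
  "det4 a b (c + c') d = det4 a b c d + det4 a b c' d" "det4 a b (x *s c) d = x * det4 a b c d"
  "det4 a b c (d + d') = det4 a b c d + det4 a b c d'" "det4 a b c (x *s d) = x * det4 a b c d"
  "det4 a (x *s b) c d = x * det4 a b c d"
  by (simp_all add: det4_def cov_emul_values cov_values algebra_simps)

lemma det4_repeat: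
  "det4 a b a d = 0" "det4 a b b d = 0" "det4 a b c a = 0" "det4 a b c b = 0" "det4 a b c c = 0"
  "det4 a b d c = - det4 a b c d"
  by (simp_all add: det4_def cov_emul_values cov_values algebra_simps)

text \<open>
  The last vector is rotated by a phase in order to make the determinant 1.
\<close>

lemma unitary_frame_exists:
  assumes "norm f0 = 1" "norm f1 = 1" "herm f0 f1 = 0"
  obtains f2 f3 where "herm f2 f2 = 1" "herm f3 f3 = 1" "herm f0 f2 = 0" "herm f0 f3 = 0"
    "herm f1 f2 = 0" "herm f1 f3 = 0" "herm f2 f3 = 0" "det4 f0 f1 f2 f3 = 1"
proof -
  have c2: "card {f0, f1} \<le> 3" by (simp add: card_insert_if)
  obtain f2 where f2: "norm f2 = 1" "\<And>u. u \<in> {f0, f1} \<Longrightarrow> herm u f2 = 0"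
    by (rule orthogonal_unit_exists[OF _ c2]) auto
  have c3: "card {f0, f1, f2} \<le> 3" by (simp add: card_insert_if)
  obtain g where g: "norm g = 1" "\<And>u. u \<in> {f0, f1, f2} \<Longrightarrow> herm u g = 0"
    by (rule orthogonal_unit_exists[OF _ c3]) auto
  define d where "d = det4 f0 f1 f2 g"
  have d: "cmod d = 1"
    unfolding d_def by (rule orthonormal_expansion(2)) (use assms f2 g in \<open>auto simp: herm_self\<close>)
  have dd: "cnj d * d = 1" using d by (simp add: complex_norm_square[symmetric] mult.commute)
  have hg: "herm (cnj d *s g) (cnj d *s g) = 1"
  proof -
    have "herm g g = 1" using g(1) by (simp add: herm_self)
    then show ?thesis using dd by (simp add: herm_linear mult.commute)
  qed
  show ?thesis
    by (rule that[of f2 "cnj d *s g"])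
      (use f2 g dd hg in \<open>auto simp: herm_linear herm_self det4_linear d_def[symmetric] mult.commute\<close>)
qed

section \<open>Adapted frames\<close>

text \<open>
  The complex line of \<open>z\<close> contains the radial direction \<open>z\<close> and the fibre direction \<open>iz\<close>. In the direction
  of \<open>f\<^sub>1\<close> the almost complex structure given by \<open>\<Omega>\<close> is opposite to the standard one.
\<close>

locale adapted_frame = invertible_skew +
  fixes z f1 f2 f3 :: "complex^4"
  assumes z: "norm z = 1"
    and f1: "f1 = (1 / norm (sharp M z)) *\<^sub>R sharp M z"
    and orthonormal: "herm f2 f2 = 1" "herm f3 f3 = 1" "herm z f2 = 0" "herm z f3 = 0"
      "herm f1 f2 = 0" "herm f1 f3 = 0" "herm f2 f3 = 0" "det4 z f1 f2 f3 = 1"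
begin

abbreviation "s \<equiv> complex_of_real (norm (sharp M z))"

lemma z_nonzero: "z \<noteq> 0" using z by auto

lemma s_nonzero: "s \<noteq> 0" using sharp_nonzero[OF z_nonzero] by simp

lemma nsq_s: "nsq z = s * s" by (simp add: norm_sq_alphaM_real power2_eq_square)

lemma invn_s: "invn z * s * s = 1" using invn_nsq[OF z_nonzero] by (simp add: nsq_s mult.assoc)

lemma herm_sharp: "herm (b z) v = m z v"
  by (subst mform_expand(2)) (simp add: herm_def sharp_nth mult.commute)

lemma orthonormal_more: "herm z z = 1" "herm f1 f1 = 1" "herm z f1 = 0" "herm f1 z = 0" "herm f2 z = 0" "herm f3 z = 0"
      "herm f2 f1 = 0" "herm f3 f1 = 0" "herm f3 f2 = 0"
proof -
  show "herm z z = 1" using z by (simp add: herm_self)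
  show "herm f1 f1 = 1" using s_nonzero by (simp add: f1 herm_linear herm_self power2_eq_square)
  show h: "herm f1 z = 0" by (simp add: f1 herm_linear herm_sharp m_self)
  show "herm z f1 = 0" using h cnj_herm complex_cnj_zero by metis
  show "herm f2 z = 0" "herm f3 z = 0" "herm f2 f1 = 0" "herm f3 f1 = 0" "herm f3 f2 = 0"
    using orthonormal cnj_herm complex_cnj_zero by metis+
qed

lemma expansion: "v = herm z v *s z + herm f1 v *s f1 + herm f2 v *s f2 + herm f3 v *s f3"
  by (rule orthonormal_expansion(1)) (use orthonormal orthonormal_more in auto)

lemma herm_expansion:
  "herm u v = cnj (herm z u) * herm z v + cnj (herm f1 u) * herm f1 v + cnj (herm f2 u) * herm f2 v + cnj (herm f3 u) * herm f3 v"
  by (subst expansion[of v]) (simp add: herm_linear cnj_herm mult.commute)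

lemma m_z: "m z v = s * herm f1 v"
  using s_nonzero by (simp add: f1 herm_linear herm_sharp)

lemma hatOmega_frame: "hatOmegaM M z = scl s (cov (herm f2) \<odot> cov (herm f3))"
proof (rule homog2_eqI)
  fix u v
  have "s *s f1 = b z" using s_nonzero by (simp add: f1 vec_eq_iff scaleR_complex)
  then have bz: "det4 z (b z) u v = s * det4 z f1 u v"
    using det4_linear(5)[of z s f1 u v] by (simp only:)
  have "det4 z f1 (x0 *s z + x1 *s f1 + x2 *s f2 + x3 *s f3) (y0 *s z + y1 *s f1 + y2 *s f2 + y3 *s f3)
      = x2 * y3 - x3 * y2" for x0 x1 x2 x3 y0 y1 y2 y3
    by (simp add: det4_linear det4_repeat(1-5) det4_repeat(6)[of z f1 f3 f2] orthonormal)
  from this[of "herm z u" "herm f1 u" "herm f2 u" "herm f3 u" "herm z v" "herm f1 v" "herm f2 v" "herm f3 v"]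
  have "det4 z f1 u v = herm f2 u * herm f3 v - herm f3 u * herm f2 v"
    unfolding expansion[symmetric] by simp
  then show "hatOmegaM M z [u, v] = scl s (cov (herm f2) \<odot> cov (herm f3)) [u, v]"
    by (simp add: hatOmegaM_value bz scl_def cov_emul_cov)
qed (intro homog_hatOmegaM homog_linear homog_cov_cov)+

text \<open>
  The components of \<open>\<eta>\<close> along \<open>\<theta>\<^sub>2\<close> and \<open>\<theta>\<^sub>3\<close>.
\<close>

definition "c2 = eta_fun M z f2"
definition "c3 = eta_fun M z f3"

lemma eta_linear: "eta_fun M z (u + v) = eta_fun M z u + eta_fun M z v" "eta_fun M z (c *s v) = c * eta_fun M z v"
  by (simp_all add: eta_fun_def mform_linear algebra_simps)

lemma eta_frame: "eta_fun M z v = - 2 * herm z v + c2 * herm f2 v + c3 * herm f3 v"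
proof -
  have "m (b z) z = - nsq z" by (subst m_skew) (simp add: norm_sq_alphaM)
  then have ez: "eta_fun M z z = - 2" using invn_nsq[OF z_nonzero] by (simp add: eta_fun_def mult.commute)
  have e1: "eta_fun M z f1 = 0" by (simp add: eta_fun_def f1 mform_linear m_self)
  have "eta_fun M z (x0 *s z + x1 *s f1 + x2 *s f2 + x3 *s f3) = - 2 * x0 + c2 * x2 + c3 * x3" for x0 x1 x2 x3
    by (simp add: eta_linear ez e1 c2_def c3_def)
  from this[of "herm z v" "herm f1 v" "herm f2 v" "herm f3 v"] show ?thesis
    unfolding expansion[symmetric] .
qed

text \<open>
  The equation \<open>d\<alpha> = \<lambda> \<Omega>hat + \<alpha> \<and> \<eta>\<close> with \<open>f\<^sub>2\<close> or \<open>f\<^sub>3\<close> as first argument: the rows of \<open>m\<close> in the frame are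
  known up to multiples of \<open>\<alpha>\<close>.
\<close>

lemma m_f2: "2 * m f2 v = lambda z * s * herm f3 v - s * herm f1 v * c2"
  and m_f3: "2 * m f3 v = - lambda z * s * herm f2 v - s * herm f1 v * c3"
proof -
  have h: "lambda z * hatOmegaM M z [u, v] = 2 * m u v - (m z u * eta_fun M z v - m z v * eta_fun M z u)" for u v
    using fun_cong[OF hatOmega_eq[OF z_nonzero], of "[u, v]"]
    by (simp add: scl_def ext_d_alphaM[OF skew]) (simp add: alphaM_cov etaM_cov[OF skew] cov_emul_cov)
  show "2 * m f2 v = lambda z * s * herm f3 v - s * herm f1 v * c2"
    using h[of f2 v] by (simp add: hatOmega_frame scl_def cov_emul_cov orthonormal orthonormal_more m_z c2_def algebra_simps)
  show "2 * m f3 v = - lambda z * s * herm f2 v - s * herm f1 v * c3"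
    using h[of f3 v] by (simp add: hatOmega_frame scl_def cov_emul_cov orthonormal orthonormal_more m_z c3_def algebra_simps)
qed

lemma omega0_frame: "omega0 z = scl (\<i> / 2) (cov (herm z) \<odot> cov (\<lambda>v. cnj (herm z v))
   + cov (herm f1) \<odot> cov (\<lambda>v. cnj (herm f1 v)) + cov (herm f2) \<odot> cov (\<lambda>v. cnj (herm f2 v))
   + cov (herm f3) \<odot> cov (\<lambda>v. cnj (herm f3 v)))"
proof (rule homog2_eqI)
  fix u v
  have d: "omega0 z [u, v] = \<i> / 2 * (herm v u - herm u v)"
    unfolding omega0_cov scl_def sum_4 herm_def plus_fun_apply cov_emul_cov
    by (simp only: ring_normal)
  show "omega0 z [u, v] = scl (\<i> / 2) (cov (herm z) \<odot> cov (\<lambda>v. cnj (herm z v))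
   + cov (herm f1) \<odot> cov (\<lambda>v. cnj (herm f1 v)) + cov (herm f2) \<odot> cov (\<lambda>v. cnj (herm f2 v))
   + cov (herm f3) \<odot> cov (\<lambda>v. cnj (herm f3 v))) [u, v]"
    unfolding d herm_expansion[of u v] herm_expansion[of v u] plus_fun_apply scl_def cov_emul_cov
    by (simp only: ring_normal)
qed (auto simp: omega0_cov sum_4 intro!: homog_linear homog_cov_cov)

text \<open>
  The left side is minus the Hermitian product of \<open>M u\<close> and \<open>M v\<close>, and such a product may be computed in
  any unitary basis.
\<close>

lemma m_sharp_frame:
  "m (b u) v = - (cnj (m z u) * m z v + cnj (m f1 u) * m f1 v + cnj (m f2 u) * m f2 v + cnj (m f3 u) * m f3 v)"
proof -
  define x :: "complex^4 \<Rightarrow> complex^4" where "x v = (\<chi> j. cnj (m (axis j 1) v))" for v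
  have x: "cnj (m w v) = herm w (x v)" for w v
    by (subst mform_expand(1)) (simp add: herm_def x_def)
  have "m (b u) v = (\<Sum>j\<in>UNIV. cnj (m u (axis j 1)) * m (axis j 1) v)"
    by (subst mform_expand(1)) (simp add: sharp_nth)
  also have "\<dots> = - herm (x v) (x u)"
    by (simp add: herm_def x_def m_skew[of u] sum_negf mult.commute)
  also have "herm (x v) (x u) = cnj (m z u) * m z v + cnj (m f1 u) * m f1 v + cnj (m f2 u) * m f2 v + cnj (m f3 u) * m f3 v"
    by (subst herm_expansion) (simp add: x[symmetric] mult.commute)
  finally show ?thesis .
qed

lemma m_f1: "m f1 v = s / 2 * eta_fun M z v"
proof -
  have "m (b z) v = s * s / 2 * eta_fun M z v" using invn_s by (simp add: eta_fun_def ac_simps)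
  then show ?thesis using s_nonzero by (simp add: f1 mform_linear)
qed

text \<open>
  The term \<open>\<rho> \<and> \<eta>\<close> comes from the factor \<open>1/N\<close>, the sum from the dependence of \<open>b\<close> on the point.
\<close>

lemma ext_d_eta:
  "ext_d \<eta> z = cov (rho z) \<odot> e z - scl (2 * invn z) (ac z \<odot> a z
    + cov (\<lambda>v. cnj (m f1 v)) \<odot> cov (m f1) + cov (\<lambda>v. cnj (m f2 v)) \<odot> cov (m f2) + cov (\<lambda>v. cnj (m f3 v)) \<odot> cov (m f3))"
proof (rule homog2_eqI)
  show "homog 2 (ext_d \<eta> z)"
    unfolding numeral_2_eq_2 by (rule homog_ext_d) (simp add: etaM_cov[OF skew] homog_cov[simplified])
  fix u v
  have f: "frechet_derivative (\<lambda>w. eta_fun M w v) (at z) u = 2 * m (b u) v * invn z + rho z u * eta_fun M z v" for u v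
    using fun_cong[OF frechet_derivative_at[OF eta_deriv[OF z_nonzero, of v]], of u] by (rule sym)
  have "ext_d \<eta> z [u, v] = ext_d (\<lambda>w. e w) z [u, v]"
    by (rule arg_cong[where f = "\<lambda>F. ext_d F z [u, v]"]) (rule ext, rule etaM_cov[OF skew])
  also have "\<dots> = 2 * m (b u) v * invn z + rho z u * eta_fun M z v - (2 * m (b v) u * invn z + rho z v * eta_fun M z u)"
    by (simp only: ext_d_1 f)
  finally have d: "ext_d \<eta> z [u, v] =
    2 * m (b u) v * invn z + rho z u * eta_fun M z v - (2 * m (b v) u * invn z + rho z v * eta_fun M z u)" .
  show "ext_d \<eta> z [u, v] = (cov (rho z) \<odot> e z - scl (2 * invn z) (ac z \<odot> a z
    + cov (\<lambda>v. cnj (m f1 v)) \<odot> cov (m f1) + cov (\<lambda>v. cnj (m f2 v)) \<odot> cov (m f2) + cov (\<lambda>v. cnj (m f3 v)) \<odot> cov (m f3))) [u, v]"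
    unfolding d m_sharp_frame[of u] m_sharp_frame[of v] plus_fun_apply minus_apply scl_def cov_emul_cov
    by (simp only: ring_normal)
qed (intro homog_linear homog_cov_cov)

end

section \<open>The structure on vectors tangent to the sphere\<close>

lemma restr_cov: "restr T (cov p) = cov (\<lambda>v. if v \<in> T then p v else 0)"
  by (rule ext) (auto simp: restr_def cov_def split: list.split)

lemma eq_forms_restr: "\<beta> =\<^sub>S \<gamma> \<longleftrightarrow> (\<forall>z\<in>S7. restr (tangent z) (\<beta> z) = restr (tangent z) (\<gamma> z))"
  by (auto simp: eq_forms_on_def restr_def fun_eq_iff)

lemma conj_restr: "conj_ext (restr T \<beta>) = restr T (conj_ext \<beta>)"
  by (auto simp: conj_ext_def restr_def fun_eq_iff)

text \<open>
  The torsion classes in closed form. \<open>W2M\<close> is the expression that the theorem gives in the LT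
  case; the cancellation described at the beginning makes it correct for every \<open>M\<close>.
\<close>

definition W1M :: "complex^4^4 \<Rightarrow> complex^4 \<Rightarrow> complex" where
  "W1M M z = 4 / 3 * cnj (2 * pfaffian M * inv_norm_sq M z)"

definition W2M :: "complex^4^4 \<Rightarrow> form" where
  "W2M M = (\<lambda>z. W1M M z / 2) *\<^sub>f
     (omegaM M + (\<lambda>z. 3 * \<i> / 2 * inv_norm_sq M z) *\<^sub>f alpha_alphabar M)"

definition W3M :: "complex^4^4 \<Rightarrow> form" where
  "W3M M = Re_form (etaM M) \<and>\<^sub>f (omegaM M + (\<lambda>z. \<i> * inv_norm_sq M z) *\<^sub>f alpha_alphabar M)"

text \<open>
  The \<open>(1,0)\<close>-part of \<open>-2 Re \<eta>\<close>. The form \<open>\<eta>\<close> takes the value \<open>-2i\<close> on the fibre direction \<open>iz\<close>, and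
  \<open>2 \<theta>\<^sub>0\<close> compensates for it.
\<close>

definition W5M :: "complex^4^4 \<Rightarrow> form" where
  "W5M M = - etaM M - (\<lambda>_. 2) *\<^sub>f (\<lambda>z. cov (herm z))"

lemma (in invertible_skew) W1M_lambda: "W1M M z = 4 / 3 * cnj (lambda z)"
  by (simp add: W1M_def lambda_def)

lemma (in invertible_skew) Re_form_eta: "Re_form (etaM M) z = cov (rho z)"
  by (rule ext) (simp add: Re_form_def etaM_cov[OF skew] cov_def rho_def split: list.split)

context adapted_frame begin

text \<open>
  The restrictions to tangent vectors of \<open>\<phi>\<^sub>1 = conj \<theta>\<^sub>1\<close>, \<open>\<phi>\<^sub>2\<close>, \<open>\<phi>\<^sub>3\<close> (named \<open>P\<close>), of their conjugates
  (named \<open>Q\<close>) and of \<open>\<theta>\<^sub>0\<close> (named \<open>G0\<close>).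
\<close>

definition "P1 = restr (tangent z) (cov (\<lambda>v. cnj (herm f1 v)))"
definition "Q1 = restr (tangent z) (cov (herm f1))"
definition "P2 = restr (tangent z) (cov (herm f2))"
definition "Q2 = restr (tangent z) (cov (\<lambda>v. cnj (herm f2 v)))"
definition "P3 = restr (tangent z) (cov (herm f3))"
definition "Q3 = restr (tangent z) (cov (\<lambda>v. cnj (herm f3 v)))"
definition "G0 = restr (tangent z) (cov (herm z))"

abbreviation "R \<equiv> restr (tangent z)"

text \<open>
  Oriented so that products of generators are sorted; simplification thus decides identities in the
  exterior algebra.
\<close>

lemma generator_rules:
  "P1 \<odot> P1 = 0" "P1 \<odot> (P1 \<odot> \<beta>) = 0"
  "Q1 \<odot> P1 = - (P1 \<odot> Q1)" "Q1 \<odot> (P1 \<odot> \<beta>) = - (P1 \<odot> (Q1 \<odot> \<beta>))"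
  "Q1 \<odot> Q1 = 0" "Q1 \<odot> (Q1 \<odot> \<beta>) = 0"
  "P2 \<odot> P1 = - (P1 \<odot> P2)" "P2 \<odot> (P1 \<odot> \<beta>) = - (P1 \<odot> (P2 \<odot> \<beta>))"
  "P2 \<odot> Q1 = - (Q1 \<odot> P2)" "P2 \<odot> (Q1 \<odot> \<beta>) = - (Q1 \<odot> (P2 \<odot> \<beta>))"
  "P2 \<odot> P2 = 0" "P2 \<odot> (P2 \<odot> \<beta>) = 0"
  "Q2 \<odot> P1 = - (P1 \<odot> Q2)" "Q2 \<odot> (P1 \<odot> \<beta>) = - (P1 \<odot> (Q2 \<odot> \<beta>))"
  "Q2 \<odot> Q1 = - (Q1 \<odot> Q2)" "Q2 \<odot> (Q1 \<odot> \<beta>) = - (Q1 \<odot> (Q2 \<odot> \<beta>))"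
  "Q2 \<odot> P2 = - (P2 \<odot> Q2)" "Q2 \<odot> (P2 \<odot> \<beta>) = - (P2 \<odot> (Q2 \<odot> \<beta>))"
  "Q2 \<odot> Q2 = 0" "Q2 \<odot> (Q2 \<odot> \<beta>) = 0"
  "P3 \<odot> P1 = - (P1 \<odot> P3)" "P3 \<odot> (P1 \<odot> \<beta>) = - (P1 \<odot> (P3 \<odot> \<beta>))"
  "P3 \<odot> Q1 = - (Q1 \<odot> P3)" "P3 \<odot> (Q1 \<odot> \<beta>) = - (Q1 \<odot> (P3 \<odot> \<beta>))"
  "P3 \<odot> P2 = - (P2 \<odot> P3)" "P3 \<odot> (P2 \<odot> \<beta>) = - (P2 \<odot> (P3 \<odot> \<beta>))"
  "P3 \<odot> Q2 = - (Q2 \<odot> P3)" "P3 \<odot> (Q2 \<odot> \<beta>) = - (Q2 \<odot> (P3 \<odot> \<beta>))"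
  "P3 \<odot> P3 = 0" "P3 \<odot> (P3 \<odot> \<beta>) = 0"
  "Q3 \<odot> P1 = - (P1 \<odot> Q3)" "Q3 \<odot> (P1 \<odot> \<beta>) = - (P1 \<odot> (Q3 \<odot> \<beta>))"
  "Q3 \<odot> Q1 = - (Q1 \<odot> Q3)" "Q3 \<odot> (Q1 \<odot> \<beta>) = - (Q1 \<odot> (Q3 \<odot> \<beta>))"
  "Q3 \<odot> P2 = - (P2 \<odot> Q3)" "Q3 \<odot> (P2 \<odot> \<beta>) = - (P2 \<odot> (Q3 \<odot> \<beta>))"
  "Q3 \<odot> Q2 = - (Q2 \<odot> Q3)" "Q3 \<odot> (Q2 \<odot> \<beta>) = - (Q2 \<odot> (Q3 \<odot> \<beta>))"
  "Q3 \<odot> P3 = - (P3 \<odot> Q3)" "Q3 \<odot> (P3 \<odot> \<beta>) = - (P3 \<odot> (Q3 \<odot> \<beta>))"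
  "Q3 \<odot> Q3 = 0" "Q3 \<odot> (Q3 \<odot> \<beta>) = 0"
  unfolding P1_def Q1_def P2_def Q2_def P3_def Q3_def restr_cov
  by (rule cov_anticommute cov_anticommute_left cov_square cov_square_left)+

lemmas R_simps = restr_linear restr_emul emul_linear scl_add scl_scl emul_assoc generator_rules

lemma tangent_iff: "v \<in> tangent z \<longleftrightarrow> Re (herm z v) = 0"
  by (simp add: tangent_def inner_herm)

text \<open>
  On the sphere, tangent vectors are those whose Hermitian product with \<open>z\<close> is imaginary.
\<close>

lemma R_z: "R (cov (\<lambda>v. cnj (herm z v))) = - G0"
  unfolding G0_def restr_cov cov_linear(4)[symmetric]
  by (rule arg_cong[where f = cov]) (auto simp: fun_eq_iff tangent_iff complex_eq_iff)

lemma G0_square: "G0 \<odot> G0 = 0"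
  by (simp add: G0_def restr_cov cov_square)

lemma R_a: "R (a z) = scl s Q1"
  unfolding Q1_def restr_cov cov_linear(3)[symmetric]
  by (rule arg_cong[where f = cov]) (auto simp: fun_eq_iff m_z)

lemma R_ac: "R (ac z) = scl s P1"
  unfolding P1_def restr_cov cov_linear(3)[symmetric]
  by (rule arg_cong[where f = cov]) (auto simp: fun_eq_iff m_z)

lemma R_hat: "R (hatOmegaM M z) = scl s (P2 \<odot> P3)"
  by (simp add: hatOmega_frame restr_linear restr_emul P2_def P3_def)

lemma R_conj: "conj_ext P1 = Q1" "conj_ext Q1 = P1" "conj_ext P2 = Q2" "conj_ext Q2 = P2" "conj_ext P3 = Q3" "conj_ext Q3 = P3"
  "conj_ext G0 = - G0"
  by (simp_all add: P1_def Q1_def P2_def Q2_def P3_def Q3_def conj_restr conj_ext_cov)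
     (simp add: G0_def conj_restr conj_ext_cov R_z)

lemma R_conj_hat: "R (conj_ext (hatOmegaM M z)) = scl s (Q2 \<odot> Q3)"
  using arg_cong[OF R_hat, of conj_ext] by (simp add: conj_restr conj_ext_linear conj_ext_emul R_conj)

text \<open>
  The term with \<open>\<theta>\<^sub>0\<close> is a multiple of \<open>\<theta>\<^sub>0 \<and> \<theta>\<^sub>0\<close> on tangent vectors.
\<close>

lemma R_omega0: "R (omega0 z) = scl (\<i> / 2) (Q1 \<odot> P1 + P2 \<odot> Q2 + P3 \<odot> Q3)"
proof -
  have "R (omega0 z) = scl (\<i> / 2) (G0 \<odot> (- G0) + Q1 \<odot> P1 + P2 \<odot> Q2 + P3 \<odot> Q3)"
    unfolding omega0_frame restr_linear restr_emul R_z
    by (simp only: P1_def Q1_def P2_def Q2_def P3_def Q3_def G0_def)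
  then show ?thesis by (simp add: emul_minus_right G0_square)
qed

lemma invn_cancel: "invn z * (s * s) = 1" "invn z * (s * (s * x)) = x" "s * (invn z * (s * x)) = x" "s * (s * (invn z * x)) = x"
  using invn_s by (simp_all add: ac_simps)

lemma R_aac: "R (a z \<odot> ac z) = scl (s * s) (Q1 \<odot> P1)"
  by (simp add: restr_emul R_a R_ac emul_linear scl_scl)

lemma R_omega: "R (omegaM M z) = scl (\<i> / 2) (P1 \<odot> Q1 + P2 \<odot> Q2 + P3 \<odot> Q3)"
proof -
  have "R (omegaM M z) = scl (\<i> / 2) (Q1 \<odot> P1 + P2 \<odot> Q2 + P3 \<odot> Q3) - scl (\<i> * (invn z * (s * s))) (Q1 \<odot> P1)"
    by (simp add: omegaM_eq restr_linear R_omega0 R_aac scl_scl mult.assoc)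
  then show ?thesis unfolding invn_cancel by (simp add: generator_rules) (simp add: fun_eq_iff scl_def algebra_simps)
qed

lemma R_Omega: "R (OmegaM M z) = P1 \<odot> P2 \<odot> P3"
proof -
  have "R (OmegaM M z) = scl (invn z * (s * s)) (P1 \<odot> P2 \<odot> P3)"
    by (simp add: OmegaM_eq restr_linear restr_emul R_ac R_hat emul_linear scl_scl)
  then show ?thesis unfolding invn_cancel by (simp add: scl_add)
qed

lemma R_conj_Omega: "R (conj_ext (OmegaM M z)) = Q1 \<odot> Q2 \<odot> Q3"
  by (simp add: conj_restr[symmetric] R_Omega conj_ext_emul R_conj)

lemma e_frame: "e z = scl (- 2) (cov (herm z)) + scl c2 (cov (herm f2)) + scl c3 (cov (herm f3))"
  unfolding cov_linear[symmetric] by (rule arg_cong[where f = cov]) (simp add: fun_eq_iff eta_frame)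

lemma R_e: "R (e z) = scl (- 2) G0 + scl c2 P2 + scl c3 P3"
  unfolding e_frame restr_linear by (simp add: G0_def P2_def P3_def)

lemma R_ec: "R (ec z) = scl 2 G0 + scl (cnj c2) Q2 + scl (cnj c3) Q3"
proof -
  have "R (ec z) = conj_ext (R (e z))" by (simp add: conj_restr conj_ext_cov)
  then show ?thesis by (simp add: R_e conj_ext_linear R_conj) (simp add: scl_def fun_eq_iff)
qed

lemma R_rho: "R (cov (rho z)) = scl (1 / 2) (scl c2 P2 + scl c3 P3 + scl (cnj c2) Q2 + scl (cnj c3) Q3)"
  unfolding cov_rho restr_linear R_e R_ec by (simp add: fun_eq_iff scl_def algebra_simps)

lemma omega_alpha: "omegaM M z + scl (\<i> * invn z) (a z \<odot> ac z) = omega0 z"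
  by (simp add: omegaM_eq)

lemma R_W3: "R (W3M M z) = R (cov (rho z)) \<odot> R (omega0 z)"
  by (simp add: W3M_def wedge_emul restr_emul Re_form_eta scale_form_scl alpha_alphabar_eq omega_alpha)

lemma R_W2: "R (W2M M z) = scl (W1M M z * \<i> / 4) (scl 2 (Q1 \<odot> P1) + P2 \<odot> Q2 + P3 \<odot> Q3)"
proof -
  have "R (W2M M z) = scl (W1M M z / 2) (scl (\<i> / 2) (P1 \<odot> Q1 + P2 \<odot> Q2 + P3 \<odot> Q3)
     + scl (3 * \<i> / 2 * (invn z * (s * s))) (Q1 \<odot> P1))"
    by (simp add: W2M_def scale_form_scl alpha_alphabar_eq restr_linear R_omega R_aac scl_scl mult.assoc)
  then show ?thesis unfolding invn_cancel by (simp add: generator_rules) (simp add: fun_eq_iff scl_def algebra_simps)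
qed

lemma R_W5: "R (W5M M z) = - (scl c2 P2 + scl c3 P3)"
proof -
  have "W5M M z = - e z - scl 2 (cov (herm z))"
    by (simp add: W5M_def scale_form_scl etaM_cov[OF skew])
  then show ?thesis by (simp add: restr_linear R_e G0_def[symmetric]) (simp add: fun_eq_iff scl_def)
qed

lemma Omega_wedge_omega: "R (OmegaM M z \<odot> omegaM M z) = 0"
  by (simp add: restr_emul R_Omega R_omega) (simp add: R_simps)

lemma Omega_wedge_conj: "R (OmegaM M z \<odot> conj_ext (OmegaM M z)) =
    scl (2 ^ 3 / fact 3 * (- \<i>) ^ 9) (R (omegaM M z \<odot> omegaM M z \<odot> omegaM M z))"
  unfolding restr_emul R_Omega R_omega R_conj_Omega
  by (simp only: R_simps) (simp add: fun_eq_iff scl_def fact_numeral eval_nat_numeral algebra_simps)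

lemma primitive_W3: "R (omegaM M z \<odot> W3M M z) = 0"
  unfolding restr_emul R_omega R_W3 R_rho R_omega0
  by (simp only: R_simps) (simp add: fun_eq_iff scl_def algebra_simps)

lemma primitive_W2: "R (omegaM M z \<odot> omegaM M z \<odot> W2M M z) = 0"
  unfolding restr_emul R_omega R_W2
  by (simp only: R_simps) (simp add: fun_eq_iff scl_def algebra_simps)

text \<open>
  In \<open>d\<eta>\<close> the summand of \<open>f\<^sub>1\<close> cancels \<open>\<rho> \<and> \<eta>\<close>, and the summand of \<open>z\<close> contains \<open>\<alpha>\<close>. Modulo \<open>\<alpha>\<close> and its
  conjugate only the multiples of \<open>\<theta>\<^sub>2\<close> and \<open>\<theta>\<^sub>3\<close> from \<open>m_f2\<close> and \<open>m_f3\<close> survive.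
\<close>

lemma alpha_deta:
  "a z \<odot> ac z \<odot> ext_d \<eta> z = scl (lambda z * cnj (lambda z) / 2)
     (a z \<odot> ac z \<odot> (cov (herm f2) \<odot> cov (\<lambda>v. cnj (herm f2 v)) + cov (herm f3) \<odot> cov (\<lambda>v. cnj (herm f3 v))))"
proof -
  have m1: "cov (m f1) = scl (s / 2) (e z)" "cov (\<lambda>v. cnj (m f1 v)) = scl (s / 2) (ec z)"
    unfolding cov_linear(3)[symmetric] by (rule arg_cong[where f = cov], simp add: fun_eq_iff m_f1)+
  have f2: "m f2 v = lambda z * s / 2 * herm f3 v + (- c2 / 2) * m z v"
    and f3: "m f3 v = (- lambda z * s / 2) * herm f2 v + (- c3 / 2) * m z v" for v
    using m_f2[of v] m_f3[of v] by (simp_all add: m_z field_simps)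
  have m2: "cov (m f2) = scl (lambda z * s / 2) (cov (herm f3)) + scl (- c2 / 2) (a z)"
    "cov (\<lambda>v. cnj (m f2 v)) = scl (cnj (lambda z) * s / 2) (cov (\<lambda>v. cnj (herm f3 v))) + scl (- cnj c2 / 2) (ac z)"
    unfolding cov_linear(1,3)[symmetric] by (rule arg_cong[where f = cov], simp add: fun_eq_iff f2)+
  have m3: "cov (m f3) = scl (- lambda z * s / 2) (cov (herm f2)) + scl (- c3 / 2) (a z)"
    "cov (\<lambda>v. cnj (m f3 v)) = scl (- cnj (lambda z) * s / 2) (cov (\<lambda>v. cnj (herm f2 v))) + scl (- cnj c3 / 2) (ac z)"
    unfolding cov_linear(1,3)[symmetric] by (rule arg_cong[where f = cov], simp add: fun_eq_iff f3)+
  have k: "a z \<odot> ac z \<odot> cov p \<odot> a z = 0" "a z \<odot> ac z \<odot> a z = 0" "a z \<odot> ac z \<odot> ac z = 0" "a z \<odot> ac z \<odot> ac z \<odot> x = 0"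
      "a z \<odot> ac z \<odot> a z \<odot> x = 0" for p x
    unfolding cov_anticommute[of p "m z"] emul_linear cov_anticommute_left[of "\<lambda>v. cnj (m z v)" "m z"]
      cov_anticommute[of "\<lambda>v. cnj (m z v)" "m z"] cov_square cov_square_left by (simp_all add: cov_square_left emul_linear)
  have r: "cov (rho z) \<odot> e z = scl (1 / 2) (ec z \<odot> e z)"
    unfolding cov_rho emul_linear cov_square by simp
  have "invn z * s * s * c = c" for c using invn_s by simp
  then have i: "invn z * (s * (s * c)) = c" for c by (simp add: mult.assoc)
  \<comment> \<open>The coefficient of the last term is zero because \<open>s\<^sup>2 = N\<close>.\<close>
  have "a z \<odot> ac z \<odot> ext_d \<eta> z = scl (- 2 * invn z) (scl (lambda z * s / 2 * (cnj (lambda z) * s / 2))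
     (a z \<odot> ac z \<odot> (cov (\<lambda>v. cnj (herm f2 v)) \<odot> cov (herm f2) + cov (\<lambda>v. cnj (herm f3 v)) \<odot> cov (herm f3))))
     + scl (1 / 2 - 2 * invn z * (s / 2 * (s / 2))) (a z \<odot> ac z \<odot> ec z \<odot> e z)"
    unfolding ext_d_eta r m1 m2 m3
    by (simp only: emul_linear scl_add scl_scl k) (simp add: fun_eq_iff scl_def algebra_simps)
  also have "1 / 2 - 2 * invn z * (s / 2 * (s / 2)) = 0" using i[of 1] by (simp add: field_simps)
  also have "cov (\<lambda>v. cnj (herm f2 v)) \<odot> cov (herm f2) = - (cov (herm f2) \<odot> cov (\<lambda>v. cnj (herm f2 v)))"
    by (rule cov_anticommute)
  also have "cov (\<lambda>v. cnj (herm f3 v)) \<odot> cov (herm f3) = - (cov (herm f3) \<odot> cov (\<lambda>v. cnj (herm f3 v)))"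
    by (rule cov_anticommute)
  also have "scl (- 2 * invn z) (scl (lambda z * s / 2 * (cnj (lambda z) * s / 2)) \<beta>) =
     scl (- (invn z * (s * (s * (lambda z * cnj (lambda z) / 2))))) \<beta>" for \<beta> :: "(complex^4) list \<Rightarrow> complex"
    by (simp add: scl_scl field_simps)
  finally show ?thesis unfolding i
    by (simp only: emul_linear scl_add) (simp add: fun_eq_iff scl_def algebra_simps)
qed

lemma R_alpha_deta:
  "R (a z \<odot> ac z \<odot> ext_d \<eta> z) = scl (lambda z * cnj (lambda z) / 2 * (s * s)) (Q1 \<odot> P1 \<odot> (P2 \<odot> Q2 + P3 \<odot> Q3))"
  unfolding alpha_deta restr_emul restr_linear R_a R_ac P2_def[symmetric] Q2_def[symmetric] P3_def[symmetric] Q3_def[symmetric]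
  by (simp only: emul_linear scl_scl) (simp add: fun_eq_iff scl_def algebra_simps)

lemma R_alpha_deta_omega0:
  "R (a z \<odot> ac z \<odot> ext_d \<eta> z) = scl (- \<i> * lambda z * cnj (lambda z)) (R (a z \<odot> ac z \<odot> omega0 z))"
proof -
  have "R (a z \<odot> ac z \<odot> omega0 z) = scl (s * s * (\<i> / 2)) (Q1 \<odot> P1 \<odot> (P2 \<odot> Q2 + P3 \<odot> Q3))"
    unfolding restr_emul R_a R_ac R_omega0
    by (simp only: R_simps) (simp add: fun_eq_iff scl_def algebra_simps)
  then show ?thesis unfolding R_alpha_deta by (simp add: scl_scl) (simp add: fun_eq_iff scl_def algebra_simps)
qed

lemma torsion_dOmega:
  "R (ext_d (OmegaM M) z) = R (scl (W1M M z) (omegaM M z \<odot> omegaM M z) + W2M M z \<odot> omegaM M z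
     + conj_ext (W5M M z) \<odot> OmegaM M z)"
proof -
  have h: "R (scl (cnj (lambda z) * invn z) (conj_ext (hatOmegaM M z) \<odot> hatOmegaM M z)) =
      scl (cnj (lambda z)) (Q2 \<odot> Q3 \<odot> P2 \<odot> P3)"
    unfolding restr_linear restr_emul R_hat R_conj_hat emul_linear scl_scl emul_assoc using invn_s
    by (simp add: mult.assoc)
  have k: "R (scl (invn z / lambda z) (a z \<odot> ac z \<odot> ext_d \<eta> z)) =
      scl (cnj (lambda z) / 2) (Q1 \<odot> P1 \<odot> (P2 \<odot> Q2 + P3 \<odot> Q3))"
  proof -
    have "invn z / lambda z * (lambda z * cnj (lambda z) / 2 * (s * s)) = cnj (lambda z) / 2 * (invn z * s * s)"
      using lambda_nonzero[OF z_nonzero] by (simp add: field_simps)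
    then show ?thesis unfolding restr_linear R_alpha_deta scl_scl by (simp add: invn_s)
  qed
  have w5: "R (conj_ext (W5M M z)) = - (scl (cnj c2) Q2 + scl (cnj c3) Q3)"
    by (simp add: conj_restr[symmetric] R_W5 conj_ext_linear R_conj)
  have "R (ext_d (OmegaM M) z) = scl (cnj (lambda z)) (Q2 \<odot> Q3 \<odot> P2 \<odot> P3)
     - scl 2 (R (cov (rho z)) \<odot> R (OmegaM M z)) + scl (cnj (lambda z) / 2) (Q1 \<odot> P1 \<odot> (P2 \<odot> Q2 + P3 \<odot> Q3))"
    unfolding ext_d_OmegaM[OF z_nonzero] restr_linear(1,2) h k
    by (simp only: restr_linear restr_emul)
  then show ?thesis
    unfolding restr_linear restr_emul R_rho R_Omega R_W2 R_omega w5 W1M_lambda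
    by (simp only: R_simps) (simp add: fun_eq_iff scl_def field_simps)
qed

text \<open>
  This needs no frame: \<open>Re \<eta> \<and> \<omega>\<close> occurs in \<open>W\<^sub>4 \<and> \<omega>\<close> and in \<open>W\<^sub>3\<close> with opposite signs.
\<close>

lemma torsion_domega:
  "ext_d (omegaM M) z = scl (3 / 2) (\<lambda>vs. of_real (Im (cnj (W1M M z) * OmegaM M z vs)))
     - cov (rho z) \<odot> omegaM M z + W3M M z"
proof -
  have "scl (3 / 2) (\<lambda>vs. of_real (Im (cnj (W1M M z) * OmegaM M z vs))) =
    scl (- \<i>) (scl (lambda z) (OmegaM M z) - scl (cnj (lambda z)) (conj_ext (OmegaM M z)))"
  proof
    fix vs
    have "of_real (Im x) = - \<i> / 2 * (x - cnj x)" for x by (simp add: complex_eq_iff)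
    note i = this[of "cnj (W1M M z) * OmegaM M z vs"]
    show "scl (3 / 2) (\<lambda>vs. of_real (Im (cnj (W1M M z) * OmegaM M z vs))) vs =
      scl (- \<i>) (scl (lambda z) (OmegaM M z) - scl (cnj (lambda z)) (conj_ext (OmegaM M z))) vs"
      unfolding scl_def i by (simp add: W1M_lambda conj_ext_def scl_def field_simps)
  qed
  moreover have "W3M M z = cov (rho z) \<odot> omegaM M z + scl (\<i> * invn z) (cov (rho z) \<odot> a z \<odot> ac z)"
    by (simp add: W3M_def wedge_emul Re_form_eta scale_form_scl alpha_alphabar_eq emul_linear)
  ultimately show ?thesis by (simp add: ext_d_omegaM[OF z_nonzero])
qed

end

lemma (in invertible_skew) adapted_frame_exists:
  assumes "z \<in> S7"
  obtains f1 f2 f3 where "adapted_frame M z f1 f2 f3"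
proof -
  have z: "norm z = 1" using assms by simp
  then have z0: "z \<noteq> 0" by auto
  define f1 where "f1 = (1 / norm (b z)) *\<^sub>R b z"
  have n: "norm f1 = 1" using sharp_nonzero[OF z0] by (simp add: f1_def)
  have "herm (b z) z = m z z"
    by (subst mform_expand(2)) (simp add: herm_def sharp_nth mult.commute)
  then have h: "herm (b z) z = 0" by (simp add: m_self)
  then have "herm z (b z) = 0" using cnj_herm complex_cnj_zero by metis
  then have "herm z f1 = 0" by (simp add: f1_def herm_linear)
  from unitary_frame_exists[OF z n this] obtain f2 f3 where
    "herm f2 f2 = 1" "herm f3 f3 = 1" "herm z f2 = 0" "herm z f3 = 0"
    "herm f1 f2 = 0" "herm f1 f3 = 0" "herm f2 f3 = 0" "det4 z f1 f2 f3 = 1" .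
  then have "adapted_frame M z f1 f2 f3"
    by unfold_locales (use z f1_def in auto)
  then show ?thesis by (rule that)
qed

section \<open>Smoothness of the forms of the structure\<close>

lemma open_punctured: "open (- {0 :: complex^4})"
  by (rule open_Compl) simp

lemma degree_sums: "1 + 1 = (2::nat)" "1 + 2 = (3::nat)"
  by simp_all

lemma smooth_on_cov:
  assumes "open S" "\<And>v. smooth_on S (\<lambda>z. p z v)"
  shows "smooth_on S (\<lambda>z. cov (p z) vs)"
proof (cases "\<exists>v. vs = [v]")
  case True
  then show ?thesis using assms(2) by (auto simp: cov_values)
next
  case False
  then have "length vs \<noteq> 1" by (auto simp: length_Suc_conv)
  then have "(\<lambda>w. cov (p w) vs) = (\<lambda>w. 0)" using homog_cov by (auto simp: homog_def)
  then show ?thesis using smooth_on_const[OF assms(1)] by simp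
qed

lemma smooth_form_on_cov:
  assumes "open S" "\<And>v. smooth_on S (\<lambda>z. p z v)" "\<And>z. z \<in> S \<Longrightarrow> linear (p z)"
  shows "smooth_form_on S 1 (\<lambda>z. cov (p z))"
proof (rule smooth_form_onI)
  show "alt_form 1 (cov (p z))" if "z \<in> S" for z using alt_form_cov assms(3)[OF that] .
  show "smooth_on S (\<lambda>z. cov (p z) vs)" for vs by (rule smooth_on_cov[OF assms(1,2)])
qed

lemma smooth_form_on_cong:
  assumes "open S" "\<And>z. z \<in> S \<Longrightarrow> \<beta> z = \<gamma> z" "smooth_form_on S k \<gamma>"
  shows "smooth_form_on S k \<beta>"
proof (rule smooth_form_onI)
  show "alt_form k (\<beta> z)" if "z \<in> S" for z
    using assms(2)[OF that] assms(3) that by (simp add: smooth_form_on_def)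
  show "smooth_on S (\<lambda>z. \<beta> z vs)" for vs
    using smooth_on_cong[OF assms(1), of "\<lambda>z. \<beta> z vs" "\<lambda>z. \<gamma> z vs"] assms(2,3) by (simp add: smooth_form_on_def)
qed

lemma smooth_form_on_const:
  assumes "open S" "alt_form k \<gamma>" shows "smooth_form_on S k (\<lambda>_. \<gamma>)"
  by (rule smooth_form_onI) (use assms smooth_on_const in auto)

lemma smooth_form_on_uminus:
  assumes "open S" "smooth_form_on S k \<beta>" shows "smooth_form_on S k (- \<beta>)"
  using smooth_form_on_linear[OF assms(1) bounded_linear_minus[OF bounded_linear_ident] assms(2)]
  by (simp add: fun_Compl_def)

lemma smooth_form_on_diff:
  assumes "open S" "smooth_form_on S k \<beta>" "smooth_form_on S k \<gamma>" shows "smooth_form_on S k (\<beta> - \<gamma>)"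
  using smooth_form_on_add[OF assms(1,2) smooth_form_on_uminus[OF assms(1,3)]] by simp

lemma smooth_form_on_cnj:
  assumes "open S" "smooth_form_on S k \<beta>" shows "smooth_form_on S k (cnj_form \<beta>)"
  using smooth_form_on_linear[OF assms(1) bounded_linear_cnj assms(2)]
  by (simp add: cnj_form_def[abs_def])

lemma smooth_form_on_Re:
  assumes "open S" "smooth_form_on S k \<beta>" shows "smooth_form_on S k (Re_form \<beta>)"
  using smooth_form_on_linear[OF assms(1) bounded_linear_compose[OF bounded_linear_of_real bounded_linear_Re] assms(2)]
  by (simp add: Re_form_def[abs_def])

lemma smooth_form_on_interior:
  assumes "smooth_form_on S (Suc k) \<beta>" shows "smooth_form_on S k (\<lambda>z. interior v (\<beta> z))"
  using assms by (auto simp: smooth_form_on_def alt_form_iff homog_interior multilin_interior alternating_interior) (simp add: interior_def)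

lemma smooth_on_linear_fun: "open S \<Longrightarrow> linear f \<Longrightarrow> smooth_on S (f :: complex^4 \<Rightarrow> complex)"
  by (simp add: smooth_on_linear linear_linear)

lemma linear_coord: "linear (\<lambda>v :: complex^4. v $ j)" "linear (\<lambda>v :: complex^4. cnj (v $ j))"
  by (auto intro!: linearI simp: scaleR_complex)

lemma linear_herm: "linear (herm u)" "linear (\<lambda>u. herm u v)"
  by (auto intro!: linearI simp: herm_linear scaleR_complex)

lemma smooth_form_omega0: "open S \<Longrightarrow> smooth_form_on S 2 omega0"
proof -
  assume S: "open S"
  have "alt_form (1 + 1) (cov (\<lambda>v :: complex^4. v $ j) \<odot> cov (\<lambda>v. cnj (v $ j)))" for j
    by (intro alt_form_emul alt_form_cov linear_coord)
  then have "alt_form 2 (omega0 0)" unfolding omega0_cov sum_4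
    by (intro alt_form_linear) (simp_all add: numeral_2_eq_2)
  then have "smooth_form_on S 2 (\<lambda>_. omega0 0)" by (rule smooth_form_on_const[OF S])
  then show ?thesis by (rule smooth_form_on_cong[OF S, rotated]) (simp add: omega0_cov)
qed

context invertible_skew begin

abbreviation "S0 \<equiv> - {0 :: complex^4}"

lemma smooth_m: "smooth_on S0 (\<lambda>z. m z v)"
  by (rule smooth_on_linear_fun[OF open_punctured linear_mform(2)])

lemma smooth_m_sharp: "smooth_on S0 (\<lambda>z. m (b z) v)"
  using linear_compose[OF linear_sharp linear_mform(2)] by (intro smooth_on_linear_fun[OF open_punctured]) (simp add: o_def)

lemma smooth_nsq: "smooth_on S0 nsq"
  unfolding norm_sq_alphaM[abs_def] mform_sharp
  by (intro smooth_on_sum smooth_on_mult smooth_m open_punctured smooth_on_compose_linear[OF open_punctured bounded_linear_cnj])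

lemma smooth_invn: "smooth_on S0 invn"
  unfolding invn_eq[abs_def] divide_inverse
  by (intro smooth_on_mult smooth_on_const open_punctured smooth_on_inverse smooth_nsq) (use nsq_nonzero in auto)

lemma smooth_eta_fun: "smooth_on S0 (\<lambda>z. eta_fun M z v)"
  unfolding eta_fun_def by (intro smooth_on_mult smooth_on_const open_punctured smooth_invn smooth_m_sharp)

lemma smooth_alpha: "smooth_form_on S0 1 \<alpha>"
  unfolding alphaM_cov[abs_def] by (rule smooth_form_on_cov) (auto intro: smooth_m linear_mform)

lemma linear_eta_fun: "linear (eta_fun M z)"
  by (rule linearI) (simp_all add: eta_fun_def mform_linear scaleR_complex algebra_simps)

lemma smooth_eta: "smooth_form_on S0 1 \<eta>"
  unfolding etaM_cov[OF skew, abs_def] by (rule smooth_form_on_cov) (auto intro: smooth_eta_fun linear_eta_fun)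

lemma smooth_aac: "smooth_form_on S0 2 (alpha_alphabar M)"
  unfolding alpha_alphabar_def
  using smooth_form_on_wedge[OF open_punctured smooth_alpha smooth_form_on_cnj[OF open_punctured smooth_alpha]] by (simp only: degree_sums)

lemma smooth_omegaM: "smooth_form_on S0 2 (omegaM M)"
  unfolding omegaM_def
  by (intro smooth_form_on_diff smooth_form_omega0 open_punctured smooth_form_on_scale smooth_aac smooth_on_mult smooth_on_const smooth_invn)

lemma dalpha_cov: "ext_d \<alpha> z = (\<Sum>i\<in>UNIV. \<Sum>j\<in>UNIV. scl (M $ i $ j) (cov (\<lambda>v. v $ i) \<odot> cov (\<lambda>v. v $ j)))"
proof (rule homog2_eqI[OF homog_ext_d_alphaM])
  fix u v
  have "ext_d \<alpha> z [u, v] = m u v - m v u"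
    unfolding ext_d_alphaM[OF skew] by (subst (2) m_skew) simp
  then show "ext_d \<alpha> z [u, v] = (\<Sum>i\<in>UNIV. \<Sum>j\<in>UNIV. scl (M $ i $ j) (cov (\<lambda>v. v $ i) \<odot> cov (\<lambda>v. v $ j))) [u, v]"
    by (simp add: mform_def sum_4 scl_def cov_emul_cov algebra_simps)
qed (auto simp: sum_4 intro!: homog_linear homog_cov_cov)

lemma smooth_dalpha: "smooth_form_on S0 2 (\<lambda>_. ext_d \<alpha> 0)"
proof (rule smooth_form_on_const[OF open_punctured])
  have "alt_form (1 + 1) (cov (\<lambda>v :: complex^4. v $ i) \<odot> cov (\<lambda>v. v $ j))" for i j
    by (intro alt_form_emul alt_form_cov linear_coord)
  then show "alt_form 2 (ext_d \<alpha> 0)" unfolding dalpha_cov sum_4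
    by (intro alt_form_linear) (simp_all add: numeral_2_eq_2)
qed

lemma smooth_hat: "smooth_form_on S0 2 (hatOmegaM M)"
proof (rule smooth_form_on_cong[OF open_punctured])
  show "smooth_form_on S0 2 ((\<lambda>z. inverse (2 * Pf * invn z)) *\<^sub>f ((\<lambda>_. ext_d \<alpha> 0) - (\<alpha> \<and>\<^sub>f \<eta>)))"
    using smooth_form_on_wedge[OF open_punctured smooth_alpha smooth_eta, unfolded degree_sums] Pf_nonzero nsq_nonzero
    by (intro smooth_form_on_scale smooth_form_on_diff open_punctured smooth_dalpha smooth_on_inverse smooth_on_mult smooth_on_const smooth_invn)
      (auto simp: invn_eq)
  fix z :: "complex^4" assume "z \<in> S0"
  then have z: "z \<noteq> 0" by simp
  show "hatOmegaM M z = ((\<lambda>z. inverse (2 * Pf * invn z)) *\<^sub>f ((\<lambda>_. ext_d \<alpha> 0) - (\<alpha> \<and>\<^sub>f \<eta>))) z"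
    using hatOmega_eq[OF z, symmetric] lambda_nonzero[OF z] ext_d_alphaM_const[OF skew, of z]
    by (simp add: scale_form_scl wedge_emul lambda_def[symmetric] scl_scl scl_add)
qed

lemma smooth_OmegaM: "smooth_form_on S0 3 (OmegaM M)"
  unfolding OmegaM_def
  using smooth_form_on_scale[OF open_punctured smooth_invn smooth_form_on_wedge[OF open_punctured smooth_form_on_cnj[OF open_punctured smooth_alpha] smooth_hat]]
  by (simp only: degree_sums)

lemma smooth_W1: "smooth_on S0 (W1M M)"
  unfolding W1M_def by (intro smooth_on_mult smooth_on_const open_punctured smooth_on_compose_linear[OF open_punctured bounded_linear_cnj] smooth_invn)

lemma smooth_W2: "smooth_form_on S0 2 (W2M M)"
  unfolding W2M_def divide_inverse
  by (intro smooth_form_on_scale smooth_form_on_add smooth_omegaM smooth_aac open_punctured smooth_on_mult smooth_W1 smooth_on_const smooth_invn)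

lemma smooth_W3: "smooth_form_on S0 3 (W3M M)"
proof -
  have "smooth_form_on S0 2 (omegaM M + (\<lambda>z. \<i> * invn z) *\<^sub>f alpha_alphabar M)"
    by (intro smooth_form_on_scale smooth_form_on_add smooth_omegaM smooth_aac open_punctured smooth_on_mult smooth_on_const smooth_invn)
  from smooth_form_on_wedge[OF open_punctured smooth_form_on_Re[OF open_punctured smooth_eta] this]
  show ?thesis by (simp only: W3M_def degree_sums)
qed

lemma smooth_W5: "smooth_form_on S0 1 (W5M M)"
  unfolding W5M_def
  by (intro smooth_form_on_diff smooth_form_on_uminus smooth_eta smooth_form_on_scale smooth_form_on_cov smooth_on_const
    open_punctured smooth_on_linear_fun linear_herm)

section \<open>Invariance under the circle action\<close>

definition pull :: "complex \<Rightarrow> ((complex^4) list \<Rightarrow> complex) \<Rightarrow> (complex^4) list \<Rightarrow> complex" where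
  "pull c \<beta> vs = \<beta> (map (\<lambda>v. c *s v) vs)"

lemma pull_simps:
  "pull c (\<beta> + \<gamma>) = pull c \<beta> + pull c \<gamma>" "pull c (\<beta> - \<gamma>) = pull c \<beta> - pull c \<gamma>"
  "pull c (- \<beta>) = - pull c \<beta>" "pull c (scl x \<beta>) = scl x (pull c \<beta>)"
  by (auto simp: pull_def fun_eq_iff scl_def)

lemma pull_emul: "pull c (\<beta> \<odot> \<gamma>) = pull c \<beta> \<odot> pull c \<gamma>"
  unfolding pull_def emul_comp_map by (simp add: pull_def[abs_def])

lemma pull_cov: "pull c (cov p) = cov (\<lambda>v. p (c *s v))"
  by (auto simp: pull_def cov_def fun_eq_iff split: list.splits)

text \<open>
  Horizontality is tested after restriction to tangent vectors, where the frame is available.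
\<close>

lemma basicI:
  assumes "\<And>z. z \<in> S7 \<Longrightarrow> interior (\<i> *s z) (restr (tangent z) (\<beta> z)) = 0"
    "\<And>z c. z \<in> S7 \<Longrightarrow> cmod c = 1 \<Longrightarrow> pull c (\<beta> (c *s z)) = \<beta> z"
  shows "basic \<beta>"
  unfolding basic_def
proof (intro ballI allI impI conjI)
  fix z vs assume z: "z \<in> S7" and vs: "set vs \<subseteq> tangent z"
  have "Re (herm z (\<i> *s z)) = 0" by (simp add: herm_linear herm_self)
  then have "\<i> *s z \<in> tangent z" by (simp add: tangent_def inner_herm)
  then show "\<beta> z (\<i> *s z # vs) = 0"
    using fun_cong[OF assms(1)[OF z], of vs] vs by (simp add: interior_def restr_def)
  fix c :: complex assume "cmod c = 1"
  from fun_cong[OF assms(2)[OF z this], of vs] show "\<beta> (c *s z) (map ((*s) c) vs) = \<beta> z vs"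
    by (simp add: pull_def)
qed

lemma unit_cnj: "cmod c = 1 \<Longrightarrow> c * cnj c = 1" "cmod c = 1 \<Longrightarrow> cnj c * c = 1"
  "cmod c = 1 \<Longrightarrow> c * (cnj c * x) = x" "cmod c = 1 \<Longrightarrow> cnj c * (c * x) = x"
proof -
  show *: "cmod c = 1 \<Longrightarrow> c * cnj c = 1" for c by (simp add: complex_norm_square[symmetric])
  show "cmod c = 1 \<Longrightarrow> cnj c * c = 1" using * by (simp add: mult.commute)
  show "cmod c = 1 \<Longrightarrow> c * (cnj c * x) = x" "cmod c = 1 \<Longrightarrow> cnj c * (c * x) = x"
    using * by (simp_all add: mult.assoc[symmetric]) (simp add: mult.commute)
qed

lemma nsq_rotate: "cmod c = 1 \<Longrightarrow> nsq (c *s z) = nsq z"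
  by (simp add: norm_sq_alphaM sharp_smult mform_linear unit_cnj)

lemma invn_rotate: "cmod c = 1 \<Longrightarrow> invn (c *s z) = invn z"
  by (simp add: invn_eq nsq_rotate)

lemma eta_rotate: "cmod c = 1 \<Longrightarrow> pull c (e (c *s z)) = e z"
  unfolding pull_cov by (rule arg_cong[where f = cov]) (simp add: fun_eq_iff eta_fun_def sharp_smult mform_linear invn_rotate unit_cnj)

lemma rho_rotate: "cmod c = 1 \<Longrightarrow> pull c (cov (rho (c *s z))) = cov (rho z)"
  unfolding pull_cov by (rule arg_cong[where f = cov]) (simp add: fun_eq_iff rho_def eta_fun_def sharp_smult mform_linear invn_rotate unit_cnj)

text \<open>
  The twist form has weight 2 under the circle. In \<open>\<omega>\<close> the weights of \<open>\<alpha>\<close> and its conjugate cancel; in \<open>\<Omega>\<close>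
  the weight of \<open>conj \<alpha>\<close> cancels that of \<open>d\<alpha> - \<alpha> \<and> \<eta>\<close>.
\<close>

lemma a_rotate: "pull c (a (c *s z)) = scl (c * c) (a z)" "pull c (ac (c *s z)) = scl (cnj c * cnj c) (ac z)"
  unfolding pull_cov cov_linear(3)[symmetric] by (rule arg_cong[where f = cov], simp add: fun_eq_iff mform_linear)+

lemma aac_rotate: "cmod c = 1 \<Longrightarrow> pull c (a (c *s z) \<odot> ac (c *s z)) = a z \<odot> ac z"
  by (simp add: pull_emul a_rotate emul_linear scl_scl mult.assoc unit_cnj scl_add)

lemma dalpha_rotate: "pull c (ext_d \<alpha> z) = scl (c * c) (ext_d \<alpha> z)"
  unfolding dalpha_cov sum_4
  by (simp add: pull_simps pull_emul pull_cov cov_linear emul_linear scl_scl scl_add mult.commute mult.left_commute)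

lemma omega0_rotate: "cmod c = 1 \<Longrightarrow> pull c (omega0 (c *s z)) = omega0 z"
  unfolding omega0_cov sum_4
  by (simp add: pull_simps pull_emul pull_cov cov_linear emul_linear scl_scl scl_add unit_cnj)

lemma omegaM_rotate: "cmod c = 1 \<Longrightarrow> pull c (omegaM M (c *s z)) = omegaM M z"
  by (simp add: omegaM_eq pull_simps aac_rotate omega0_rotate invn_rotate)

lemma OmegaM_rotate: assumes "cmod c = 1" "z \<noteq> 0" shows "pull c (OmegaM M (c *s z)) = OmegaM M z"
proof -
  have "c *s z \<noteq> 0" using assms by (auto simp: vec_eq_iff)
  then show ?thesis using assms
    by (simp add: OmegaM_eq_pfaffian pull_simps pull_emul a_rotate eta_rotate dalpha_rotate emul_linear scl_scl scl_add mult.assoc unit_cnj)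
qed

lemma W1_rotate: "cmod c = 1 \<Longrightarrow> W1M M (c *s z) = W1M M z"
  by (simp add: W1M_def invn_rotate)

lemma W2_rotate: "cmod c = 1 \<Longrightarrow> pull c (W2M M (c *s z)) = W2M M z"
  by (simp add: W2M_def scale_form_scl alpha_alphabar_eq pull_simps W1_rotate omegaM_rotate aac_rotate invn_rotate)

lemma W3_rotate: "cmod c = 1 \<Longrightarrow> pull c (W3M M (c *s z)) = W3M M z"
  by (simp add: W3M_def wedge_emul Re_form_eta scale_form_scl alpha_alphabar_eq pull_simps pull_emul[of _ "cov (rho _)"] rho_rotate omegaM_rotate aac_rotate invn_rotate)

lemma W5_rotate: "cmod c = 1 \<Longrightarrow> pull c (W5M M (c *s z)) = W5M M z"
  by (simp add: W5M_def etaM_cov[OF skew] scale_form_scl pull_simps eta_rotate)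
     (simp add: pull_cov herm_linear unit_cnj)

end

section \<open>Complex vectors and types\<close>

lemma complexify_zero: "complexify (\<lambda>vs. 0) ws = 0"
  by (induction ws) auto

lemma complexify_uminus: "complexify (\<lambda>vs. - \<beta> vs) ws = - complexify \<beta> ws"
  using complexify_scale[of "- 1" \<beta> ws] by simp

lemma complexify_linear:
  "complexify (\<beta> + \<gamma>) = complexify \<beta> + complexify \<gamma>" "complexify (\<beta> - \<gamma>) = complexify \<beta> - complexify \<gamma>"
  "complexify (- \<beta>) = - complexify \<beta>" "complexify (scl c \<beta>) = scl c (complexify \<beta>)"
proof -
  show "complexify (\<beta> + \<gamma>) = complexify \<beta> + complexify \<gamma>"
    by (rule ext) (simp add: complexify_add plus_fun_def)
  show "complexify (- \<beta>) = - complexify \<beta>"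
    by (rule ext) (simp add: complexify_uminus fun_Compl_def)
  show "complexify (\<beta> - \<gamma>) = complexify \<beta> - complexify \<gamma>"
    using complexify_add[of \<beta> "\<lambda>vs. - \<gamma> vs"] by (intro ext) (simp add: complexify_uminus fun_diff_def)
  show "complexify (scl c \<beta>) = scl c (complexify \<beta>)"
    by (rule ext) (simp add: complexify_scale scl_def[abs_def])
qed

lemma complexify_cov: "complexify (cov p) = cov (\<lambda>(x, y). p x + \<i> * p y)"
proof
  fix ws show "complexify (cov p) ws = cov (\<lambda>(x, y). p x + \<i> * p y) ws"
  proof (cases ws)
    case Nil then show ?thesis by (simp add: cov_values)
  next
    case (Cons w ws')
    then show ?thesis
      by (cases w; cases ws') (auto simp: cov_values complexify_zero)
  qed
qed

lemma homog_complexify: "homog k \<beta> \<Longrightarrow> length ws \<noteq> k \<Longrightarrow> complexify \<beta> ws = 0"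
proof (induction ws arbitrary: k \<beta>)
  case Nil
  then show ?case by (simp add: homog_def)
next
  case (Cons w ws)
  obtain x y where w: "w = (x, y)" by force
  have i: "(\<lambda>vs. \<beta> (x # vs)) = interior x \<beta>" for x by (simp add: interior_def fun_eq_iff)
  show ?case
  proof (cases k)
    case 0
    then have "interior v \<beta> = 0" for v using homog_0[of \<beta>] Cons.prems interior_const_form by metis
    then show ?thesis unfolding w complexify.simps i by (simp add: complexify_zero zero_fun_def)
  next
    case (Suc l)
    then have h: "homog l (interior v \<beta>)" for v using Cons.prems homog_interior by auto
    show ?thesis unfolding w complexify.simps i
      using Cons.IH[OF h[of x]] Cons.IH[OF h[of y]] Cons.prems Suc by auto
  qed
qed

text \<open>
  On vectors with tangent components, complexification only sees the restricted form.
\<close>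

lemma complexify_restr:
  assumes "set ws \<subseteq> T \<times> T" shows "complexify (restr T \<beta>) ws = complexify \<beta> ws"
  using assms
proof (induction ws arbitrary: \<beta>)
  case Nil
  then show ?case by (simp add: restr_def)
next
  case (Cons w ws)
  obtain x y where w: "w = (x, y)" by force
  have "(\<lambda>vs. restr T \<beta> (v # vs)) = restr T (\<lambda>vs. \<beta> (v # vs))" if "v \<in> T" for v
    using that by (simp add: restr_def fun_eq_iff)
  then show ?case using Cons by (auto simp: w)
qed

context adapted_frame begin

lemma horizontal_iff: "v \<in> horizontal z \<longleftrightarrow> herm z v = 0"
  by (auto simp: horizontal_def inner_herm herm_linear complex_eq_iff)

lemma horizontal_tangent: "v \<in> horizontal z \<Longrightarrow> v \<in> tangent z"
  by (simp add: horizontal_iff tangent_iff)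

lemma interior_iz: "interior (\<i> *s z) P1 = 0" "interior (\<i> *s z) Q1 = 0" "interior (\<i> *s z) P2 = 0" "interior (\<i> *s z) Q2 = 0"
   "interior (\<i> *s z) P3 = 0" "interior (\<i> *s z) Q3 = 0"
  by (simp_all add: P1_def Q1_def P2_def Q2_def P3_def Q3_def restr_cov interior_cov herm_linear orthonormal orthonormal_more)
     (simp_all add: const_form_def fun_eq_iff)

lemma frame_values:
  "x \<in> horizontal z \<Longrightarrow> P1 [x] = cnj (herm f1 x)" "x \<in> horizontal z \<Longrightarrow> Q1 [x] = herm f1 x"
  "x \<in> horizontal z \<Longrightarrow> P2 [x] = herm f2 x" "x \<in> horizontal z \<Longrightarrow> Q2 [x] = cnj (herm f2 x)"
  "x \<in> horizontal z \<Longrightarrow> P3 [x] = herm f3 x" "x \<in> horizontal z \<Longrightarrow> Q3 [x] = cnj (herm f3 x)"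
  using horizontal_tangent
  by (simp_all add: P1_def Q1_def P2_def Q2_def P3_def Q3_def restr_cov cov_values)

lemma P_cov: "P1 = cov (\<lambda>v. P1 [v])" "P2 = cov (\<lambda>v. P2 [v])" "P3 = cov (\<lambda>v. P3 [v])"
   "Q1 = cov (\<lambda>v. Q1 [v])" "Q2 = cov (\<lambda>v. Q2 [v])" "Q3 = cov (\<lambda>v. Q3 [v])"
  by (simp_all add: P1_def Q1_def P2_def Q2_def P3_def Q3_def restr_cov cov_values)

lemma Omega_value:
  assumes "x \<in> horizontal z" "y \<in> horizontal z" "w \<in> horizontal z"
  shows "OmegaM M z [x, y, w] = P1 [x] * (P2 [y] * P3 [w] - P2 [w] * P3 [y]) - P1 [y] * (P2 [x] * P3 [w] - P2 [w] * P3 [x])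
     + P1 [w] * (P2 [x] * P3 [y] - P2 [y] * P3 [x])"
proof -
  have "OmegaM M z [x, y, w] = R (OmegaM M z) [x, y, w]"
    using assms horizontal_tangent by (simp add: restr_def)
  also have "\<dots> = (cov (\<lambda>v. P1 [v]) \<odot> cov (\<lambda>v. P2 [v]) \<odot> cov (\<lambda>v. P3 [v])) [x, y, w]"
    unfolding R_Omega by (simp flip: P_cov)
  finally show ?thesis by (simp add: cov_emul_values cov_values mult.commute)
qed

lemma omega_value:
  assumes "x \<in> horizontal z" "y \<in> horizontal z"
  shows "omegaM M z [x, y] = \<i> / 2 * (P1 [x] * Q1 [y] - P1 [y] * Q1 [x] + (P2 [x] * Q2 [y] - P2 [y] * Q2 [x])
     + (P3 [x] * Q3 [y] - P3 [y] * Q3 [x]))"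
proof -
  have "omegaM M z [x, y] = R (omegaM M z) [x, y]"
    using assms horizontal_tangent by (simp add: restr_def)
  also have "\<dots> = scl (\<i> / 2) (cov (\<lambda>v. P1 [v]) \<odot> cov (\<lambda>v. Q1 [v]) + cov (\<lambda>v. P2 [v]) \<odot> cov (\<lambda>v. Q2 [v])
      + cov (\<lambda>v. P3 [v]) \<odot> cov (\<lambda>v. Q3 [v])) [x, y]"
    unfolding R_omega by (simp flip: P_cov)
  finally show ?thesis by (simp add: cov_emul_values cov_values scl_def mult.commute)
qed

lemma frame_horizontal: "f1 \<in> horizontal z" "f2 \<in> horizontal z" "f3 \<in> horizontal z"
  "v \<in> horizontal z \<Longrightarrow> \<i> *s v \<in> horizontal z"
  by (simp_all add: horizontal_iff orthonormal orthonormal_more herm_linear)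

lemma Omega_frame: "OmegaM M z [f1, f2, f3] = 1"
  by (simp add: Omega_value frame_horizontal frame_values orthonormal orthonormal_more)

text \<open>
  Insert two of the frame vectors into \<open>\<Omega> = \<phi>\<^sub>1 \<and> \<phi>\<^sub>2 \<and> \<phi>\<^sub>3\<close> besides the given complex vector.
\<close>

lemma T01_covectors:
  assumes "w \<in> T01 (OmegaM M) z"
  shows "fst w \<in> horizontal z" "snd w \<in> horizontal z"
    "P1 [fst w] + \<i> * P1 [snd w] = 0" "P2 [fst w] + \<i> * P2 [snd w] = 0" "P3 [fst w] + \<i> * P3 [snd w] = 0"
proof -
  obtain x y where w: "w = (x, y)" by force
  show h: "fst w \<in> horizontal z" "snd w \<in> horizontal z" using assms by (auto simp: w T01_def)
  have v: "OmegaM M z (x # vs) + \<i> * OmegaM M z (y # vs) = 0" if "set vs \<subseteq> horizontal z" for vs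
    using assms that by (auto simp: w T01_def)
  show "P1 [fst w] + \<i> * P1 [snd w] = 0"
    using v[of "[f2, f3]"] h by (simp add: w Omega_value frame_horizontal frame_values orthonormal orthonormal_more)
  show "P2 [fst w] + \<i> * P2 [snd w] = 0"
    using v[of "[f3, f1]"] h by (simp add: w Omega_value frame_horizontal frame_values orthonormal orthonormal_more algebra_simps)
  show "P3 [fst w] + \<i> * P3 [snd w] = 0"
    using v[of "[f1, f2]"] h by (simp add: w Omega_value frame_horizontal frame_values orthonormal orthonormal_more algebra_simps)
qed

lemma T10_covectors:
  assumes "w \<in> T10 (OmegaM M) z"
  shows "fst w \<in> horizontal z" "snd w \<in> horizontal z"
    "Q1 [fst w] + \<i> * Q1 [snd w] = 0" "Q2 [fst w] + \<i> * Q2 [snd w] = 0" "Q3 [fst w] + \<i> * Q3 [snd w] = 0"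
proof -
  obtain x y where w: "w = (x, y)" by force
  have t: "(x, - y) \<in> T01 (OmegaM M) z" using assms by (simp add: w T10_def)
  have m: "- y \<in> horizontal z \<longleftrightarrow> y \<in> horizontal z"
    using herm_linear(2)[of z "-1" y] by (simp add: horizontal_iff)
  show h: "fst w \<in> horizontal z" "snd w \<in> horizontal z" using T01_covectors(1,2)[OF t] m by (auto simp: w)
  have n: "herm u (- y) = - herm u y" for u using herm_linear(2)[of u "-1" y] by simp
  have c: "A = B \<Longrightarrow> cnj A = cnj B" for A B by simp
  show "Q1 [fst w] + \<i> * Q1 [snd w] = 0" "Q2 [fst w] + \<i> * Q2 [snd w] = 0" "Q3 [fst w] + \<i> * Q3 [snd w] = 0"
    using T01_covectors(3-5)[OF t, THEN c] h m by (simp_all add: w frame_values n)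
qed

text \<open>
  The value of a real-linear one-form on a complex tangent vector given as a pair.
\<close>

definition "cx p = (\<lambda>(x, y). p [x] + \<i> * p [y])" for p :: "(complex^4) list \<Rightarrow> complex"

lemma complexify_P: "complexify P1 = cov (cx P1)" "complexify P2 = cov (cx P2)" "complexify P3 = cov (cx P3)"
  "complexify Q1 = cov (cx Q1)" "complexify Q2 = cov (cx Q2)" "complexify Q3 = cov (cx Q3)"
  using P_cov complexify_cov[of "\<lambda>v. P1 [v]"] complexify_cov[of "\<lambda>v. P2 [v]"] complexify_cov[of "\<lambda>v. P3 [v]"]
    complexify_cov[of "\<lambda>v. Q1 [v]"] complexify_cov[of "\<lambda>v. Q2 [v]"] complexify_cov[of "\<lambda>v. Q3 [v]"]
  by (simp_all add: cx_def)

lemma T01_cx: "w \<in> T01 (OmegaM M) z \<Longrightarrow> cx P1 w = 0" "w \<in> T01 (OmegaM M) z \<Longrightarrow> cx P2 w = 0" "w \<in> T01 (OmegaM M) z \<Longrightarrow> cx P3 w = 0"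
  and T10_cx: "w \<in> T10 (OmegaM M) z \<Longrightarrow> cx Q1 w = 0" "w \<in> T10 (OmegaM M) z \<Longrightarrow> cx Q2 w = 0" "w \<in> T10 (OmegaM M) z \<Longrightarrow> cx Q3 w = 0"
  using T01_covectors[of w] T10_covectors[of w] by (auto simp: cx_def split_beta)

lemma complexify_R:
  assumes "set us \<subseteq> T10 (OmegaM M) z" "set vs \<subseteq> T01 (OmegaM M) z"
  shows "complexify \<beta> (us @ vs) = complexify (R \<beta>) (us @ vs)"
proof -
  have "w \<in> tangent z \<times> tangent z" if "w \<in> set (us @ vs)" for w
    using that assms T01_covectors(1,2)[of w] T10_covectors(1,2)[of w] horizontal_tangent by (auto simp: mem_Times_iff)
  then show ?thesis by (intro complexify_restr[symmetric]) blast
qed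

end

section \<open>Existence of the torsion classes\<close>

lemma length_2_obtain: assumes "length ws = 2" obtains x y where "ws = [x, y]"
  using assms by (auto simp: numeral_2_eq_2 length_Suc_conv)

lemma length_3_obtain: assumes "length ws = 3" obtains x y w where "ws = [x, y, w]"
  using assms by (auto simp: numeral_3_eq_3 length_Suc_conv)

lemma length_1_obtain: assumes "length ws = 1" obtains x where "ws = [x]"
  using assms by (auto simp: length_Suc_conv)

context adapted_frame begin

lemma conj_R: "conj_ext (R (omegaM M z)) = R (omegaM M z)"
  unfolding R_omega conj_ext_linear conj_ext_emul R_conj
  by (simp only: R_simps) (simp add: fun_eq_iff scl_def algebra_simps)

lemma conj_W3: "conj_ext (R (W3M M z)) = R (W3M M z)"
proof -
  have "conj_ext (R (omega0 z)) = R (omega0 z)"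
    unfolding R_omega0 conj_ext_linear conj_ext_emul R_conj
    by (simp only: R_simps) (simp add: fun_eq_iff scl_def algebra_simps)
  moreover have "conj_ext (cov (rho z)) = cov (rho z)"
    by (simp add: conj_ext_cov rho_def[abs_def])
  ultimately show ?thesis by (simp add: R_W3 conj_ext_emul conj_restr)
qed

lemma interior_iz_forms:
  "interior (\<i> *s z) (R (OmegaM M z)) = 0" "interior (\<i> *s z) (R (omegaM M z)) = 0" "interior (\<i> *s z) (R (W2M M z)) = 0"
  "interior (\<i> *s z) (R (W3M M z)) = 0" "interior (\<i> *s z) (R (cov (rho z))) = 0" "interior (\<i> *s z) (R (W5M M z)) = 0"
  unfolding R_W3 R_Omega R_omega R_W2 R_W5 R_omega0 R_rho
  by (simp_all add: interior_simps interior_iz emul_linear scl_add)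

text \<open>
  \<open>W\<^sub>2\<close> is a combination of the \<open>\<phi>\<^sub>k \<and> conj \<phi>\<^sub>k\<close>, and one factor vanishes on each type of vectors.
\<close>

lemma type_W2:
  assumes "set us \<subseteq> T10 (OmegaM M) z" "set vs \<subseteq> T01 (OmegaM M) z" "(length us, length vs) \<notin> {(1, 1)}"
  shows "complexify (W2M M z) (us @ vs) = 0"
proof (cases "length (us @ vs) = 2")
  case False
  have "alt_form 2 (W2M M z)" using smooth_W2 z_nonzero by (simp add: smooth_form_on_def)
  then show ?thesis using homog_complexify[OF _ False] by (simp add: alt_form_iff)
next
  case True
  then obtain x y where xy: "us @ vs = [x, y]" by (rule length_2_obtain)
  have "set [x, y] \<subseteq> T10 (OmegaM M) z \<or> set [x, y] \<subseteq> T01 (OmegaM M) z"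
  proof (cases "length us = 0")
    case True then show ?thesis using assms(2) xy by auto
  next
    case False
    then have "vs = []" using True assms(3) by (cases us; cases vs) auto
    then show ?thesis using assms(1) xy by auto
  qed
  then have k: "(cov (cx Q1) \<odot> cov (cx P1)) [x, y] = 0" "(cov (cx P2) \<odot> cov (cx Q2)) [x, y] = 0" "(cov (cx P3) \<odot> cov (cx Q3)) [x, y] = 0"
    by (elim disjE; simp add: cov_emul_cov T01_cx T10_cx)+
  show ?thesis
    by (subst complexify_R[OF assms(1,2)], unfold R_W2 complexify_linear complexify_emul complexify_P xy)
      (simp add: scl_def k)
qed

text \<open>
  \<open>W\<^sub>3\<close> contains the factor \<open>\<omega>\<^sub>0\<close>, which is of type \<open>(1,1)\<close> also for the modified complex structure.
\<close>

lemma type_W3: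
  assumes "set us \<subseteq> T10 (OmegaM M) z" "set vs \<subseteq> T01 (OmegaM M) z" "(length us, length vs) \<notin> {(1, 2), (2, 1)}"
  shows "complexify (W3M M z) (us @ vs) = 0"
proof (cases "length (us @ vs) = 3")
  case False
  have "alt_form 3 (W3M M z)" using smooth_W3 z_nonzero by (simp add: smooth_form_on_def)
  then show ?thesis using homog_complexify[OF _ False] by (simp add: alt_form_iff)
next
  case True
  then obtain x y w where xy: "us @ vs = [x, y, w]" by (rule length_3_obtain)
  have "set [x, y, w] \<subseteq> T10 (OmegaM M) z \<or> set [x, y, w] \<subseteq> T01 (OmegaM M) z"
  proof (cases "length us = 0")
    case True then show ?thesis using assms(2) xy by auto
  next
    case False
    moreover have "\<not> (length us = 1 \<and> length vs = 2)" "\<not> (length us = 2 \<and> length vs = 1)"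
      using assms(3) by auto
    moreover have "length us + length vs = 3" using True by simp
    ultimately have "length us = 3" by presburger
    then have "vs = []" using True by auto
    then show ?thesis using assms(1) xy by auto
  qed
  then have k: "(cov (cx Q1) \<odot> cov (cx P1)) [a, b] = 0" "(cov (cx P2) \<odot> cov (cx Q2)) [a, b] = 0" "(cov (cx P3) \<odot> cov (cx Q3)) [a, b] = 0"
    if "a \<in> {x, y, w}" "b \<in> {x, y, w}" for a b
    using that by (elim disjE insertE emptyE; simp add: cov_emul_cov T01_cx T10_cx)+
  have r: "complexify (R (cov (rho z))) = cov (\<lambda>(u, v). R (cov (rho z)) [u] + \<i> * R (cov (rho z)) [v])"
    unfolding restr_cov complexify_cov cov_values ..
  show ?thesis
    by (subst complexify_R[OF assms(1,2)], unfold R_W3 R_omega0 complexify_linear complexify_emul complexify_P xy r)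
      (simp add: cov_emul_values(4) scl_def k)
qed

lemma type_W5:
  assumes "set us \<subseteq> T10 (OmegaM M) z" "set vs \<subseteq> T01 (OmegaM M) z" "(length us, length vs) \<notin> {(1, 0)}"
  shows "complexify (W5M M z) (us @ vs) = 0"
proof (cases "length (us @ vs) = 1")
  case False
  have "alt_form 1 (W5M M z)" using smooth_W5 z_nonzero by (simp add: smooth_form_on_def)
  then show ?thesis using homog_complexify[OF _ False] by (simp add: alt_form_iff)
next
  case True
  then obtain x where x: "us @ vs = [x]" by (rule length_1_obtain)
  then have "us = []" using assms(3) by (cases us) auto
  then have "x \<in> T01 (OmegaM M) z" using x assms(2) by auto
  then show ?thesis
    by (subst complexify_R[OF assms(1,2)], unfold R_W5 complexify_linear complexify_P x)
      (simp add: scl_def cov_values T01_cx)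
qed

lemma nondegenerate_frame:
  assumes u: "u \<in> horizontal z" and 0: "\<And>v. v \<in> horizontal z \<Longrightarrow> omegaM M z [u, v] = 0"
  shows "u = 0"
proof -
  note v = 0[OF frame_horizontal(1)] 0[OF frame_horizontal(2)] 0[OF frame_horizontal(3)]
    0[OF frame_horizontal(4)[OF frame_horizontal(1)]] 0[OF frame_horizontal(4)[OF frame_horizontal(2)]]
    0[OF frame_horizontal(4)[OF frame_horizontal(3)]]
  have "herm f1 u = 0" "herm f2 u = 0" "herm f3 u = 0"
    using v u by (simp_all add: omega_value frame_horizontal frame_values orthonormal orthonormal_more herm_linear complex_eq_iff)
  moreover have "herm z u = 0" using u by (simp add: horizontal_iff)
  ultimately show ?thesis using expansion[of u] by simp
qed

end

context invertible_skew begin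

lemma S7_nonzero: "z \<in> S7 \<Longrightarrow> z \<noteq> 0" by auto

lemma smooth_on_continuous: "smooth_on S f \<Longrightarrow> continuous_on S f"
  unfolding smooth_on_def by (drule spec[of _ 0]) simp

text \<open>
  A decomposable two-form \<open>\<sigma>\<close> equals \<open>\<iota>\<^sub>X\<sigma> \<and> \<iota>\<^sub>Y\<sigma> / \<sigma>(X,Y)\<close> wherever \<open>\<sigma>(X,Y) \<noteq> 0\<close>. For \<open>\<sigma> = \<Omega>hat\<close> and constant
  vectors \<open>X, Y\<close>, taken from the frame at the given point, the two factors are smooth near that point.
\<close>

lemma decomposable_OmegaM: "locally_decomposable (OmegaM M)"
  unfolding locally_decomposable_def
proof
  fix z assume z: "z \<in> S7"
  obtain f1 f2 f3 where "adapted_frame M z f1 f2 f3" by (rule adapted_frame_exists[OF z])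
  then interpret F: adapted_frame M z f1 f2 f3 .
  define g where "g w = hatOmegaM M w [f2, f3]" for w
  define U where "U = {w \<in> S0. g w \<noteq> 0}"
  have g: "smooth_on S0 g" using smooth_hat by (simp add: g_def[abs_def] smooth_form_on_def)
  have "open (S0 \<inter> g -` (- {0}))"
    by (rule continuous_open_preimage[OF smooth_on_continuous[OF g] open_punctured]) (simp add: open_Compl)
  moreover have U_eq: "U = S0 \<inter> g -` (- {0})" by (auto simp: U_def)
  ultimately have U: "open U" by simp
  have sub: "U \<subseteq> S0" by (auto simp: U_def)
  have sm: "smooth_form_on S0 k \<beta> \<Longrightarrow> smooth_form_on U k \<beta>" for k \<beta>
    using smooth_on_subset[OF _ sub] sub by (auto simp: smooth_form_on_def)
  have "g z = F.s" by (simp add: g_def F.hatOmega_frame scl_def cov_emul_cov F.orthonormal F.orthonormal_more)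
  then have zU: "z \<in> U" using F.z_nonzero F.s_nonzero by (simp add: U_def)
  define t1 where "t1 = invn *\<^sub>f cnj_form \<alpha>"
  define t2 :: form where "t2 = (\<lambda>w. interior f2 (hatOmegaM M w))"
  define t3 where "t3 = (\<lambda>w. inverse (g w)) *\<^sub>f (\<lambda>w. interior f3 (hatOmegaM M w))"
  have h2: "smooth_form_on S0 (Suc 1) (hatOmegaM M)" using smooth_hat by (simp add: numeral_2_eq_2)
  have s1: "smooth_form_on U 1 t1" unfolding t1_def
    by (intro sm smooth_form_on_scale open_punctured smooth_invn smooth_form_on_cnj smooth_alpha)
  have s2: "smooth_form_on U 1 t2" unfolding t2_def by (intro sm smooth_form_on_interior h2)
  have s3: "smooth_form_on U 1 t3" unfolding t3_def
    by (intro smooth_form_on_scale U sm smooth_form_on_interior h2 smooth_on_inverse smooth_on_subset[OF g sub]) (simp add: U_def)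
  have "OmegaM M w = (t1 \<and>\<^sub>f t2 \<and>\<^sub>f t3) w" if w: "w \<in> S7 \<inter> U" for w
  proof -
    obtain k1 k2 k3 where "adapted_frame M w k1 k2 k3" using adapted_frame_exists w by blast
    then interpret G: adapted_frame M w k1 k2 k3 .
    have gw: "g w = G.s * (herm k2 f2 * herm k3 f3 - herm k3 f2 * herm k2 f3)"
      by (simp add: g_def G.hatOmega_frame scl_def cov_emul_cov mult.commute)
    have gn: "g w \<noteq> 0" using w by (simp add: U_def)
    have i: "interior v (hatOmegaM M w) = scl G.s (scl (herm k2 v) (cov (herm k3)) - scl (herm k3 v) (cov (herm k2)))" for v
      by (simp add: G.hatOmega_frame interior_simps interior_cov parity_cov const_form_emul emul_const_form emul_linear) (simp add: fun_eq_iff scl_def)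
    have "t2 w \<odot> interior f3 (hatOmegaM M w) = scl (g w) (hatOmegaM M w)"
      unfolding t2_def i unfolding G.hatOmega_frame gw
      by (simp only: emul_linear scl_add scl_scl cov_square cov_anticommute[of "herm k3" "herm k2"])
        (simp add: fun_eq_iff scl_def algebra_simps)
    then have "t2 w \<odot> t3 w = hatOmegaM M w"
      using gn by (simp add: t3_def scale_form_scl emul_linear scl_scl scl_add)
    then show ?thesis
      by (simp add: wedge_emul OmegaM_eq t1_def scale_form_scl emul_linear cnj_form_conj_ext alphaM_cov conj_ext_cov)
  qed
  then have "eq_forms_on U (OmegaM M) (t1 \<and>\<^sub>f t2 \<and>\<^sub>f t3)" by (simp add: eq_forms_on_def)
  then show "\<exists>U \<theta>\<^sub>1 \<theta>\<^sub>2 \<theta>\<^sub>3. open U \<and> z \<in> U \<and>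
     smooth_form_on U 1 \<theta>\<^sub>1 \<and> smooth_form_on U 1 \<theta>\<^sub>2 \<and> smooth_form_on U 1 \<theta>\<^sub>3 \<and>
     eq_forms_on U (OmegaM M) (\<theta>\<^sub>1 \<and>\<^sub>f \<theta>\<^sub>2 \<and>\<^sub>f \<theta>\<^sub>3)"
    using U zU s1 s2 s3 by blast
qed

lemma adapted_frame_elim:
  assumes "z \<in> S7" "\<And>f1 f2 f3. adapted_frame M z f1 f2 f3 \<Longrightarrow> P"
  shows P
  using adapted_frame_exists[OF assms(1)] assms(2) by blast

lemma basic_forms:
  "basic (OmegaM M)" "basic (omegaM M)" "basic (W2M M)" "basic (W3M M)" "basic (- Re_form \<eta>)" "basic (W5M M)"
proof -
  show "basic (OmegaM M)"
    by (rule basicI, erule adapted_frame_elim, erule adapted_frame.interior_iz_forms, simp add: OmegaM_rotate S7_nonzero)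
  show "basic (omegaM M)"
    by (rule basicI, erule adapted_frame_elim, erule adapted_frame.interior_iz_forms, simp add: omegaM_rotate)
  show "basic (W2M M)"
    by (rule basicI, erule adapted_frame_elim, erule adapted_frame.interior_iz_forms, simp add: W2_rotate)
  show "basic (W3M M)"
    by (rule basicI, erule adapted_frame_elim, erule adapted_frame.interior_iz_forms, simp add: W3_rotate)
  show "basic (W5M M)"
    by (rule basicI, erule adapted_frame_elim, erule adapted_frame.interior_iz_forms, simp add: W5_rotate)
  show "basic (- Re_form \<eta>)"
  proof (rule basicI)
    show "interior (\<i> *s z) (restr (tangent z) ((- Re_form \<eta>) z)) = 0" if "z \<in> S7" for z
      by (rule adapted_frame_elim[OF that], drule adapted_frame.interior_iz_forms(5)) (simp add: Re_form_eta restr_linear interior_simps)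
    show "pull c ((- Re_form \<eta>) (c *s z)) = (- Re_form \<eta>) z" if "cmod c = 1" for c z
      using that by (simp add: Re_form_eta pull_simps rho_rotate)
  qed
qed

lemma SU3_OmegaM: "SU3_structure (OmegaM M) (omegaM M)"
  unfolding SU3_structure_def CP3_form_def
proof (intro conjI)
  show "nowhere_vanishing (OmegaM M)"
    unfolding nowhere_vanishing_def
  proof
    fix z assume "z \<in> S7"
    then obtain f1 f2 f3 where "adapted_frame M z f1 f2 f3" by (rule adapted_frame_exists)
    then interpret adapted_frame M z f1 f2 f3 .
    show "\<exists>vs. set vs \<subseteq> horizontal z \<and> OmegaM M z vs \<noteq> 0"
      by (rule exI[of _ "[f1, f2, f3]"]) (simp add: frame_horizontal Omega_frame)
  qed
  show "real_form (omegaM M)"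
    unfolding real_form_def eq_forms_restr
    by (rule ballI, erule adapted_frame_elim, drule adapted_frame.conj_R) (simp add: cnj_form_conj_ext conj_restr)
  show "nondegenerate (omegaM M)"
    unfolding nondegenerate_def
    by (intro ballI impI, erule adapted_frame_elim, erule adapted_frame.nondegenerate_frame) auto
  show "OmegaM M \<and>\<^sub>f omegaM M =\<^sub>S 0"
    unfolding eq_forms_restr wedge_emul
    by (rule ballI, erule adapted_frame_elim, drule adapted_frame.Omega_wedge_omega) (simp add: restr_linear)
  show "OmegaM M \<and>\<^sub>f cnj_form (OmegaM M) =\<^sub>S (\<lambda>_. 2 ^ 3 / fact 3 * (- \<i>) ^ 9) *\<^sub>f (omegaM M \<and>\<^sub>f omegaM M \<and>\<^sub>f omegaM M)"
    unfolding eq_forms_restr wedge_emul cnj_form_conj_ext scale_form_scl restr_linear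
    by (rule ballI, erule adapted_frame_elim, erule adapted_frame.Omega_wedge_conj)
qed (intro smooth_OmegaM basic_forms decomposable_OmegaM smooth_omegaM)+

text \<open>
  Each condition is either pointwise, and then read off in an adapted frame, or a statement on
  smoothness and invariance.
\<close>

lemma torsion_classes_OmegaM:
  "torsion_classes (OmegaM M) (omegaM M) (W1M M) (W2M M) (W3M M) (- Re_form \<eta>) (W5M M)"
  unfolding torsion_classes_def CP3_form_def CP3_function_def
proof (intro conjI)
  show "\<forall>z\<in>S7. \<forall>c. cmod c = 1 \<longrightarrow> W1M M (c *s z) = W1M M z" using W1_rotate by blast
  show "of_type (OmegaM M) {(1, 1)} (W2M M)"
    unfolding of_type_def by (intro ballI allI impI, erule adapted_frame_elim, erule adapted_frame.type_W2)
  show "of_type (OmegaM M) {(1, 2), (2, 1)} (W3M M)"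
    unfolding of_type_def by (intro ballI allI impI, erule adapted_frame_elim, erule adapted_frame.type_W3)
  show "of_type (OmegaM M) {(1, 0)} (W5M M)"
    unfolding of_type_def by (intro ballI allI impI, erule adapted_frame_elim, erule adapted_frame.type_W5)
  show "primitive (omegaM M) 2 (W2M M)"
    unfolding primitive_def eq_forms_restr
    by (rule ballI, erule adapted_frame_elim, drule adapted_frame.primitive_W2) (simp add: restr_linear wedge_emul numeral_2_eq_2)
  show "primitive (omegaM M) 3 (W3M M)"
    unfolding primitive_def eq_forms_restr
    by (rule ballI, erule adapted_frame_elim, drule adapted_frame.primitive_W3) (simp add: restr_linear wedge_emul)
  show "real_form (W3M M)"
    unfolding real_form_def eq_forms_restr
    by (rule ballI, erule adapted_frame_elim, drule adapted_frame.conj_W3) (simp add: cnj_form_conj_ext conj_restr)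
  show "real_form (- Re_form \<eta>)"
    unfolding real_form_def eq_forms_restr by (simp add: cnj_form_conj_ext Re_form_eta conj_ext_linear conj_ext_cov rho_def[abs_def])
  show s4: "smooth_form_on S0 1 (- Re_form \<eta>)"
    by (intro smooth_form_on_uminus smooth_form_on_Re open_punctured smooth_eta)
  show "of_type (OmegaM M) {(1, 0), (0, 1)} (- Re_form \<eta>)"
    unfolding of_type_def
  proof (intro ballI allI impI)
    fix z and us vs :: "((complex^4) \<times> (complex^4)) list" assume z: "z \<in> S7" and l: "(length us, length vs) \<notin> {(1, 0), (0, 1)}"
    have "alt_form 1 ((- Re_form \<eta>) z)" using s4 S7_nonzero[OF z] by (simp add: smooth_form_on_def)
    then have "homog 1 ((- Re_form \<eta>) z)" by (simp only: alt_form_iff)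
    moreover have "length (us @ vs) \<noteq> 1" using l by (cases us; cases vs) auto
    ultimately show "complexify ((- Re_form \<eta>) z) (us @ vs) = 0" by (rule homog_complexify)
  qed
  show "ext_d (omegaM M) =\<^sub>S (\<lambda>_. 3 / 2) *\<^sub>f Im_form ((\<lambda>z. cnj (W1M M z)) *\<^sub>f OmegaM M)
      + - Re_form \<eta> \<and>\<^sub>f omegaM M + W3M M"
    unfolding eq_forms_restr
  proof
    fix z assume "z \<in> S7"
    then obtain f1 f2 f3 where "adapted_frame M z f1 f2 f3" by (rule adapted_frame_exists)
    then interpret adapted_frame M z f1 f2 f3 .
    have "Im_form ((\<lambda>z. cnj (W1M M z)) *\<^sub>f OmegaM M) z = (\<lambda>vs. of_real (Im (cnj (W1M M z) * OmegaM M z vs)))"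
      by (simp add: Im_form_def scale_form_def fun_eq_iff)
    then show "restr (tangent z) (ext_d (omegaM M) z) = restr (tangent z) (((\<lambda>_. 3 / 2) *\<^sub>f Im_form ((\<lambda>z. cnj (W1M M z)) *\<^sub>f OmegaM M)
      + - Re_form \<eta> \<and>\<^sub>f omegaM M + W3M M) z)"
      unfolding torsion_domega by (simp only: plus_fun_apply scale_form_scl wedge_emul uminus_apply Re_form_eta emul_minus_left diff_conv_add_uminus)
  qed
  show "ext_d (OmegaM M) =\<^sub>S W1M M *\<^sub>f (omegaM M \<and>\<^sub>f omegaM M) + W2M M \<and>\<^sub>f omegaM M + cnj_form (W5M M) \<and>\<^sub>f OmegaM M"
    unfolding eq_forms_restr
    by (rule ballI, erule adapted_frame_elim, drule adapted_frame.torsion_dOmega)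
      (simp add: scale_form_scl wedge_emul cnj_form_conj_ext)
qed (intro SU3_OmegaM smooth_W1 smooth_W2 smooth_W3 smooth_W5 basic_forms)+

end

section \<open>Uniqueness of the torsion classes\<close>

lemma emul_2_2:
  assumes "homog 2 \<beta>" "homog 2 \<gamma>"
  shows "(\<beta> \<odot> \<gamma>) [a, b, c, d] = \<beta> [a, b] * \<gamma> [c, d] - \<beta> [a, c] * \<gamma> [b, d] + \<beta> [a, d] * \<gamma> [b, c]
    + \<beta> [b, c] * \<gamma> [a, d] - \<beta> [b, d] * \<gamma> [a, c] + \<beta> [c, d] * \<gamma> [a, b]"
  using assms by (simp add: emul_def parity_def interior_def homog_def)

lemma emul_1_4:
  "(cov p \<odot> \<beta>) [a, b, c, d, f] = p a * \<beta> [b, c, d, f] - p b * \<beta> [a, c, d, f] + p c * \<beta> [a, b, d, f]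
    - p d * \<beta> [a, b, c, f] + p f * \<beta> [a, b, c, d]"
  by (subst cov_emul_value) (simp add: cov_emul_values interior_def)

lemma torsion_classesD:
  assumes "torsion_classes \<Omega> \<omega> W\<^sub>1 W\<^sub>2 W\<^sub>3 W\<^sub>4 W\<^sub>5"
  shows "smooth_form_on (- {0}) 2 W\<^sub>2" "smooth_form_on (- {0}) 3 W\<^sub>3" "smooth_form_on (- {0}) 1 W\<^sub>4" "smooth_form_on (- {0}) 1 W\<^sub>5"
    "basic W\<^sub>2" "basic W\<^sub>4" "basic W\<^sub>5"
    "of_type \<Omega> {(1, 1)} W\<^sub>2" "of_type \<Omega> {(1, 2), (2, 1)} W\<^sub>3" "of_type \<Omega> {(1, 0)} W\<^sub>5" "primitive \<omega> 3 W\<^sub>3"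
    "ext_d \<omega> =\<^sub>S (\<lambda>_. 3 / 2) *\<^sub>f Im_form ((\<lambda>z. cnj (W\<^sub>1 z)) *\<^sub>f \<Omega>) + W\<^sub>4 \<and>\<^sub>f \<omega> + W\<^sub>3"
    "ext_d \<Omega> =\<^sub>S W\<^sub>1 *\<^sub>f (\<omega> \<and>\<^sub>f \<omega>) + W\<^sub>2 \<and>\<^sub>f \<omega> + cnj_form W\<^sub>5 \<and>\<^sub>f \<Omega>"
  using assms unfolding torsion_classes_def CP3_form_def by (simp_all only: simp_thms)

context adapted_frame begin

text \<open>
  The complex basis dual to \<open>P1, P2, P3, Q1, Q2, Q3\<close>. The signs of \<open>E1\<close> and \<open>F1\<close> are exchanged
  because \<open>P1\<close> is antilinear.
\<close>

definition "E1 = ((1 / 2) *\<^sub>R f1, (1 / 2) *\<^sub>R (\<i> *s f1))"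
definition "E2 = ((1 / 2) *\<^sub>R f2, (- 1 / 2) *\<^sub>R (\<i> *s f2))"
definition "E3 = ((1 / 2) *\<^sub>R f3, (- 1 / 2) *\<^sub>R (\<i> *s f3))"
definition "F1 = ((1 / 2) *\<^sub>R f1, (- 1 / 2) *\<^sub>R (\<i> *s f1))"
definition "F2 = ((1 / 2) *\<^sub>R f2, (1 / 2) *\<^sub>R (\<i> *s f2))"
definition "F3 = ((1 / 2) *\<^sub>R f3, (1 / 2) *\<^sub>R (\<i> *s f3))"

abbreviation "EF \<equiv> {E1, E2, E3, F1, F2, F3}"

lemmas EF_defs = E1_def E2_def E3_def F1_def F2_def F3_def

lemma scaled_horizontal: "v \<in> horizontal z \<Longrightarrow> r *\<^sub>R v \<in> horizontal z"
  by (simp add: horizontal_iff herm_linear)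

lemma minus_herm: "herm u (- y) = - herm u y"
  using herm_linear(2)[of u "-1" y] by simp

lemma minus_horizontal: "- v \<in> horizontal z \<longleftrightarrow> v \<in> horizontal z"
  by (simp add: horizontal_iff minus_herm)

lemma cx_vals:
  "cx P1 E1 = 1" "cx P1 F1 = 0" "cx Q1 E1 = 0" "cx Q1 F1 = 1"
  "cx P1 E2 = 0" "cx P1 F2 = 0" "cx Q1 E2 = 0" "cx Q1 F2 = 0"
  "cx P1 E3 = 0" "cx P1 F3 = 0" "cx Q1 E3 = 0" "cx Q1 F3 = 0"
  "cx P2 E1 = 0" "cx P2 F1 = 0" "cx Q2 E1 = 0" "cx Q2 F1 = 0"
  "cx P2 E2 = 1" "cx P2 F2 = 0" "cx Q2 E2 = 0" "cx Q2 F2 = 1"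
  "cx P2 E3 = 0" "cx P2 F3 = 0" "cx Q2 E3 = 0" "cx Q2 F3 = 0"
  "cx P3 E1 = 0" "cx P3 F1 = 0" "cx Q3 E1 = 0" "cx Q3 F1 = 0"
  "cx P3 E2 = 0" "cx P3 F2 = 0" "cx Q3 E2 = 0" "cx Q3 F2 = 0"
  "cx P3 E3 = 1" "cx P3 F3 = 0" "cx Q3 E3 = 0" "cx Q3 F3 = 1"
  by (simp_all add: cx_def EF_defs frame_values scaled_horizontal frame_horizontal minus_horizontal minus_herm herm_linear orthonormal orthonormal_more)

lemma T01I:
  assumes "x \<in> horizontal z" "y \<in> horizontal z"
    "P1 [x] + \<i> * P1 [y] = 0" "P2 [x] + \<i> * P2 [y] = 0" "P3 [x] + \<i> * P3 [y] = 0"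
  shows "(x, y) \<in> T01 (OmegaM M) z"
proof -
  have "OmegaM M z (x # vs) + \<i> * OmegaM M z (y # vs) = 0" if vs: "set vs \<subseteq> horizontal z" for vs
  proof (cases "length vs = 2")
    case True
    then obtain u v where v: "vs = [u, v]" by (rule length_2_obtain)
    have "P1 [x] = - \<i> * P1 [y]" "P2 [x] = - \<i> * P2 [y]" "P3 [x] = - \<i> * P3 [y]"
      using assms(3-5) by (simp_all add: add_eq_0_iff)
    then show ?thesis using vs assms(1,2) by (simp add: v Omega_value algebra_simps)
  next
    case False
    have "alt_form 3 (OmegaM M z)" using smooth_OmegaM z_nonzero by (simp add: smooth_form_on_def)
    then show ?thesis using False by (simp add: alt_form_iff homog_def)
  qed
  then show ?thesis using assms(1,2) by (simp add: T01_def)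
qed

lemma EF_type: "F1 \<in> T01 (OmegaM M) z" "F2 \<in> T01 (OmegaM M) z" "F3 \<in> T01 (OmegaM M) z"
  "E1 \<in> T10 (OmegaM M) z" "E2 \<in> T10 (OmegaM M) z" "E3 \<in> T10 (OmegaM M) z"
proof -
  show F: "F1 \<in> T01 (OmegaM M) z" "F2 \<in> T01 (OmegaM M) z" "F3 \<in> T01 (OmegaM M) z"
    unfolding EF_defs by (rule T01I; simp add: frame_values scaled_horizontal frame_horizontal minus_horizontal minus_herm herm_linear orthonormal orthonormal_more)+
  show "E1 \<in> T10 (OmegaM M) z" "E2 \<in> T10 (OmegaM M) z" "E3 \<in> T10 (OmegaM M) z"
    using F by (simp_all add: EF_defs T10_def)
qed

lemma EF_tangent: "set [E1, E2, E3, F1, F2, F3] \<subseteq> tangent z \<times> tangent z"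
  using horizontal_tangent by (simp add: EF_defs scaled_horizontal frame_horizontal minus_horizontal)

lemma complexify_cong_R:
  assumes "R \<beta> = R \<gamma>" "set ws \<subseteq> EF"
  shows "complexify \<beta> ws = complexify \<gamma> ws"
proof -
  have "set ws \<subseteq> tangent z \<times> tangent z" using assms(2) EF_tangent by auto
  then show ?thesis using complexify_restr[of ws "tangent z"] assms(1) by metis
qed

definition "cfun p = (\<lambda>(x, y). p x + \<i> * p y)" for p :: "complex^4 \<Rightarrow> complex"

text \<open>
  The complex frame spans the complexification of the horizontal vectors, and \<open>iz\<close> is the only
  further tangent direction.
\<close>

lemma linear_zero_on_tangent:
  assumes p: "linear p" and iz: "p (\<i> *s z) = 0"
    and 0: "cfun p E1 = 0" "cfun p E2 = 0" "cfun p E3 = 0" "cfun p F1 = 0" "cfun p F2 = 0" "cfun p F3 = 0"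
    and v: "v \<in> tangent z"
  shows "p v = 0"
proof -
  have sc: "p (r *\<^sub>R w) = of_real r * p w" for r w
    using linear_scale[OF p] by (simp add: scaleR_complex)
  have half: "p w = 0 \<and> p (\<i> *s w) = 0"
    if "cfun p ((1 / 2) *\<^sub>R w, (1 / 2) *\<^sub>R (\<i> *s w)) = 0" "cfun p ((1 / 2) *\<^sub>R w, (- 1 / 2) *\<^sub>R (\<i> *s w)) = 0" for w
  proof -
    have 1: "p w + \<i> * p (\<i> *s w) = 0" using arg_cong[OF that(1), of "\<lambda>x. 2 * x"] by (simp add: cfun_def sc algebra_simps)
    have 2: "p w - \<i> * p (\<i> *s w) = 0" using arg_cong[OF that(2), of "\<lambda>x. 2 * x"] by (simp add: cfun_def sc linear_neg[OF p] algebra_simps)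
    have "p w = 0" using 1 2 by algebra
    then show ?thesis using 1 by simp
  qed
  have h: "p f1 = 0" "p (\<i> *s f1) = 0" "p f2 = 0" "p (\<i> *s f2) = 0" "p f3 = 0" "p (\<i> *s f3) = 0"
    using half[of f1] half[of f2] half[of f3] 0 by (auto simp: EF_defs)
  have c: "c *s w = Re c *\<^sub>R w + Im c *\<^sub>R (\<i> *s w)" for c w
    by (simp add: vec_eq_iff scaleR_complex complex_eq_iff algebra_simps)
  have pc: "p (c *s w) = of_real (Re c) * p w + of_real (Im c) * p (\<i> *s w)" for c w
    by (subst c) (simp add: linear_add[OF p] sc)
  have "p (herm z v *s z + herm f1 v *s f1 + herm f2 v *s f2 + herm f3 v *s f3) = 0"
    using v unfolding linear_add[OF p] pc[of "herm z v"] pc[of "herm f1 v"] pc[of "herm f2 v"] pc[of "herm f3 v"] h iz tangent_iff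
    by simp
  then show ?thesis unfolding expansion[symmetric] .
qed

lemma alt_form_linear_arg: "alt_form k \<beta> \<Longrightarrow> linear (\<lambda>v. \<beta> (us @ v # vs))"
  by (simp add: alt_form_iff multilin_def)

lemma one_form_zero_on_tangent:
  assumes a: "alt_form 1 \<beta>" and iz: "\<beta> [\<i> *s z] = 0"
    and 0: "\<And>X. X \<in> EF \<Longrightarrow> complexify \<beta> [X] = 0"
  shows "R \<beta> = 0"
proof -
  have c: "complexify \<beta> [X] = cfun (\<lambda>v. \<beta> [v]) X" for X by (cases X) (simp add: cfun_def)
  have "\<beta> [v] = 0" if "v \<in> tangent z" for v
    by (rule linear_zero_on_tangent[OF alt_form_linear_arg[OF a, of "[]" "[]", simplified]])
      (use 0 iz that in \<open>auto simp: c\<close>)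
  then have "R \<beta> vs = 0" for vs
  proof (cases "length vs = 1")
    case True
    then obtain v where "vs = [v]" by (rule length_1_obtain)
    then show ?thesis using \<open>\<And>v. v \<in> tangent z \<Longrightarrow> \<beta> [v] = 0\<close> by (simp add: restr_def)
  next
    case False
    then show ?thesis using a by (simp add: restr_def alt_form_iff homog_def)
  qed
  then show ?thesis by (simp add: fun_eq_iff)
qed

lemma alt_form_2_swap: "alt_form 2 \<beta> \<Longrightarrow> \<beta> [u, v] = - \<beta> [v, u]"
  using alternating_swap[of \<beta> "[]" u v "[]"] by (simp add: alt_form_iff)

lemma two_form_zero_on_tangent:
  assumes a: "alt_form 2 \<beta>" and iz: "\<And>v. v \<in> tangent z \<Longrightarrow> \<beta> [\<i> *s z, v] = 0"
    and 0: "\<And>X Y. X \<in> EF \<Longrightarrow> Y \<in> EF \<Longrightarrow> complexify \<beta> [X, Y] = 0"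
  shows "R \<beta> = 0"
proof -
  let ?S = "EF"
  have 1: "cfun (\<lambda>y. \<beta> [v, y]) Y = 0" if v: "v \<in> tangent z" and Y: "Y \<in> ?S" for v Y
  proof -
    have l: "linear (\<lambda>x. cfun (\<lambda>y. \<beta> [x, y]) Y)"
      using alt_form_linear_arg[OF a, of "[]" "[_]"]
      by (cases Y) (auto simp: cfun_def intro!: linear_compose_add linear_const_mult)
    have t: "fst Y \<in> tangent z" "snd Y \<in> tangent z" using Y EF_tangent by (auto simp: mem_Times_iff)
    have c: "cfun (\<lambda>x. cfun (\<lambda>y. \<beta> [x, y]) Y) X = 0" if "X \<in> ?S" for X
      using 0[OF that Y] by (cases X; cases Y) (simp add: cfun_def)
    show ?thesis
      by (rule linear_zero_on_tangent[OF l _ c c c c c c v]) (use iz t in \<open>auto simp: cfun_def split_beta\<close>)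
  qed
  have 2: "\<beta> [v, y] = 0" if v: "v \<in> tangent z" and y: "y \<in> tangent z" for v y
  proof -
    have l: "linear (\<lambda>y. \<beta> [v, y])" using alt_form_linear_arg[OF a, of "[v]" "[]"] by simp
    have iz': "\<beta> [v, \<i> *s z] = 0" using iz[OF v] alt_form_2_swap[OF a, of v] by simp
    show ?thesis by (rule linear_zero_on_tangent[OF l iz' 1 1 1 1 1 1 y]) (use v in auto)
  qed
  have "R \<beta> vs = 0" for vs
  proof (cases "length vs = 2")
    case True
    then obtain u v where "vs = [u, v]" by (rule length_2_obtain)
    then show ?thesis using 2 by (simp add: restr_def)
  next
    case False
    then show ?thesis using a by (simp add: restr_def alt_form_iff homog_def)
  qed
  then show ?thesis by (simp add: fun_eq_iff)
qed

lemma cx_omega: "complexify (R (omegaM M z)) [X, Y] = \<i> / 2 * (cx P1 X * cx Q1 Y - cx P1 Y * cx Q1 X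
   + (cx P2 X * cx Q2 Y - cx P2 Y * cx Q2 X) + (cx P3 X * cx Q3 Y - cx P3 Y * cx Q3 X))"
  unfolding R_omega complexify_linear complexify_emul complexify_P
  by (simp add: scl_def cov_emul_cov mult.commute)

lemma cx_Omega: "complexify (R (OmegaM M z)) = cov (cx P1) \<odot> cov (cx P2) \<odot> cov (cx P3)"
  unfolding R_Omega complexify_linear complexify_emul complexify_P ..

lemma homog_complexify_form: "homog k \<beta> \<Longrightarrow> homog k (complexify \<beta>)"
  using homog_complexify by (auto simp: homog_def[of k "complexify \<beta>"])

lemma homog_restr: "homog k \<beta> \<Longrightarrow> homog k (restr T \<beta>)"
  by (auto simp: homog_def restr_def)

lemma homog_omega: "homog 2 (complexify (R (omegaM M z)))"
  using smooth_omegaM z_nonzero by (intro homog_complexify_form homog_restr) (simp add: smooth_form_on_def alt_form_iff)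

text \<open>
  The form \<open>\<beta> \<and> \<omega>\<^sup>2\<close>, evaluated on a frame vector and the two frame planes that do not contain it, is
  a nonzero multiple of \<open>\<beta>\<close> on this vector.
\<close>

lemma omega_omega_one_form:
  assumes h: "homog 1 \<beta>" and 0: "R (omegaM M z \<odot> \<beta> \<odot> omegaM M z) = 0" and X: "X \<in> EF"
  shows "complexify (R \<beta>) [X] = 0"
proof -
  have h': "homog (Suc 0) (complexify (R \<beta>))" using homog_complexify_form[OF homog_restr[OF h]] by simp
  define d where "d X = complexify (R \<beta>) [X]" for X
  have d: "complexify (R \<beta>) = cov d" by (rule homog1_eqI[OF h']) (simp add: d_def)
  let ?w = "complexify (R (omegaM M z))"
  have "cov d \<odot> ?w \<odot> ?w = complexify (R (omegaM M z \<odot> \<beta> \<odot> omegaM M z))"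
    unfolding restr_emul complexify_emul d emul_assoc[symmetric] cov_commute_even[OF homog_omega] ..
  also have "\<dots> = (\<lambda>_. 0)" unfolding 0 by (rule ext) (simp add: zero_fun_def complexify_zero)
  finally have z: "(cov d \<odot> ?w \<odot> ?w) ws = 0" for ws by simp
  have "d E1 = 0" "d F1 = 0" "d E2 = 0" "d F2 = 0" "d E3 = 0" "d F3 = 0"
    using z[of "[E1, E2, F2, E3, F3]"] z[of "[F1, E2, F2, E3, F3]"] z[of "[E2, E1, F1, E3, F3]"] z[of "[F2, E1, F1, E3, F3]"]
      z[of "[E3, E1, F1, E2, F2]"] z[of "[F3, E1, F1, E2, F2]"]
    by (simp_all add: emul_1_4 emul_2_2[OF homog_omega homog_omega] cx_omega cx_vals)
  then show ?thesis using X by (auto simp: d_def)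
qed

text \<open>
  The map \<open>\<beta> \<mapsto> \<beta> \<and> \<omega>\<close> is injective. An off-diagonal coefficient is isolated by inserting the remaining frame
  plane; the sums of any two diagonal coefficients vanish, hence so do the coefficients.
\<close>

lemma two_form_omega:
  assumes a: "alt_form 2 \<beta>" and 0: "R (\<beta> \<odot> omegaM M z) = 0" and iz: "\<And>v. v \<in> tangent z \<Longrightarrow> \<beta> [\<i> *s z, v] = 0"
    and t: "\<And>X Y. X \<in> {E1, E2, E3} \<Longrightarrow> Y \<in> {E1, E2, E3} \<Longrightarrow> complexify (R \<beta>) [X, Y] = 0"
      "\<And>X Y. X \<in> {F1, F2, F3} \<Longrightarrow> Y \<in> {F1, F2, F3} \<Longrightarrow> complexify (R \<beta>) [X, Y] = 0"
  shows "R \<beta> = 0"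
proof -
  let ?w = "complexify (R (omegaM M z))" and ?D = "complexify (R \<beta>)"
  have h: "homog 2 ?D" using a by (intro homog_complexify_form homog_restr) (simp add: alt_form_iff)
  have "?D \<odot> ?w = (\<lambda>_. 0)"
    unfolding complexify_emul[symmetric] restr_emul[symmetric] 0 by (rule ext) (simp add: zero_fun_def complexify_zero)
  then have z: "(?D \<odot> ?w) ws = 0" for ws by simp
  have sw: "?D [X, Y] = - ?D [Y, X]" for X Y
  proof -
    obtain x y u v where XY: "X = (x, y)" "Y = (u, v)" by (cases X; cases Y) auto
    have s: "R \<beta> [u, v] = - R \<beta> [v, u]" for u v
      using alt_form_2_swap[OF a, of u v] by (simp add: restr_def insert_commute)
    show ?thesis by (simp add: XY s[of u x] s[of v x] s[of u y] s[of v y] algebra_simps)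
  qed
  have off: "?D [E1, F2] = 0" "?D [E1, F3] = 0" "?D [E2, F1] = 0" "?D [E2, F3] = 0" "?D [E3, F1] = 0" "?D [E3, F2] = 0"
    using z[of "[E1, F2, E3, F3]"] z[of "[E1, F3, E2, F2]"] z[of "[E2, F1, E3, F3]"] z[of "[E2, F3, E1, F1]"] z[of "[E3, F1, E2, F2]"] z[of "[E3, F2, E1, F1]"]
    by (simp_all add: emul_2_2[OF h homog_omega] cx_omega cx_vals)
  have "\<i> / 2 * (?D [E1, F1] + ?D [E2, F2]) = 0" "\<i> / 2 * (?D [E1, F1] + ?D [E3, F3]) = 0" "\<i> / 2 * (?D [E2, F2] + ?D [E3, F3]) = 0"
    using z[of "[E1, F1, E2, F2]"] z[of "[E1, F1, E3, F3]"] z[of "[E2, F2, E3, F3]"]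
    unfolding emul_2_2[OF h homog_omega] cx_omega cx_vals by (simp_all add: distrib_left mult.commute)
  then have "?D [E1, F1] + ?D [E2, F2] = 0" "?D [E1, F1] + ?D [E3, F3] = 0" "?D [E2, F2] + ?D [E3, F3] = 0"
    by (simp_all only: mult_eq_0_iff divide_eq_0_iff) simp_all
  then have diag: "?D [E1, F1] = 0" "?D [E2, F2] = 0" "?D [E3, F3] = 0"
    by algebra+
  have EF: "?D [X, Y] = 0" if "X \<in> {E1, E2, E3}" "Y \<in> {F1, F2, F3}" for X Y
    using that by (elim insertE emptyE) (simp_all only: off diag)
  have FE: "?D [X, Y] = 0" if "X \<in> {F1, F2, F3}" "Y \<in> {E1, E2, E3}" for X Y
    by (subst sw) (simp only: EF[OF that(2,1)] neg_equal_zero neg_0_equal_iff_equal minus_zero)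
  have "?D [X, Y] = 0" if "X \<in> EF" "Y \<in> EF" for X Y
  proof -
    have "X \<in> {E1, E2, E3} \<or> X \<in> {F1, F2, F3}" "Y \<in> {E1, E2, E3} \<or> Y \<in> {F1, F2, F3}"
      using that by blast+
    then show ?thesis using t EF FE by metis
  qed
  moreover have "complexify \<beta> [X, Y] = ?D [X, Y]" if "X \<in> EF" "Y \<in> EF" for X Y
    by (rule complexify_cong_R) (use that in \<open>auto simp: restr_def fun_eq_iff\<close>)
  ultimately show ?thesis by (intro two_form_zero_on_tangent[OF a iz]) auto
qed

lemma complexify_conj: "complexify (conj_ext \<beta>) [(x, y)] = cnj (complexify \<beta> [(x, - y)])" if "alt_form 1 \<beta>"
proof -
  have "\<beta> [- y] = - \<beta> [y]" using linear_neg[OF alt_form_linear_arg[OF that, of "[]" "[]"]] by simp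
  then show ?thesis by (simp add: conj_ext_def)
qed

lemma cx_Omega_123: "complexify (R (OmegaM M z)) [E1, E2, E3] = 1"
  by (simp add: cx_Omega cov_emul_values cov_values cx_vals)

lemma one_form_cov: "homog 1 \<beta> \<Longrightarrow> \<exists>p. complexify (R \<beta>) = cov p"
proof -
  assume "homog 1 \<beta>"
  then have "homog (Suc 0) (complexify (R \<beta>))"
    using homog_complexify_form[OF homog_restr[of 1 \<beta> "tangent z"]] by simp
  then have "complexify (R \<beta>) = cov (\<lambda>X. complexify (R \<beta>) [X])" by (rule homog1_eqI) simp
  then show "\<exists>p. complexify (R \<beta>) = cov p" by (intro exI[of _ "\<lambda>X. complexify (R \<beta>) [X]"])
qed

text \<open>
  Only the differences of two systems of torsion classes matter. The \<open>(3,0)\<close>-part of the equation for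
  \<open>d\<omega>\<close> gives \<open>W\<^sub>1\<close>. Multiplying the rest by \<open>\<omega>\<close> removes the primitive \<open>W\<^sub>3\<close> and gives \<open>W\<^sub>4\<close>, hence \<open>W\<^sub>3\<close>. In the
  equation for \<open>d\<Omega>\<close> the term with \<open>W\<^sub>2\<close> is of type \<open>(2,2)\<close> and that with \<open>W\<^sub>5\<close> of type \<open>(3,1)\<close>, which
  separates them.
\<close>

lemma torsion_unique_at:
  assumes W: "torsion_classes (OmegaM M) (omegaM M) W\<^sub>1 W\<^sub>2 W\<^sub>3 W\<^sub>4 W\<^sub>5"
    and V: "torsion_classes (OmegaM M) (omegaM M) V\<^sub>1 V\<^sub>2 V\<^sub>3 V\<^sub>4 V\<^sub>5"
  shows "W\<^sub>1 z = V\<^sub>1 z" "R (W\<^sub>4 z) = R (V\<^sub>4 z)" "R (W\<^sub>3 z) = R (V\<^sub>3 z)" "R (W\<^sub>5 z) = R (V\<^sub>5 z)" "R (W\<^sub>2 z) = R (V\<^sub>2 z)"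
proof -
  have zS: "z \<in> S7" using z by simp
  note wd = torsion_classesD[OF W] and vd = torsion_classesD[OF V]
  note smooth = wd(1-4) vd(1-4) and basic = wd(5-7) vd(5-7) and types = wd(8-10) vd(8-10)
    and prim = wd(11) vd(11) and eqs = wd(12) vd(12) wd(13) vd(13)
  note eqs_at = bspec[OF iffD1[OF eq_forms_restr] zS]
  have iz: "\<i> *s z \<in> tangent z" by (simp add: tangent_iff herm_linear orthonormal_more)
  let ?O = "OmegaM M z" and ?w = "omegaM M z"
  define D2 where "D2 = W\<^sub>2 z - V\<^sub>2 z"
  define D3 where "D3 = W\<^sub>3 z - V\<^sub>3 z"
  define D4 where "D4 = W\<^sub>4 z - V\<^sub>4 z"
  define D5 where "D5 = W\<^sub>5 z - V\<^sub>5 z"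
  have alt: "alt_form 2 D2" "alt_form 3 D3" "alt_form 1 D4" "alt_form 1 D5"
    using smooth z_nonzero by (auto simp: D2_def D3_def D4_def D5_def smooth_form_on_def intro!: alt_form_linear)
  have b: "\<beta> z (\<i> *s z # vs) = 0" if "basic \<beta>" "set vs \<subseteq> tangent z" for \<beta> vs
    using that zS by (auto simp: basic_def)
  have kill: "D4 [\<i> *s z] = 0" "D5 [\<i> *s z] = 0" "v \<in> tangent z \<Longrightarrow> D2 [\<i> *s z, v] = 0" for v
    using basic by (auto simp: D2_def D4_def D5_def b)
  have type: "complexify (\<beta> z) (us @ vs) = 0"
    if "of_type (OmegaM M) P \<beta>" "set us \<subseteq> T10 (OmegaM M) z" "set vs \<subseteq> T01 (OmegaM M) z" "(length us, length vs) \<notin> P" for P \<beta> us vs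
    using that zS by (auto simp: of_type_def)
  have t3: "complexify (W\<^sub>3 z) [E1, E2, E3] = 0" "complexify (V\<^sub>3 z) [E1, E2, E3] = 0"
    using type[of "{(1, 2), (2, 1)}" _ "[E1, E2, E3]" "[]"] types EF_type by auto
  have t2: "complexify (W\<^sub>2 z) [X, Y] = 0 \<and> complexify (V\<^sub>2 z) [X, Y] = 0" if "X \<in> {E1, E2, E3}" "Y \<in> {E1, E2, E3}" for X Y
    using type[of "{(1, 1)}" _ "[X, Y]" "[]"] types EF_type that by auto
  have t2': "complexify (W\<^sub>2 z) [X, Y] = 0 \<and> complexify (V\<^sub>2 z) [X, Y] = 0" if "X \<in> {F1, F2, F3}" "Y \<in> {F1, F2, F3}" for X Y
    using type[of "{(1, 1)}" _ "[]" "[X, Y]"] types EF_type that by auto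
  have t5: "complexify (W\<^sub>5 z) [X] = 0 \<and> complexify (V\<^sub>5 z) [X] = 0" if "X \<in> {F1, F2, F3}" for X
    using type[of "{(1, 0)}" _ "[]" "[X]"] types EF_type that by auto
  have rr: "R (R \<beta>) = R \<beta>" for \<beta> by (auto simp: restr_def fun_eq_iff)
  have cR: "complexify (R \<beta>) ws = complexify \<beta> ws" if "set ws \<subseteq> EF" for \<beta> ws
    by (rule complexify_cong_R[OF rr that])
  have cdiff: "complexify (R (\<beta> - \<gamma>)) ws = complexify \<beta> ws - complexify \<gamma> ws"
    if "set ws \<subseteq> EF" for \<beta> \<gamma> ws
    unfolding cR[OF that] complexify_linear by simp
  define d where "d = W\<^sub>1 z - V\<^sub>1 z"
  have im: "scl (3 / 2) (Im_form ((\<lambda>z. cnj (f z)) *\<^sub>f OmegaM M) z) = scl (- 3 * \<i> / 4) (scl (cnj (f z)) ?O - scl (f z) (conj_ext ?O))" for f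
  proof
    fix vs
    have "of_real (Im x) = - \<i> / 2 * (x - cnj x)" for x by (simp add: complex_eq_iff)
    note i = this[of "cnj (f z) * OmegaM M z vs"]
    show "scl (3 / 2) (Im_form ((\<lambda>z. cnj (f z)) *\<^sub>f OmegaM M) z) vs = scl (- 3 * \<i> / 4) (scl (cnj (f z)) ?O - scl (f z) (conj_ext ?O)) vs"
      unfolding scl_def Im_form_def scale_form_def i by (simp add: conj_ext_def scl_def field_simps)
  qed
  have dw: "R (ext_d (omegaM M) z) = R (scl (- 3 * \<i> / 4) (scl (cnj (W\<^sub>1 z)) ?O - scl (W\<^sub>1 z) (conj_ext ?O)) + W\<^sub>4 z \<odot> ?w + W\<^sub>3 z)"
    "R (ext_d (omegaM M) z) = R (scl (- 3 * \<i> / 4) (scl (cnj (V\<^sub>1 z)) ?O - scl (V\<^sub>1 z) (conj_ext ?O)) + V\<^sub>4 z \<odot> ?w + V\<^sub>3 z)"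
    using eqs_at[OF eqs(1)] eqs_at[OF eqs(2)] by (simp_all add: scale_form_scl wedge_emul im)
  have e1: "scl (- 3 * \<i> / 4) (scl (cnj d) (R ?O) - scl d (R (conj_ext ?O))) + R D4 \<odot> R ?w + R D3 = 0"
    using trans[OF dw(1)[symmetric] dw(2)] unfolding restr_linear restr_emul D4_def D3_def d_def emul_linear
    by (simp add: fun_eq_iff scl_def algebra_simps)
  have "complexify (scl (- 3 * \<i> / 4) (scl (cnj d) (R ?O) - scl d (R (conj_ext ?O))) + R D4 \<odot> R ?w + R D3) [E1, E2, E3] = 0"
    unfolding e1 by (simp add: complexify_zero zero_fun_def)
  moreover have "complexify (R (conj_ext ?O)) [E1, E2, E3] = 0"
    unfolding R_conj_Omega complexify_emul complexify_P by (simp add: cov_emul_values cov_values cx_vals)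
  moreover have "complexify (R D3) [E1, E2, E3] = 0" by (simp add: D3_def cdiff t3)
  moreover have "(complexify (R D4) \<odot> complexify (R ?w)) [E1, E2, E3] = 0"
  proof -
    obtain p where "complexify (R D4) = cov p" using one_form_cov alt(3) by (auto simp: alt_form_iff)
    then show ?thesis by (simp add: cov_emul_values cx_omega cx_vals)
  qed
  ultimately have "- 3 * \<i> / 4 * cnj d = 0"
    unfolding complexify_linear complexify_emul[symmetric] by (simp add: complexify_emul scl_def cx_Omega_123)
  then have d0: "d = 0" by simp
  then show W1: "W\<^sub>1 z = V\<^sub>1 z" by (simp add: d_def)
  have e2: "R D4 \<odot> R ?w + R D3 = 0" using e1 unfolding d0 by (simp add: scl_add)
  have "R (?w \<odot> W\<^sub>3 z) = 0" "R (?w \<odot> V\<^sub>3 z) = 0"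
    using eqs_at[OF prim(1)[unfolded primitive_def]] eqs_at[OF prim(2)[unfolded primitive_def]]
    by (simp_all add: wedge_emul restr_linear)
  then have "R ?w \<odot> R D3 = 0" by (simp add: D3_def restr_linear emul_linear restr_emul)
  then have "R ?w \<odot> (R D4 \<odot> R ?w) = 0"
    using arg_cong[OF e2, of "\<lambda>x. R ?w \<odot> x"] by (simp add: emul_linear)
  then have "R (?w \<odot> D4 \<odot> ?w) = 0" by (simp add: restr_emul)
  then have "complexify (R D4) [X] = 0" if "X \<in> EF" for X
    using omega_omega_one_form[OF _ _ that] alt(3) by (simp add: alt_form_iff)
  then have D4: "R D4 = 0"
    by (intro one_form_zero_on_tangent[OF alt(3) kill(1)]) (simp add: cR)
  then show "R (W\<^sub>4 z) = R (V\<^sub>4 z)" by (simp add: D4_def restr_linear)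
  have "R D3 = 0" using e2 by (simp add: D4 emul_linear)
  then show "R (W\<^sub>3 z) = R (V\<^sub>3 z)" by (simp add: D3_def restr_linear)
  have dO: "R (ext_d (OmegaM M) z) = R (scl (W\<^sub>1 z) (?w \<odot> ?w) + W\<^sub>2 z \<odot> ?w + conj_ext (W\<^sub>5 z) \<odot> ?O)"
    "R (ext_d (OmegaM M) z) = R (scl (V\<^sub>1 z) (?w \<odot> ?w) + V\<^sub>2 z \<odot> ?w + conj_ext (V\<^sub>5 z) \<odot> ?O)"
    using eqs_at[OF eqs(3)] eqs_at[OF eqs(4)] by (simp_all add: scale_form_scl wedge_emul cnj_form_conj_ext)
  have e3: "R D2 \<odot> R ?w + R (conj_ext D5) \<odot> R ?O = 0"
    using trans[OF dO(1)[symmetric] dO(2)] unfolding restr_linear restr_emul D2_def D5_def conj_ext_linear emul_linear W1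
    by (simp add: fun_eq_iff scl_def algebra_simps)
  have h2: "homog 2 (complexify (R D2))"
    using alt(1) by (intro homog_complexify_form homog_restr) (simp add: alt_form_iff)
  have a5: "alt_form 1 (conj_ext D5)"
    using alt_form_compose_linear[OF alt(4) bounded_linear.linear[OF bounded_linear_cnj]] by (simp add: conj_ext_def[abs_def])
  obtain q where q: "complexify (R (conj_ext D5)) = cov q" using one_form_cov a5 by (auto simp: alt_form_iff)
  have q_eq: "q X = complexify (R (conj_ext D5)) [X]" for X by (simp add: q cov_values)
  have D2E: "complexify (R D2) [X, Y] = 0" if "X \<in> {E1, E2, E3}" "Y \<in> {E1, E2, E3}" for X Y
    using t2[OF that] that by (auto simp: D2_def cdiff)
  have "complexify (R D2 \<odot> R ?w + R (conj_ext D5) \<odot> R ?O) ws = 0" for ws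
    unfolding e3 by (simp add: complexify_zero zero_fun_def)
  then have c3: "(complexify (R D2) \<odot> complexify (R ?w)) ws + (cov q \<odot> complexify (R ?O)) ws = 0" for ws
    by (simp add: complexify_linear complexify_emul q)
  \<comment> \<open>On three vectors of type \<open>(1,0)\<close> and one of type \<open>(0,1)\<close> the product of two \<open>(1,1)\<close>-forms vanishes.\<close>
  have qF: "q F1 = 0" "q F2 = 0" "q F3 = 0"
    using c3[of "[E1, E2, E3, F1]"] c3[of "[E1, E2, E3, F2]"] c3[of "[E1, E2, E3, F3]"]
    by (simp_all add: emul_2_2[OF h2 homog_omega] D2E cx_omega cx_Omega cx_vals cov_emul_values cov_values)
  have cE: "complexify (conj_ext D5) [E1] = cnj (complexify D5 [F1])" "complexify (conj_ext D5) [E2] = cnj (complexify D5 [F2])"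
    "complexify (conj_ext D5) [E3] = cnj (complexify D5 [F3])"
    unfolding EF_defs complexify_conj[OF alt(4)] by simp_all
  have "complexify D5 [X] = 0" if "X \<in> {F1, F2, F3}" for X
    using t5[OF that] unfolding D5_def complexify_linear by simp
  then have "complexify (conj_ext D5) [E1] = 0" "complexify (conj_ext D5) [E2] = 0" "complexify (conj_ext D5) [E3] = 0"
    unfolding cE by simp_all
  moreover have "complexify (conj_ext D5) [F1] = 0" "complexify (conj_ext D5) [F2] = 0" "complexify (conj_ext D5) [F3] = 0"
    using qF unfolding q_eq by (simp_all add: cR)
  ultimately have "complexify (conj_ext D5) [X] = 0" if "X \<in> EF" for X
    using that by (elim insertE emptyE) simp_all
  moreover have "conj_ext D5 [\<i> *s z] = 0" using kill by (simp add: conj_ext_def)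
  ultimately have c5: "R (conj_ext D5) = 0" by (rule one_form_zero_on_tangent[OF a5, rotated])
  then have "conj_ext (R (conj_ext D5)) = 0" by (simp add: conj_ext_linear)
  then have "R D5 = 0" by (simp add: conj_restr conj_ext_linear)
  then show "R (W\<^sub>5 z) = R (V\<^sub>5 z)" by (simp add: D5_def restr_linear)
  have D2w: "R (D2 \<odot> ?w) = 0" using e3 by (simp add: c5 emul_linear restr_emul)
  have D2F: "complexify (R D2) [X, Y] = 0" if "X \<in> {F1, F2, F3}" "Y \<in> {F1, F2, F3}" for X Y
    using t2'[OF that] that by (auto simp: D2_def cdiff)
  have "R D2 = 0" by (rule two_form_omega[OF alt(1) D2w kill(3) D2E D2F])
  then show "R (W\<^sub>2 z) = R (V\<^sub>2 z)" by (simp add: D2_def restr_linear)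
qed

end

section \<open>The function lambda\<close>

context invertible_skew begin

lemma interior_hatOmegaM_i: "interior (axis j \<i>) (hatOmegaM M z) = scl \<i> (interior (axis j 1) (hatOmegaM M z))"
proof
  fix vs
  have ax: "axis j \<i> = \<i> *s (axis j 1 :: complex^4)" by (simp add: vec_eq_iff axis_def)
  show "interior (axis j \<i>) (hatOmegaM M z) vs = scl \<i> (interior (axis j 1) (hatOmegaM M z)) vs"
  proof (cases "length vs = 1")
    case True
    then obtain v where "vs = [v]" by (rule length_1_obtain)
    then show ?thesis by (simp add: interior_def scl_def hatOmegaM_value ax det4_linear)
  next
    case False
    then show ?thesis using homog_hatOmegaM[of M z] by (simp add: interior_def scl_def homog_def)
  qed
qed

text \<open>
  The \<open>(0,1)\<close>-vector of the contraction annihilates \<open>\<Omega>hat\<close>, which is complex multilinear, and takes the value \<open>N\<close>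
  on the conjugate of \<open>\<alpha>\<close>.
\<close>

lemma contract_OmegaM:
  assumes z: "z \<noteq> 0" shows "contract \<alpha> (OmegaM M) z = hatOmegaM M z"
proof
  fix vs
  have v: "OmegaM M z (v # vs) = invn z * (cnj (m z v) * hatOmegaM M z vs - (ac z \<odot> interior v (hatOmegaM M z)) vs)" for v
    by (simp add: OmegaM_eq scl_def cov_emul_value)
  have c: "contr_dzbar j (OmegaM M) z vs = invn z * cnj (m z (axis j 1)) * hatOmegaM M z vs" for j
    unfolding contr_dzbar_def v interior_hatOmegaM_i emul_linear scl_def[of \<i>] mform_axis(2)[of M z j \<i>]
    by (simp add: field_simps)
  have "contract \<alpha> (OmegaM M) z vs = invn z * nsq z * hatOmegaM M z vs"
    unfolding contract_def contr_dz_alphaM c norm_sq_alphaM mform_sharp sum_distrib_left sum_distrib_right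
    by (simp add: ac_simps)
  then show "contract \<alpha> (OmegaM M) z vs = hatOmegaM M z vs" by (simp add: invn_nsq[OF z])
qed

lemma is_lambdaM_lambda: "is_lambdaM M lambda"
  unfolding is_lambdaM_def
proof
  show "smooth_on S0 lambda"
    unfolding lambda_def[abs_def] by (intro smooth_on_mult smooth_on_const open_punctured smooth_invn)
  show "ext_d \<alpha> =\<^sub>S lambda *\<^sub>f contract \<alpha> (OmegaM M) + \<alpha> \<and>\<^sub>f \<eta>"
    unfolding eq_forms_restr
    by (simp add: scale_form_scl wedge_emul contract_OmegaM S7_nonzero hatOmega_eq)
qed

lemma is_lambdaM_unique:
  assumes lam: "is_lambdaM M lam" and zS: "z \<in> S7"
  shows "lam z = lambda z"
proof -
  obtain f1 f2 f3 where "adapted_frame M z f1 f2 f3" by (rule adapted_frame_exists[OF zS])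
  then interpret adapted_frame M z f1 f2 f3 .
  have "ext_d \<alpha> =\<^sub>S lam *\<^sub>f contract \<alpha> (OmegaM M) + \<alpha> \<and>\<^sub>f \<eta>" using lam by (simp add: is_lambdaM_def)
  then have "R (ext_d \<alpha> z) = R ((lam *\<^sub>f contract \<alpha> (OmegaM M) + \<alpha> \<and>\<^sub>f \<eta>) z)"
    using zS unfolding eq_forms_restr by (rule bspec)
  then have "R (scl (lambda z) (hatOmegaM M z)) = R (scl (lam z) (hatOmegaM M z))"
    unfolding hatOmega_eq[OF z_nonzero] by (simp add: scale_form_scl wedge_emul contract_OmegaM z_nonzero restr_linear)
  then have "R (scl (lambda z) (hatOmegaM M z)) [f2, f3] = R (scl (lam z) (hatOmegaM M z)) [f2, f3]" by simp
  moreover have "hatOmegaM M z [f2, f3] = s" by (simp add: hatOmega_frame scl_def cov_emul_cov orthonormal orthonormal_more)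
  ultimately show ?thesis using s_nonzero frame_horizontal horizontal_tangent by (simp add: restr_def scl_def)
qed

section \<open>The Hermitian form and vanishing torsion\<close>

abbreviation "H \<equiv> conj_transpose M ** M"

text \<open>
  The identity \<open>N = z\<^sup>*(M\<^sup>*M)z\<close> in polarised form.
\<close>

lemma m_sharp_hermitian: "m v (b z) = herm (H *v z) v"
proof -
  have e: "m v (axis j 1) = - (\<Sum>i\<in>UNIV. M $ j $ i * v $ i)" for v j
    by (subst m_skew) (use exhaust_4[of j] in \<open>auto simp: mform_def axis_def sum_4\<close>)
  show ?thesis
    unfolding mform_sharp e
    by (simp add: sum_4 herm_def matrix_vector_mult_def matrix_matrix_mult_def conj_transpose_def algebra_simps)
qed

lemma rho_hermitian: "rho z v = - 2 * invn z * of_real ((H *v z) \<bullet> v)"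
  by (simp add: rho_nsq m_sharp_hermitian inner_herm)

text \<open>
  \<open>Re \<eta>\<close> vanishes on the tangent vectors at \<open>z\<close> iff \<open>M\<^sup>*M z\<close> is a real multiple of \<open>z\<close>. If this holds for all
  \<open>z\<close>, comparing the eigenvalues of \<open>e\<^sub>i\<close>, \<open>e\<^sub>j\<close> and \<open>e\<^sub>i + e\<^sub>j\<close> shows that there is only one eigenvalue.
\<close>

lemma scalar_if_rho_vanishes:
  assumes "\<And>z v. z \<in> S7 \<Longrightarrow> v \<in> tangent z \<Longrightarrow> rho z v = 0"
  shows "\<exists>\<mu>::real. H = mat (complex_of_real \<mu>)"
proof -
  have 1: "H *v z = (z \<bullet> (H *v z)) *\<^sub>R z" if z: "z \<in> S7" for z
  proof -
    let ?u = "H *v z"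
    \<comment> \<open>the component of \<open>?u\<close> tangent to the sphere\<close>
    let ?v = "?u - (z \<bullet> ?u) *\<^sub>R z"
    have zz: "z \<bullet> z = 1" using z by (simp add: power2_norm_eq_inner[symmetric])
    have t: "z \<bullet> ?v = 0" by (simp add: inner_diff_right zz)
    then have "rho z ?v = 0" using assms[OF z] by (simp add: tangent_def)
    moreover have "invn z \<noteq> 0" using nsq_nonzero[OF S7_nonzero[OF z]] by (simp add: invn_eq)
    ultimately have "?u \<bullet> ?v = 0" by (simp add: rho_hermitian)
    then have "?v \<bullet> ?v = 0" using t by (simp add: inner_diff_left)
    then show ?thesis by simp
  qed
  have 2: "\<exists>c. H *v z = c *\<^sub>R z" if z: "z \<noteq> 0" for z
  proof -
    have r: "H *v (r *\<^sub>R z) = r *\<^sub>R (H *v z)" for r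
      by (simp add: vec_eq_iff matrix_vector_mult_def scaleR_complex sum_distrib_left algebra_simps)
    have "(1 / norm z) *\<^sub>R z \<in> S7" using z by simp
    from 1[OF this] obtain c where "(1 / norm z) *\<^sub>R (H *v z) = c *\<^sub>R ((1 / norm z) *\<^sub>R z)"
      unfolding r by blast
    then have "norm z *\<^sub>R ((1 / norm z) *\<^sub>R (H *v z)) = norm z *\<^sub>R (c *\<^sub>R ((1 / norm z) *\<^sub>R z))" by simp
    then show ?thesis using z by (intro exI[of _ c]) simp
  qed
  have ax: "(H *v axis j 1) $ i = H $ i $ j" for i j
    by (simp add: matrix_vector_mult_def axis_def if_distrib cong: if_cong)
  have "\<exists>c. H *v axis j 1 = c *\<^sub>R axis j 1" for j by (rule 2) (simp add: axis_eq_0_iff)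
  then obtain c where c: "\<And>j. H *v axis j 1 = c j *\<^sub>R axis j 1" by metis
  have ent: "H $ i $ j = (if i = j then of_real (c j) else 0)" for i j
    unfolding ax[symmetric] c by (simp add: axis_def scaleR_complex)
  have "c i = c j" for i j
  proof (cases "i = j")
    case False
    have "axis i 1 + axis j 1 \<noteq> (0 :: complex^4)"
      using False by (auto simp: vec_eq_iff axis_def intro!: exI[of _ i])
    then obtain d where d: "H *v (axis i 1 + axis j 1) = d *\<^sub>R (axis i 1 + axis j 1)" using 2 by blast
    have "c i *\<^sub>R axis i 1 + c j *\<^sub>R axis j 1 = d *\<^sub>R (axis i 1 + axis j 1 :: complex^4)"
      using d unfolding matrix_vector_right_distrib c .
    then have "(c i *\<^sub>R axis i 1 + c j *\<^sub>R axis j 1) $ k = (d *\<^sub>R (axis i 1 + axis j 1 :: complex^4)) $ k" for k by simp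
    from this[of i] this[of j] show ?thesis using False by (simp add: axis_def scaleR_complex)
  qed simp
  then have "H = mat (of_real (c 1))" by (simp add: vec_eq_iff mat_def ent)
  then show ?thesis by blast
qed

text \<open>
  Here \<open>N = \<mu>\<close> on the sphere, so that \<open>\<eta> = -2 \<theta>\<^sub>0\<close>.
\<close>

lemma scalar_consequences:
  assumes "H = mat (complex_of_real \<mu>)" "z \<in> S7"
  shows "v \<in> tangent z \<Longrightarrow> rho z v = 0" and "W5M M z = 0"
proof -
  have Hz: "H *v z = of_real \<mu> *s z"
    unfolding assms(1) by (simp add: vec_eq_iff matrix_vector_mult_def mat_def if_distrib[of "\<lambda>x. x * _"] cong: if_cong)
  have m: "m v (b z) = of_real \<mu> * herm z v" for v
    by (simp add: m_sharp_hermitian Hz herm_linear)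
  show "v \<in> tangent z \<Longrightarrow> rho z v = 0"
    by (simp add: rho_nsq m tangent_def inner_herm)
  have "nsq z = of_real \<mu>" using assms(2) by (simp add: norm_sq_alphaM m herm_self)
  then have "eta_fun M z v = - 2 * herm z v" for v
    using nsq_nonzero[OF S7_nonzero[OF assms(2)]] by (simp add: eta_fun_def m_skew[of "b z"] m invn_eq)
  then have "e z = scl (- 2) (cov (herm z))"
    unfolding cov_linear(3)[symmetric] by (intro arg_cong[where f = cov]) (simp add: fun_eq_iff)
  then show "W5M M z = 0"
    by (simp add: W5M_def etaM_cov[OF skew] scale_form_scl) (simp add: fun_eq_iff scl_def)
qed

lemma torsion_classes_unique:
  assumes "torsion_classes (OmegaM M) (omegaM M) W\<^sub>1 W\<^sub>2 W\<^sub>3 W\<^sub>4 W\<^sub>5"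
  shows "\<And>z. z \<in> S7 \<Longrightarrow> W\<^sub>1 z = W1M M z" "W\<^sub>2 =\<^sub>S W2M M" "W\<^sub>3 =\<^sub>S W3M M" "W\<^sub>4 =\<^sub>S - Re_form \<eta>" "W\<^sub>5 =\<^sub>S W5M M"
  unfolding eq_forms_restr
  by (safe, (erule adapted_frame_elim, drule adapted_frame.torsion_unique_at[OF _ assms torsion_classes_OmegaM], simp)+)

lemma Re_eta_vanishes_iff: "- Re_form \<eta> =\<^sub>S 0 \<longleftrightarrow> (\<forall>z\<in>S7. \<forall>v\<in>tangent z. rho z v = 0)"
proof
  assume l: "- Re_form \<eta> =\<^sub>S 0"
  show "\<forall>z\<in>S7. \<forall>v\<in>tangent z. rho z v = 0"
  proof (intro ballI)
    fix z v assume "z \<in> S7" "v \<in> tangent z"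
    then have "(- Re_form \<eta>) z [v] = (0 :: form) z [v]" using l by (simp add: eq_forms_on_def)
    then show "rho z v = 0" by (simp add: Re_form_eta cov_values)
  qed
next
  assume r: "\<forall>z\<in>S7. \<forall>v\<in>tangent z. rho z v = 0"
  show "- Re_form \<eta> =\<^sub>S 0"
    unfolding eq_forms_restr
  proof
    fix z assume "z \<in> S7"
    then have "cov (\<lambda>v. if v \<in> tangent z then rho z v else 0) vs = 0" for vs
      using r by (auto simp: cov_def split: list.split)
    then show "restr (tangent z) ((- Re_form \<eta>) z) = restr (tangent z) ((0 :: form) z)"
      by (simp add: Re_form_eta restr_linear restr_cov fun_eq_iff)
  qed
qed

end

theorem theorem9:
  fixes M :: "complex^4^4"
  assumes "transpose M = - M" and "invertible M"
  shows "(\<exists>lam. is_lambdaM M lam) \<and>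
    (\<forall>lam. is_lambdaM M lam \<longrightarrow>
      (\<forall>z\<in>S7. lam z \<noteq> 0) \<and>
      (\<exists>W\<^sub>1 W\<^sub>2 W\<^sub>3 W\<^sub>4 W\<^sub>5. torsion_classes (OmegaM M) (omegaM M) W\<^sub>1 W\<^sub>2 W\<^sub>3 W\<^sub>4 W\<^sub>5) \<and>
      (\<forall>W\<^sub>1 W\<^sub>2 W\<^sub>3 W\<^sub>4 W\<^sub>5. torsion_classes (OmegaM M) (omegaM M) W\<^sub>1 W\<^sub>2 W\<^sub>3 W\<^sub>4 W\<^sub>5 \<longrightarrow>
        (\<forall>z\<in>S7. W\<^sub>1 z = 4 / 3 * cnj (lam z)) \<and>
        W\<^sub>2 \<and>\<^sub>f omegaM M =\<^sub>S
          (\<lambda>z. W\<^sub>1 z / 2) *\<^sub>f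
            ((omegaM M + (\<lambda>z. 3 * \<i> / 2 * inv_norm_sq M z) *\<^sub>f alpha_alphabar M) \<and>\<^sub>f omegaM M)
          + (\<lambda>z. \<i> * cnj (lam z) * inv_norm_sq M z) *\<^sub>f (alpha_alphabar M \<and>\<^sub>f omega0)
          + (\<lambda>z. 1 / lam z * inv_norm_sq M z) *\<^sub>f (alpha_alphabar M \<and>\<^sub>f ext_d (etaM M)) \<and>
        W\<^sub>3 =\<^sub>S
          Re_form (etaM M) \<and>\<^sub>f
            (omegaM M + (\<lambda>z. \<i> * inv_norm_sq M z) *\<^sub>f alpha_alphabar M) \<and>
        W\<^sub>4 =\<^sub>S - Re_form (etaM M) \<and>
        cnj_form W\<^sub>5 \<and>\<^sub>f OmegaM M =\<^sub>S ((\<lambda>_. - 2) *\<^sub>f Re_form (etaM M)) \<and>\<^sub>f OmegaM M \<and>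
        ((W\<^sub>3 =\<^sub>S 0 \<and> W\<^sub>4 =\<^sub>S 0 \<and> W\<^sub>5 =\<^sub>S 0) \<longleftrightarrow>
          (\<exists>\<mu>::real. conj_transpose M ** M = mat (complex_of_real \<mu>))) \<and>
        ((W\<^sub>3 =\<^sub>S 0 \<and> W\<^sub>4 =\<^sub>S 0 \<and> W\<^sub>5 =\<^sub>S 0) \<longrightarrow>
          W\<^sub>2 =\<^sub>S
            (\<lambda>z. W\<^sub>1 z / 2) *\<^sub>f
              (omegaM M + (\<lambda>z. 3 * \<i> / 2 * inv_norm_sq M z) *\<^sub>f alpha_alphabar M))))"
proof -
  interpret invertible_skew M using assms by unfold_locales
  have sym: "\<gamma> =\<^sub>S \<beta>" if "\<beta> =\<^sub>S \<gamma>" for \<beta> \<gamma> using that by (simp add: eq_forms_on_def)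
  have tr: "\<beta> =\<^sub>S \<delta>" if "\<beta> =\<^sub>S \<gamma>" "\<gamma> =\<^sub>S \<delta>" for \<beta> \<gamma> \<delta> using that by (simp add: eq_forms_on_def)
  show ?thesis
  proof (intro conjI allI impI)
    show "\<exists>lam. is_lambdaM M lam" using is_lambdaM_lambda by blast
    fix lam assume lam: "is_lambdaM M lam"
    note L = is_lambdaM_unique[OF lam]
    show "\<forall>z\<in>S7. lam z \<noteq> 0" using L lambda_nonzero S7_nonzero by simp
    show "\<exists>W\<^sub>1 W\<^sub>2 W\<^sub>3 W\<^sub>4 W\<^sub>5. torsion_classes (OmegaM M) (omegaM M) W\<^sub>1 W\<^sub>2 W\<^sub>3 W\<^sub>4 W\<^sub>5"
      using torsion_classes_OmegaM by blast
    fix W\<^sub>1 W\<^sub>2 W\<^sub>3 W\<^sub>4 W\<^sub>5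
    assume W: "torsion_classes (OmegaM M) (omegaM M) W\<^sub>1 W\<^sub>2 W\<^sub>3 W\<^sub>4 W\<^sub>5"
    note U = torsion_classes_unique[OF W]
    show "\<forall>z\<in>S7. W\<^sub>1 z = 4 / 3 * cnj (lam z)"
      using U(1) L by (simp add: W1M_lambda)
    show W2: "W\<^sub>2 =\<^sub>S (\<lambda>z. W\<^sub>1 z / 2) *\<^sub>f (omegaM M + (\<lambda>z. 3 * \<i> / 2 * inv_norm_sq M z) *\<^sub>f alpha_alphabar M)"
      using U(1,2) by (simp add: eq_forms_on_def W2M_def scale_form_def)
    show "W\<^sub>3 =\<^sub>S Re_form (etaM M) \<and>\<^sub>f (omegaM M + (\<lambda>z. \<i> * inv_norm_sq M z) *\<^sub>f alpha_alphabar M)"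
      using U(3) by (simp add: W3M_def)
    show "W\<^sub>4 =\<^sub>S - Re_form (etaM M)" by (rule U(4))
    show "W\<^sub>2 \<and>\<^sub>f omegaM M =\<^sub>S
          (\<lambda>z. W\<^sub>1 z / 2) *\<^sub>f
            ((omegaM M + (\<lambda>z. 3 * \<i> / 2 * inv_norm_sq M z) *\<^sub>f alpha_alphabar M) \<and>\<^sub>f omegaM M)
          + (\<lambda>z. \<i> * cnj (lam z) * inv_norm_sq M z) *\<^sub>f (alpha_alphabar M \<and>\<^sub>f omega0)
          + (\<lambda>z. 1 / lam z * inv_norm_sq M z) *\<^sub>f (alpha_alphabar M \<and>\<^sub>f ext_d (etaM M))"
      unfolding eq_forms_restr
    proof
      fix z assume zS: "z \<in> S7"
      then obtain f1 f2 f3 where "adapted_frame M z f1 f2 f3" by (rule adapted_frame_exists)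
      then interpret adapted_frame M z f1 f2 f3 .
      let ?x = "omegaM M z + scl (3 * \<i> / 2 * invn z) (alpha_alphabar M z)"
      have w: "R (W\<^sub>2 z) = scl (W\<^sub>1 z / 2) (R ?x)"
        using bspec[OF iffD1[OF eq_forms_restr W2] zS] by (simp add: scale_form_scl restr_linear)
      have c: "1 / lambda z * invn z * (- \<i> * lambda z * cnj (lambda z)) = - (\<i> * cnj (lambda z) * invn z)"
        using lambda_nonzero[OF z_nonzero] by simp
      have "R (scl (1 / lambda z * invn z) (a z \<odot> ac z \<odot> ext_d \<eta> z)) = - R (scl (\<i> * cnj (lambda z) * invn z) (a z \<odot> ac z \<odot> omega0 z))"
        unfolding restr_linear R_alpha_deta_omega0 scl_scl c by (simp add: fun_eq_iff scl_def)
      then show "R ((W\<^sub>2 \<and>\<^sub>f omegaM M) z) = R (((\<lambda>z. W\<^sub>1 z / 2) *\<^sub>f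
            ((omegaM M + (\<lambda>z. 3 * \<i> / 2 * inv_norm_sq M z) *\<^sub>f alpha_alphabar M) \<and>\<^sub>f omegaM M)
          + (\<lambda>z. \<i> * cnj (lam z) * inv_norm_sq M z) *\<^sub>f (alpha_alphabar M \<and>\<^sub>f omega0)
          + (\<lambda>z. 1 / lam z * inv_norm_sq M z) *\<^sub>f (alpha_alphabar M \<and>\<^sub>f ext_d (etaM M))) z)"
        unfolding plus_fun_apply wedge_emul scale_form_scl restr_linear restr_emul w L[OF zS] alpha_alphabar_eq
        by (simp add: restr_emul emul_assoc emul_linear restr_linear)
    qed
    show "cnj_form W\<^sub>5 \<and>\<^sub>f OmegaM M =\<^sub>S ((\<lambda>_. - 2) *\<^sub>f Re_form (etaM M)) \<and>\<^sub>f OmegaM M"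
      unfolding eq_forms_restr
    proof
      fix z assume zS: "z \<in> S7"
      then obtain f1 f2 f3 where "adapted_frame M z f1 f2 f3" by (rule adapted_frame_exists)
      then interpret adapted_frame M z f1 f2 f3 .
      have "R (conj_ext (W\<^sub>5 z)) = - (scl (cnj c2) Q2 + scl (cnj c3) Q3)"
        using bspec[OF iffD1[OF eq_forms_restr U(5)] zS]
        by (simp add: conj_restr[symmetric] R_W5 conj_ext_linear R_conj)
      then show "R ((cnj_form W\<^sub>5 \<and>\<^sub>f OmegaM M) z) = R ((((\<lambda>_. - 2) *\<^sub>f Re_form (etaM M)) \<and>\<^sub>f OmegaM M) z)"
        unfolding wedge_emul scale_form_scl cnj_form_conj_ext Re_form_eta restr_emul restr_linear R_rho R_Omega
        by (simp only: R_simps) (simp add: fun_eq_iff scl_def)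
    qed
    show "(W\<^sub>3 =\<^sub>S 0 \<and> W\<^sub>4 =\<^sub>S 0 \<and> W\<^sub>5 =\<^sub>S 0) \<longleftrightarrow>
          (\<exists>\<mu>::real. conj_transpose M ** M = mat (complex_of_real \<mu>))"
    proof
      assume "W\<^sub>3 =\<^sub>S 0 \<and> W\<^sub>4 =\<^sub>S 0 \<and> W\<^sub>5 =\<^sub>S 0"
      then have "- Re_form \<eta> =\<^sub>S 0" using tr[OF sym[OF U(4)]] by blast
      then show "\<exists>\<mu>::real. conj_transpose M ** M = mat (complex_of_real \<mu>)"
        unfolding Re_eta_vanishes_iff by (intro scalar_if_rho_vanishes) auto
    next
      assume "\<exists>\<mu>::real. conj_transpose M ** M = mat (complex_of_real \<mu>)"
      then obtain \<mu> :: real where \<mu>: "H = mat (complex_of_real \<mu>)" by blast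
      have r: "- Re_form \<eta> =\<^sub>S 0"
        unfolding Re_eta_vanishes_iff using scalar_consequences(1)[OF \<mu>] by blast
      have "W3M M =\<^sub>S 0"
        unfolding eq_forms_restr
      proof
        fix z assume zS: "z \<in> S7"
        have "restr (tangent z) (cov (rho z)) = 0"
          using bspec[OF iffD1[OF eq_forms_restr r] zS] by (simp add: Re_form_eta restr_linear)
        then show "restr (tangent z) (W3M M z) = restr (tangent z) ((0 :: form) z)"
          by (simp add: W3M_def wedge_emul restr_emul Re_form_eta emul_linear restr_linear)
      qed
      moreover have "W5M M =\<^sub>S 0"
        unfolding eq_forms_restr using scalar_consequences(2)[OF \<mu>] by simp
      ultimately show "W\<^sub>3 =\<^sub>S 0 \<and> W\<^sub>4 =\<^sub>S 0 \<and> W\<^sub>5 =\<^sub>S 0"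
        using tr[OF U(3)] tr[OF U(4) r] tr[OF U(5)] by blast
    qed
  qed
qed

end
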